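(* Let $p(y_1,y_2|x_1,x_2)$ be a discrete memoryless interference channel and let $(U_1,V_1)\sim p(u_1,v_1)$, $(U_2,V_2)\sim p(u_2,v_2)$ be mutually independent source/side-information pairs on finite alphabets. Sources $U_1$ and $U_2$ can be transmitted reliably over the channel with side information $V_1$ at Receiver 2 and $V_2$ at Receiver 1 if there exist finite-alphabet random variables $Q,W_1,W_2$ and distributions $p(q)$, $p(w_1,x_1|u_1,q)$, $p(w_2,x_2|u_2,q)$ such that \begin{align*} H(U_1) &< I(X_1;V_2,Y_1|W_2,Q),\\ H(U_2) &< I(X_2;V_1,Y_2|W_1,Q),\\ H(U_1) &< I(W_2,X_1;V_2,Y_1|Q)-I(U_2;W_2|Q),\\ H(U_2) &< I(W_1,X_2;V_1,Y_2|Q)-I(U_1;W_1|Q),\\ H(U_1)+H(U_2) &< I(X_1;V_2,Y_1|W_1,W_2,Q)+I(W_1,X_2;V_1,Y_2|Q),\\ H(U_1)+H(U_2) &< I(X_2;V_1,Y_2|W_1,W_2,Q)+I(W_2,X_1;V_2,Y_1|Q),\\ H(U_1)+H(U_2) &< I(W_1,X_2;V_1,Y_2|W_2,Q)+I(W_2,X_1;V_2,Y_1|W_1,Q),\\ H(U_1)+H(U_2) &< I(W_2,X_1;V_2,Y_1|Q)+I(W_1,X_2;V_1,Y_2|W_2,Q)-I(U_1;W_1|Q),\\ H(U_1)+H(U_2) &< I(W_1,X_2;V_1,Y_2|Q)+I(W_2,X_1;V_2,Y_1|W_1,Q)-I(U_2;W_2|Q),\\ 2H(U_1)+H(U_2)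 &< I(W_2,X_1;V_2,Y_1|Q)+I(X_1;V_2,Y_1|W_1,W_2,Q)+I(W_1,X_2;V_1,Y_2|W_2,Q),\\ H(U_1)+2H(U_2) &< I(W_1,X_2;V_1,Y_2|Q)+I(X_2;V_1,Y_2|W_1,W_2,Q)+I(W_2,X_1;V_2,Y_1|W_1,Q), \end{align*} where the entropies and mutual informations are evaluated using the joint distribution $$p(q,u_1,v_1,u_2,v_2,w_1,w_2,x_1,x_2,y_1,y_2)=p(q)\,p(u_1,v_1)\,p(u_2,v_2)\,p(w_1,x_1|u_1,q)\,p(w_2,x_2|u_2,q)\,p(y_1,y_2|x_1,x_2).$$
   Context: Channel: a discrete memoryless interference channel has finite input alphabets $\mathcal{X}_1,\mathcal{X}_2$, finite output alphabets $\mathcal{Y}_1,\mathcal{Y}_2$, and transition probability $p(y_1,y_2|x_1,x_2)$; $n$ uses of the channel are governed by the product law $\prod_{i=1}^n p(y_{1,i},y_{2,i}|x_{1,i},x_{2,i})$. Logarithms are base 2. Notation: $A^n=(A_1,\dots,A_n)$. Sources: $(U_{1,i},V_{1,i},U_{2,i},V_{2,i})_{i\ge1}$ are i.i.d. with law $p(u_1,v_1)p(u_2,v_2)$ on the finite alphabet $\mathcal{U}_1\times\mathcal{V}_1\times\mathcal{U}_2\times\mathcal{V}_2$. Source-channel code (side information correlated with the interfering source): Transmitter $k$ observes $U_k^n$ and sends $X_k^n=f_k^n(U_k^n)$, where $f_k^n:\mathcal{U}_k^n\to\mathcal{X}_k^n$. Receiver 1 outputs $\hat U_1^n=g_1^n(Y_1^n,V_2^n)$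 with $g_1^n:\mathcal{Y}_1^n\times\mathcal{V}_2^n\to\mathcal{U}_1^n$, and Receiver 2 outputs $\hat U_2^n=g_2^n(Y_2^n,V_1^n)$ with $g_2^n:\mathcal{Y}_2^n\times\mathcal{V}_1^n\to\mathcal{U}_2^n$. The error probability is $P_e^n=\Pr\{(U_1^n,U_2^n)\ne(\hat U_1^n,\hat U_2^n)\}$. The sources can be transmitted reliably if there is a sequence $(f_1^n,f_2^n,g_1^n,g_2^n)$ with $P_e^n\to0$ as $n\to\infty$. *)

theory Defs
  imports "HOL-Probability.Probability"
begin

text \<open>A random variable is a function on the sample space of a pmf, and the
  codomain carries the counting measure on its range, as in the library's
  \<open>entropy_Pow\<close> and \<open>conditional_mutual_information_Pow\<close>.\<close>

definition pmf_entropy :: "'a pmf \<Rightarrow> ('a \<Rightarrow> 'b) \<Rightarrow> real" where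
  "pmf_entropy p X =
     prob_space.entropy (measure_pmf p) 2 (count_space (X ` space (measure_pmf p))) X"

definition pmf_cmi :: "'a pmf \<Rightarrow> ('a \<Rightarrow> 'b) \<Rightarrow> ('a \<Rightarrow> 'c) \<Rightarrow> ('a \<Rightarrow> 'd) \<Rightarrow> real" where
  "pmf_cmi p X Y Z =
     prob_space.conditional_mutual_information (measure_pmf p) 2
       (count_space (X ` space (measure_pmf p)))
       (count_space (Y ` space (measure_pmf p)))
       (count_space (Z ` space (measure_pmf p))) X Y Z"

text \<open>Conditional laws are pmf-valued functions: \<open>e1 u1 q\<close> is \<open>p(w1,x1|u1,q)\<close>,
  \<open>e2 u2 q\<close> is \<open>p(w2,x2|u2,q)\<close>, and \<open>ch x1 x2\<close> is \<open>p(y1,y2|x1,x2)\<close>.\<close>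

definition joint_law ::
  "'q pmf \<Rightarrow> ('u1 \<times> 'v1) pmf \<Rightarrow> ('u2 \<times> 'v2) pmf
   \<Rightarrow> ('u1 \<Rightarrow> 'q \<Rightarrow> ('w1 \<times> 'x1) pmf) \<Rightarrow> ('u2 \<Rightarrow> 'q \<Rightarrow> ('w2 \<times> 'x2) pmf)
   \<Rightarrow> ('x1 \<Rightarrow> 'x2 \<Rightarrow> ('y1 \<times> 'y2) pmf)
   \<Rightarrow> ('q \<times> 'u1 \<times> 'v1 \<times> 'u2 \<times> 'v2 \<times> 'w1 \<times> 'w2 \<times> 'x1 \<times> 'x2 \<times> 'y1 \<times> 'y2) pmf" where
  "joint_law pq s1 s2 e1 e2 ch =
     do {
       q \<leftarrow> pq;
       (u1, v1) \<leftarrow> s1;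
       (u2, v2) \<leftarrow> s2;
       (w1, x1) \<leftarrow> e1 u1 q;
       (w2, x2) \<leftarrow> e2 u2 q;
       (y1, y2) \<leftarrow> ch x1 x2;
       return_pmf (q, u1, v1, u2, v2, w1, w2, x1, x2, y1, y2)
     }"

lemma pmf_bind_inj_point:
  assumes "\<And>x. x \<noteq> a \<Longrightarrow> pmf (f x) z = 0"
  shows "pmf (bind_pmf p f) z = pmf p a * pmf (f a) z"
proof -
  have "pmf (bind_pmf p f) z = (\<integral>x. pmf (f x) z \<partial>measure_pmf p)"
    by (rule pmf_bind)
  also have "\<dots> = (\<integral>x. pmf (f a) z * indicator {a} x \<partial>measure_pmf p)"
    by (rule Bochner_Integration.integral_cong) (auto simp: indicator_def assms)
  also have "\<dots> = pmf p a * pmf (f a) z"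
    by (simp add: measure_pmf_single)
  finally show ?thesis .
qed

lemma pmf_joint_law:
  "pmf (joint_law pq s1 s2 e1 e2 ch) (q, u1, v1, u2, v2, w1, w2, x1, x2, y1, y2) =
     pmf pq q * pmf s1 (u1, v1) * pmf s2 (u2, v2)
     * pmf (e1 u1 q) (w1, x1) * pmf (e2 u2 q) (w2, x2) * pmf (ch x1 x2) (y1, y2)"
  unfolding joint_law_def
  apply (subst pmf_bind_inj_point[where a = q])
   apply (force simp: pmf_eq_0_set_pmf split: prod.splits)
  apply (subst pmf_bind_inj_point[where a = "(u1, v1)"])
   apply (force simp: pmf_eq_0_set_pmf split: prod.splits)
  apply (simp only: prod.case)
  apply (subst pmf_bind_inj_point[where a = "(u2, v2)"])
   apply (force simp: pmf_eq_0_set_pmf split: prod.splits)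
  apply (simp only: prod.case)
  apply (subst pmf_bind_inj_point[where a = "(w1, x1)"])
   apply (force simp: pmf_eq_0_set_pmf split: prod.splits)
  apply (simp only: prod.case)
  apply (subst pmf_bind_inj_point[where a = "(w2, x2)"])
   apply (force simp: pmf_eq_0_set_pmf split: prod.splits)
  apply (simp only: prod.case)
  apply (subst pmf_bind_inj_point[where a = "(y1, y2)"])
   apply (auto simp: pmf_eq_0_set_pmf split: prod.splits)[1]
  apply simp
  done

definition "rvQ  = (\<lambda>(q, u1, v1, u2, v2, w1, w2, x1, x2, y1, y2). q)"
definition "rvU1 = (\<lambda>(q, u1, v1, u2, v2, w1, w2, x1, x2, y1, y2). u1)"
definition "rvV1 = (\<lambda>(q, u1, v1, u2, v2, w1, w2, x1, x2, y1, y2). v1)"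
definition "rvU2 = (\<lambda>(q, u1, v1, u2, v2, w1, w2, x1, x2, y1, y2). u2)"
definition "rvV2 = (\<lambda>(q, u1, v1, u2, v2, w1, w2, x1, x2, y1, y2). v2)"
definition "rvW1 = (\<lambda>(q, u1, v1, u2, v2, w1, w2, x1, x2, y1, y2). w1)"
definition "rvW2 = (\<lambda>(q, u1, v1, u2, v2, w1, w2, x1, x2, y1, y2). w2)"
definition "rvX1 = (\<lambda>(q, u1, v1, u2, v2, w1, w2, x1, x2, y1, y2). x1)"
definition "rvX2 = (\<lambda>(q, u1, v1, u2, v2, w1, w2, x1, x2, y1, y2). x2)"
definition "rvY1 = (\<lambda>(q, u1, v1, u2, v2, w1, w2, x1, x2, y1, y2). y1)"
definition "rvY2 = (\<lambda>(q, u1, v1, u2, v2, w1, w2, x1, x2, y1, y2). y2)"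

definition rv_pair :: "('a \<Rightarrow> 'b) \<Rightarrow> ('a \<Rightarrow> 'c) \<Rightarrow> 'a \<Rightarrow> 'b \<times> 'c"  (infixr \<open>\<otimes>\<^sub>r\<close> 80) where
  "(X \<otimes>\<^sub>r Y) = (\<lambda>\<omega>. (X \<omega>, Y \<omega>))"

text \<open>An \<open>n\<close>-block is a function on \<open>{..<n}\<close>, extended by \<open>undefined\<close> so that blocks are equal
  exactly when their \<open>n\<close> entries are.\<close>

definition blocks :: "nat \<Rightarrow> (nat \<Rightarrow> 'a) set" where
  "blocks n = {..<n} \<rightarrow>\<^sub>E UNIV"

definition source_blocks ::
  "('u1 \<times> 'v1) pmf \<Rightarrow> ('u2 \<times> 'v2) pmf \<Rightarrow> nat \<Rightarrow> (nat \<Rightarrow> ('u1 \<times> 'v1) \<times> ('u2 \<times> 'v2)) pmf" where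
  "source_blocks s1 s2 n = Pi_pmf {..<n} undefined (\<lambda>_. pair_pmf s1 s2)"

definition channel_blocks ::
  "('x1 \<Rightarrow> 'x2 \<Rightarrow> ('y1 \<times> 'y2) pmf) \<Rightarrow> nat \<Rightarrow> (nat \<Rightarrow> 'x1) \<Rightarrow> (nat \<Rightarrow> 'x2) \<Rightarrow> (nat \<Rightarrow> 'y1 \<times> 'y2) pmf" where
  "channel_blocks ch n x1 x2 = Pi_pmf {..<n} undefined (\<lambda>i. ch (x1 i) (x2 i))"

definition is_code ::
  "nat \<Rightarrow> ((nat \<Rightarrow> 'u1) \<Rightarrow> (nat \<Rightarrow> 'x1)) \<Rightarrow> ((nat \<Rightarrow> 'u2) \<Rightarrow> (nat \<Rightarrow> 'x2))
   \<Rightarrow> ((nat \<Rightarrow> 'y1) \<times> (nat \<Rightarrow> 'v2) \<Rightarrow> (nat \<Rightarrow> 'u1)) \<Rightarrow> ((nat \<Rightarrow> 'y2) \<times> (nat \<Rightarrow> 'v1) \<Rightarrow> (nat \<Rightarrow> 'u2))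
   \<Rightarrow> bool" where
  "is_code n f1 f2 g1 g2 \<longleftrightarrow>
     f1 \<in> blocks n \<rightarrow> blocks n \<and>
     f2 \<in> blocks n \<rightarrow> blocks n \<and>
     g1 \<in> blocks n \<times> blocks n \<rightarrow> blocks n \<and>
     g2 \<in> blocks n \<times> blocks n \<rightarrow> blocks n"

definition transmission_law ::
  "('u1 \<times> 'v1) pmf \<Rightarrow> ('u2 \<times> 'v2) pmf \<Rightarrow> ('x1 \<Rightarrow> 'x2 \<Rightarrow> ('y1 \<times> 'y2) pmf) \<Rightarrow> nat
   \<Rightarrow> ((nat \<Rightarrow> 'u1) \<Rightarrow> (nat \<Rightarrow> 'x1)) \<Rightarrow> ((nat \<Rightarrow> 'u2) \<Rightarrow> (nat \<Rightarrow> 'x2))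
   \<Rightarrow> ((nat \<Rightarrow> 'y1) \<times> (nat \<Rightarrow> 'v2) \<Rightarrow> (nat \<Rightarrow> 'u1)) \<Rightarrow> ((nat \<Rightarrow> 'y2) \<times> (nat \<Rightarrow> 'v1) \<Rightarrow> (nat \<Rightarrow> 'u2))
   \<Rightarrow> (((nat \<Rightarrow> 'u1) \<times> (nat \<Rightarrow> 'u2)) \<times> ((nat \<Rightarrow> 'u1) \<times> (nat \<Rightarrow> 'u2))) pmf" where
  "transmission_law s1 s2 ch n f1 f2 g1 g2 =
     do {
       s \<leftarrow> source_blocks s1 s2 n;
       let u1 = (\<lambda>i\<in>{..<n}. fst (fst (s i)));
       let v1 = (\<lambda>i\<in>{..<n}. snd (fst (s i)));
       let u2 = (\<lambda>i\<in>{..<n}. fst (snd (s i)));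
       let v2 = (\<lambda>i\<in>{..<n}. snd (snd (s i)));
       y \<leftarrow> channel_blocks ch n (f1 u1) (f2 u2);
       let y1 = (\<lambda>i\<in>{..<n}. fst (y i));
       let y2 = (\<lambda>i\<in>{..<n}. snd (y i));
       return_pmf ((u1, u2), (g1 (y1, v2), g2 (y2, v1)))
     }"

definition error_prob ::
  "('u1 \<times> 'v1) pmf \<Rightarrow> ('u2 \<times> 'v2) pmf \<Rightarrow> ('x1 \<Rightarrow> 'x2 \<Rightarrow> ('y1 \<times> 'y2) pmf) \<Rightarrow> nat
   \<Rightarrow> ((nat \<Rightarrow> 'u1) \<Rightarrow> (nat \<Rightarrow> 'x1)) \<Rightarrow> ((nat \<Rightarrow> 'u2) \<Rightarrow> (nat \<Rightarrow> 'x2))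
   \<Rightarrow> ((nat \<Rightarrow> 'y1) \<times> (nat \<Rightarrow> 'v2) \<Rightarrow> (nat \<Rightarrow> 'u1)) \<Rightarrow> ((nat \<Rightarrow> 'y2) \<times> (nat \<Rightarrow> 'v1) \<Rightarrow> (nat \<Rightarrow> 'u2))
   \<Rightarrow> real" where
  "error_prob s1 s2 ch n f1 f2 g1 g2 =
     measure_pmf.prob (transmission_law s1 s2 ch n f1 f2 g1 g2) {(u, uhat). u \<noteq> uhat}"

definition reliably_transmissible ::
  "('u1 \<times> 'v1) pmf \<Rightarrow> ('u2 \<times> 'v2) pmf \<Rightarrow> ('x1 \<Rightarrow> 'x2 \<Rightarrow> ('y1 \<times> 'y2) pmf) \<Rightarrow> bool" where
  "reliably_transmissible s1 s2 ch \<longleftrightarrow>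
     (\<exists>f1 f2 g1 g2.
        (\<forall>n. is_code n (f1 n) (f2 n) (g1 n) (g2 n)) \<and>
        (\<lambda>n. error_prob s1 s2 ch n (f1 n) (f2 n) (g1 n) (g2 n)) \<longlonglongrightarrow> 0)"

end

theory Submission
  imports Defs
begin

text \<open>Random coding with superposition. User \<open>k\<close> holds \<open>M\<^sub>k \<approx> 2\<^sup>n\<^sup>R\<close> independent words \<open>w(m)\<close>. Each
  source word \<open>u\<close> picks an index with probability about \<open>p(w(m)|u) / (M p(w(m)))\<close> and then a channel
  input from \<open>p(x|u,w(m))\<close>. Because the index probabilities are bounded by this likelihood ratio,
  every average over the codebooks is dominated by the ideal memoryless law, so that neither a
  Markov lemma nor a conditional covering argument is needed; indexing fails with vanishing
  probability when \<open>R > I(U;W|Q)\<close>, by a second-moment bound on a truncated likelihood ratio.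

  Receiver 1 looks for the only source word that is jointly typical with the observations for some
  word of the other user. With typicality defined by thresholds on products of information
  densities, the union bound needs only Markov's inequality, and the true pair is missed with
  exponentially small probability by Chernoff's bound. This works when
  \<open>H(U\<^sub>1) - R\<^sub>1 < I(X\<^sub>1;V\<^sub>2,Y\<^sub>1|W\<^sub>1,W\<^sub>2,Q)\<close>, \<open>H(U\<^sub>1) < I(X\<^sub>1;V\<^sub>2,Y\<^sub>1|W\<^sub>2,Q)\<close>,
  \<open>H(U\<^sub>1) - R\<^sub>1 + R\<^sub>2 < I(W\<^sub>2,X\<^sub>1;V\<^sub>2,Y\<^sub>1|W\<^sub>1,Q)\<close> and \<open>H(U\<^sub>1) + R\<^sub>2 < I(W\<^sub>2,X\<^sub>1;V\<^sub>2,Y\<^sub>1|Q)\<close>.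
  Eliminating \<open>R\<^sub>1\<close> and \<open>R\<^sub>2\<close> from these, their mirror images and \<open>R\<^sub>k > I(U\<^sub>k;W\<^sub>k|Q)\<close> leaves the
  eleven stated inequalities.\<close>

\<comment> \<open>The obstacle is dependence: the indices of the true and of a wrong source word are
  drawn from the same random list, and the word that is sent is tilted by this selection. With the
  bound r(w(m)) / M on an index probability, the M possible indices cancel 1/M, and p(w) reweighted
  by r is p(w|u). Only upper bounds survive, which is what a union bound uses. The one lower bound,
  that some index is chosen, is treated separately by truncating r at B = 2^(n c) with I(U;W|Q) < c
  < R: the tail above B is rare, and the mean of M truncated ratios has variance at most B / M. The
  four conditions of a receiver match four kinds of confusion. Sharing the index of the true word
  costs a factor 1/M, hence H - R; a wrong word of the other user is one of M', hence the added
  rate. The number of source words enters through a factor p(u) in the densities, which contributes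
  H to the exponents. Weights, kernels and thresholds are products over letters, and sums and
  averages of such products factorize, so every block bound comes from a bound on one
  letter.\<close>
syntax
  "_nn_integral_pmf" :: "pttrn \<Rightarrow> ennreal \<Rightarrow> 'a pmf \<Rightarrow> ennreal"
    (\<open>(2\<integral>\<^sub>p _./ _ \<partial>_)\<close> [60, 61] 110)
translations
  "\<integral>\<^sub>p x. f \<partial>p" \<rightleftharpoons> "CONST nn_integral (CONST measure_pmf p) (\<lambda>x. f)"

section \<open>Averages over products of probability mass functions\<close>

text \<open>Both orders are averages over \<open>pair_pmf\<close>, which is commutative up to
  swapping components. With values in \<open>ennreal\<close> there is no integrability to check, so
  averages are exchanged by plain rewriting throughout.\<close>

lemma nn_integral_pmf_swap:
  "(\<integral>\<^sub>px. \<integral>\<^sub>py. f x y \<partial>q \<partial>p) = (\<integral>\<^sub>py. \<integral>\<^sub>px. f x y \<partial>p \<partial>q)"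
proof -
  have "(\<integral>\<^sub>px. \<integral>\<^sub>py. f x y \<partial>q \<partial>p) = (\<integral>\<^sub>pz. f (fst z) (snd z) \<partial>(pair_pmf p q))"
    by (simp add: nn_integral_pair_pmf')
  also have "\<dots> = (\<integral>\<^sub>pz. f (snd z) (fst z) \<partial>(pair_pmf q p))"
    by (subst pair_commute_pmf) (simp add: case_prod_unfold)
  also have "\<dots> = (\<integral>\<^sub>py. \<integral>\<^sub>px. f x y \<partial>p \<partial>q)"
    by (simp add: nn_integral_pair_pmf')
  finally show ?thesis .
qed

lemma nn_integral_pmf_const [simp]: "(\<integral>\<^sub>px. c \<partial>p) = c"
  by (simp add: measure_pmf.emeasure_space_1)

lemma nn_integral_pmf_le_const:
  assumes "\<And>x. f x \<le> c"
  shows "(\<integral>\<^sub>px. f x \<partial>p) \<le> c"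
  using nn_integral_mono[of "measure_pmf p" f "\<lambda>_. c"] assms by simp

text \<open>Derandomization: if every value exceeded \<open>c\<close>, so would the average. It is
  used to fix the time-sharing block and then the two codebooks.\<close>

lemma nn_integral_pmf_le_imp_ex:
  assumes "(\<integral>\<^sub>px. f x \<partial>p) \<le> c"
  obtains x where "f x \<le> c"
proof (rule ccontr)
  assume "\<not> thesis"
  then have gt: "c < f x" for x
    using that by (meson not_le)
  then have "c \<noteq> \<top>"
    by (metis top.extremum_strict)
  then have "(\<integral>\<^sub>px. c \<partial>p) < (\<integral>\<^sub>px. f x \<partial>p)"
    using gt set_pmf_not_empty[of p]
    by (intro nn_integral_less) (auto simp: AE_measure_pmf_iff not_le less_imp_le)
  with assms show False
    by simp
qed

lemma nn_integral_Pi_pmf_component: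
  assumes "finite A" "i \<in> A"
  shows "(\<integral>\<^sub>pf. h (f i) \<partial>(Pi_pmf A d p)) = (\<integral>\<^sub>pa. h a \<partial>(p i))"
proof -
  have "(\<integral>\<^sub>pf. h (f i) \<partial>(Pi_pmf A d p)) = (\<integral>\<^sub>pa. h a \<partial>(map_pmf (\<lambda>f. f i) (Pi_pmf A d p)))"
    by simp
  then show ?thesis
    using assms by (simp only: Pi_pmf_component if_True)
qed

lemma nn_integral_Pi_pmf_component2:
  assumes "finite A" "i \<in> A" "j \<in> A" "i \<noteq> j"
  shows "(\<integral>\<^sub>pf. h (f i) (f j) \<partial>(Pi_pmf A d p)) = (\<integral>\<^sub>pa. \<integral>\<^sub>pb. h a b \<partial>(p j) \<partial>(p i))"
proof -
  define A' where "A' = A - {i}"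
  have A: "A = insert i A'" "i \<notin> A'" "j \<in> A'" "finite A'"
    using assms by (auto simp: A'_def)
  have "(\<integral>\<^sub>pf. h (f i) (f j) \<partial>(Pi_pmf A d p)) =
      (\<integral>\<^sub>pa. \<integral>\<^sub>pf. h a (f j) \<partial>(Pi_pmf A' d p) \<partial>(p i))"
    unfolding A(1) using A assms(4) by (simp add: Pi_pmf_insert nn_integral_pair_pmf' case_prod_unfold)
  also have "\<dots> = (\<integral>\<^sub>pa. \<integral>\<^sub>pb. h a b \<partial>(p j) \<partial>(p i))"
    using A by (simp add: nn_integral_Pi_pmf_component)
  finally show ?thesis .
qed

section \<open>Random codebooks\<close>

text \<open>Values above \<open>B\<close> become 0, not \<open>B\<close>: the lost mean is then
  exactly the tail of \<open>r\<close>, and the second moment is still at most \<open>B\<close>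
  times the mean.\<close>

definition truncated :: "real \<Rightarrow> ('w \<Rightarrow> real) \<Rightarrow> 'w \<Rightarrow> real" where
  "truncated B r x = (if r x \<le> B then r x else 0)"

definition sample_mean :: "nat \<Rightarrow> ('w \<Rightarrow> real) \<Rightarrow> (nat \<Rightarrow> 'w) \<Rightarrow> real" where
  "sample_mean M r w = (\<Sum>m<M. r (w m)) / real M"

text \<open>Index \<open>M\<close> stands for an encoding failure. The factor \<open>max 1\<close> keeps the total mass of the
  proper indices at most 1 while no index \<open>m\<close> gets more than \<open>r (w m) / M\<close>; this upper bound is
  all that the union bounds below need.\<close>

definition index_weight :: "nat \<Rightarrow> ('w \<Rightarrow> real) \<Rightarrow> (nat \<Rightarrow> 'w) \<Rightarrow> nat \<Rightarrow> real" where
  "index_weight M r w m =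
     (if m < M then r (w m) / (real M * max 1 (sample_mean M r w))
      else if m = M then 1 - min 1 (sample_mean M r w) else 0)"

definition index_pmf :: "nat \<Rightarrow> ('w \<Rightarrow> real) \<Rightarrow> (nat \<Rightarrow> 'w) \<Rightarrow> nat pmf" where
  "index_pmf M r w = embed_pmf (index_weight M r w)"

context
  fixes M :: nat and r :: "'w \<Rightarrow> real"
  assumes M: "M > 0" and r: "\<And>x. 0 \<le> r x"
begin

lemma sample_mean_nonneg: "0 \<le> sample_mean M r w"
  by (simp add: sample_mean_def r sum_nonneg)

lemma index_weight_nonneg: "0 \<le> index_weight M r w m"
  by (auto simp: index_weight_def r)

lemma pmf_index_pmf: "pmf (index_pmf M r w) m = index_weight M r w m"
  unfolding index_pmf_def
proof (rule pmf_embed_pmf[OF index_weight_nonneg])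
  have "(\<integral>\<^sup>+x. ennreal (index_weight M r w x) \<partial>count_space UNIV) = (\<integral>\<^sup>+x. ennreal (index_weight M r w x) \<partial>count_space {..M})"
    by (auto simp: nn_integral_count_space_indicator index_weight_def indicator_def intro!: nn_integral_cong)
  also have "\<dots> = ennreal (\<Sum>m\<le>M. index_weight M r w m)"
    by (simp add: nn_integral_count_space_finite sum_ennreal index_weight_nonneg)
  also have "(\<Sum>m\<le>M. index_weight M r w m) = (\<Sum>m<M. index_weight M r w m) + index_weight M r w M"
    by (simp add: lessThan_Suc_atMost[symmetric])
  also have "(\<Sum>m<M. index_weight M r w m) = sample_mean M r w / max 1 (sample_mean M r w)"
    by (simp add: index_weight_def sample_mean_def sum_divide_distrib)
  \<comment> \<open>As s / max 1 s = min 1 s, the proper indices have mass at most 1 and index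
    \<open>M\<close> receives exactly the rest.\<close>
  also have "\<dots> = min 1 (sample_mean M r w)"
    by (auto simp: min_def max_def)
  finally show "(\<integral>\<^sup>+x. ennreal (index_weight M r w x) \<partial>count_space UNIV) = 1"
    by (simp add: index_weight_def)
qed

lemma pmf_index_pmf_le:
  assumes "m < M"
  shows "pmf (index_pmf M r w) m \<le> r (w m) / real M"
proof -
  have "r (w m) / (real M * max 1 (sample_mean M r w)) \<le> r (w m) / (real M * 1)"
    using M r by (intro divide_left_mono mult_left_mono mult_pos_pos) auto
  then show ?thesis
    using assms by (simp add: pmf_index_pmf index_weight_def)
qed

lemma set_index_pmf: "m \<in> set_pmf (index_pmf M r w) \<Longrightarrow> m \<le> M"
  by (auto simp: set_pmf_eq pmf_index_pmf index_weight_def split: if_splits)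

lemma nn_integral_index_pmf_le:
  "(\<integral>\<^sub>pm. (if m < M then g m else 0) \<partial>(index_pmf M r w)) \<le> (\<Sum>m<M. ennreal (r (w m) / M) * g m)"
proof -
  have "(\<integral>\<^sub>pm. (if m < M then g m else 0) \<partial>(index_pmf M r w)) =
      (\<Sum>m\<le>M. (if m < M then g m else 0) * ennreal (pmf (index_pmf M r w) m))"
    using set_index_pmf by (intro nn_integral_measure_pmf_support) auto
  also have "\<dots> = (\<Sum>m<M. ennreal (pmf (index_pmf M r w) m) * g m)"
    by (simp add: lessThan_Suc_atMost[symmetric] mult.commute)
  also have "\<dots> \<le> (\<Sum>m<M. ennreal (r (w m) / M) * g m)"
    by (intro sum_mono mult_right_mono ennreal_leI pmf_index_pmf_le) auto
  finally show ?thesis .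
qed

lemma nn_integral_index_pmf_fail:
  "(\<integral>\<^sub>pm. (if m < M then 0 else 1) \<partial>(index_pmf M r w)) = ennreal (1 - min 1 (sample_mean M r w))"
proof -
  have "(\<integral>\<^sub>pm. (if m < M then 0 else 1) \<partial>(index_pmf M r w)) =
      (\<Sum>m\<le>M. (if m < M then 0 else 1) * ennreal (pmf (index_pmf M r w) m))"
    using set_index_pmf by (intro nn_integral_measure_pmf_support) auto
  also have "\<dots> = ennreal (index_weight M r w M)"
    by (simp add: lessThan_Suc_atMost[symmetric] pmf_index_pmf)
  finally show ?thesis
    by (simp add: index_weight_def)
qed

end


text \<open>On the diagonal the two words coincide, off it they are independent. Counting M^2
  instead of M(M-1) independent pairs avoids a subtraction in \<open>ennreal\<close>.\<close>

lemma nn_integral_double_sum_iid_le: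
  "(\<integral>\<^sub>pw. (\<Sum>m<M. \<Sum>m'<M. K (w m) (w m')) \<partial>(Pi_pmf {..<M} d (\<lambda>_. p)))
     \<le> of_nat M * (\<integral>\<^sub>pa. K a a \<partial>p)
       + of_nat M * (of_nat M * (\<integral>\<^sub>pa. \<integral>\<^sub>pb. K a b \<partial>p \<partial>p))"
proof -
  let ?D = "\<integral>\<^sub>pa. K a a \<partial>p" and ?E = "\<integral>\<^sub>pa. \<integral>\<^sub>pb. K a b \<partial>p \<partial>p"
  have "(\<integral>\<^sub>pw. K (w m) (w m') \<partial>(Pi_pmf {..<M} d (\<lambda>_. p)))
      \<le> (if m' = m then ?D else 0) + ?E" if "m < M" "m' < M" for m m'
    using that nn_integral_Pi_pmf_component[where A = "{..<M}" and i = m and h = "\<lambda>a. K a a" and d = d and p = "\<lambda>_. p"]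
      nn_integral_Pi_pmf_component2[where A = "{..<M}" and i = m and j = m' and h = K and d = d and p = "\<lambda>_. p"]
    by (cases "m' = m") auto
  then have "(\<Sum>m<M. \<Sum>m'<M. \<integral>\<^sub>pw. K (w m) (w m') \<partial>(Pi_pmf {..<M} d (\<lambda>_. p)))
      \<le> (\<Sum>m<M. \<Sum>m'<M. (if m' = m then ?D else 0) + ?E)"
    by (intro sum_mono) auto
  also have "\<dots> = of_nat M * ?D + of_nat M * (of_nat M * ?E)"
    by (simp add: sum.distrib distrib_left)
  finally show ?thesis
    by (simp add: nn_integral_sum)
qed

text \<open>In the application \<open>r u w\<close> is the likelihood ratio \<open>p(w|u) / p(w)\<close>. The index and the channel
  input of every source word \<open>u\<close> are drawn once and belong to the codebook, so the receiver knows them.\<close>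

definition codebook ::
  "'u set \<Rightarrow> 'w pmf \<Rightarrow> ('u \<Rightarrow> 'w \<Rightarrow> real) \<Rightarrow> ('u \<Rightarrow> 'w \<Rightarrow> 'x pmf) \<Rightarrow> nat \<Rightarrow> real
   \<Rightarrow> ((nat \<Rightarrow> 'w) \<times> ('u \<Rightarrow> nat \<times> 'x)) pmf" where
  "codebook A pw r ex M B =
     do {
       w \<leftarrow> Pi_pmf {..<M} undefined (\<lambda>_. pw);
       c \<leftarrow> Pi_pmf A undefined (\<lambda>u. do {
              m \<leftarrow> index_pmf M (truncated B (r u)) w;
              x \<leftarrow> ex u (w m);
              return_pmf (m, x)
            });
       return_pmf (w, c)
     }"

lemma truncated_nonneg: "(\<And>x. 0 \<le> r x) \<Longrightarrow> 0 \<le> truncated B r x"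
  by (simp add: truncated_def)

lemma truncated_le: "(\<And>x. 0 \<le> r x) \<Longrightarrow> truncated B r x \<le> r x"
  by (simp add: truncated_def)

text \<open>Passing from the truncated to the full ratio removes \<open>B\<close> from the confusion
  bounds and leaves the weights that turn p(w) into p(w|u).\<close>

lemma nn_integral_index_truncated_le:
  assumes "M > 0" "\<And>x. 0 \<le> r x"
  shows "(\<integral>\<^sub>pm. (if m < M then g m else 0) \<partial>(index_pmf M (truncated B r) w))
     \<le> (\<Sum>m<M. ennreal (r (w m) / M) * g m)"
proof -
  have "(\<integral>\<^sub>pm. (if m < M then g m else 0) \<partial>(index_pmf M (truncated B r) w))
      \<le> (\<Sum>m<M. ennreal (truncated B r (w m) / M) * g m)"
    by (intro nn_integral_index_pmf_le assms truncated_nonneg)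
  also have "\<dots> \<le> (\<Sum>m<M. ennreal (r (w m) / M) * g m)"
    by (intro sum_mono mult_right_mono ennreal_leI divide_right_mono truncated_le assms) auto
  finally show ?thesis .
qed

context
  fixes A :: "'u set" and pw :: "'w pmf" and r :: "'u \<Rightarrow> 'w \<Rightarrow> real" and ex :: "'u \<Rightarrow> 'w \<Rightarrow> 'x pmf"
    and M :: nat and B :: real
  assumes A: "finite A" and M: "M > 0" and r: "\<And>u w. 0 \<le> r u w"
begin

text \<open>\<open>g\<close> may depend on the whole list \<open>w\<close>, since a receiver also
  inspects words other than the chosen one.\<close>

lemma codebook_single:
  assumes u: "u \<in> A"
  shows "(\<integral>\<^sub>pC. (case snd C u of (m, x) \<Rightarrow> if m < M then g (fst C) m x else 0) \<partial>(codebook A pw r ex M B))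
    \<le> (\<integral>\<^sub>pw. (\<Sum>m<M. ennreal (r u (w m) / M) * (\<integral>\<^sub>px. g w m x \<partial>(ex u (w m))))
           \<partial>(Pi_pmf {..<M} undefined (\<lambda>_. pw)))"
proof -
  have *: "(\<integral>\<^sub>pm. \<integral>\<^sub>px. (if m < M then g w m x else 0) \<partial>(ex u (w m))
        \<partial>(index_pmf M (truncated B (r u)) w))
      \<le> (\<Sum>m<M. ennreal (r u (w m) / M) * (\<integral>\<^sub>px. g w m x \<partial>(ex u (w m))))" for w
    by (rule order.trans[OF _ nn_integral_index_truncated_le[OF M r, where B = B]])
       (intro nn_integral_mono, simp)
  have "(\<integral>\<^sub>pC. (case snd C u of (m, x) \<Rightarrow> if m < M then g (fst C) m x else 0) \<partial>(codebook A pw r ex M B))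
    = (\<integral>\<^sub>pw. \<integral>\<^sub>pm. \<integral>\<^sub>px. (if m < M then g w m x else 0) \<partial>(ex u (w m))
         \<partial>(index_pmf M (truncated B (r u)) w) \<partial>(Pi_pmf {..<M} undefined (\<lambda>_. pw)))"
    unfolding codebook_def nn_integral_bind_pmf nn_integral_return_pmf[OF zero_le] fst_conv snd_conv
    by (simp add: nn_integral_Pi_pmf_component[OF A u, where h = "\<lambda>z. case z of (m, x) \<Rightarrow> if m < M then g w m x else 0" for w])
  also have "\<dots> \<le> (\<integral>\<^sub>pw. (\<Sum>m<M. ennreal (r u (w m) / M) * (\<integral>\<^sub>px. g w m x \<partial>(ex u (w m))))
           \<partial>(Pi_pmf {..<M} undefined (\<lambda>_. pw)))"
    by (intro nn_integral_mono *)
  finally show ?thesis .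
qed

text \<open>Given the list \<open>w\<close>, the entries of two different source words are
  independent, so the index bound applies twice; the words stay coupled through
  \<open>w\<close>.\<close>

lemma codebook_pair:
  assumes u: "u \<in> A" "u' \<in> A" "u \<noteq> u'"
  shows "(\<integral>\<^sub>pC. (case snd C u of (m, x) \<Rightarrow> case snd C u' of (m', x') \<Rightarrow>
              if m < M then if m' < M then g (fst C) m x m' x' else 0 else 0) \<partial>(codebook A pw r ex M B))
    \<le> (\<integral>\<^sub>pw. (\<Sum>m<M. ennreal (r u (w m) / M) * (\<integral>\<^sub>px. (\<Sum>m'<M. ennreal (r u' (w m') / M) *
             (\<integral>\<^sub>px'. g w m x m' x' \<partial>(ex u' (w m')))) \<partial>(ex u (w m))))
           \<partial>(Pi_pmf {..<M} undefined (\<lambda>_. pw)))"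
proof -
  let ?P = "\<lambda>w u. do { m \<leftarrow> index_pmf M (truncated B (r u)) w; x \<leftarrow> ex u (w m); return_pmf (m, x) }"
  have inner: "(\<integral>\<^sub>pm'. \<integral>\<^sub>px'. (if m' < M then g w m x m' x' else 0) \<partial>(ex u' (w m'))
        \<partial>(index_pmf M (truncated B (r u')) w))
      \<le> (\<Sum>m'<M. ennreal (r u' (w m') / M) * (\<integral>\<^sub>px'. g w m x m' x' \<partial>(ex u' (w m'))))" for w m x
    by (rule order.trans[OF _ nn_integral_index_truncated_le[OF M r, where B = B]])
       (intro nn_integral_mono, simp)
  have outer: "(\<integral>\<^sub>pm. \<integral>\<^sub>px. (if m < M then h m x else 0) \<partial>(ex u (w m))
        \<partial>(index_pmf M (truncated B (r u)) w))
      \<le> (\<Sum>m<M. ennreal (r u (w m) / M) * (\<integral>\<^sub>px. h m x \<partial>(ex u (w m))))" for w h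
    by (rule order.trans[OF _ nn_integral_index_truncated_le[OF M r, where B = B]])
       (intro nn_integral_mono, simp)
  have "(\<integral>\<^sub>pC. (case snd C u of (m, x) \<Rightarrow> case snd C u' of (m', x') \<Rightarrow>
              if m < M then if m' < M then g (fst C) m x m' x' else 0 else 0) \<partial>(codebook A pw r ex M B))
    = (\<integral>\<^sub>pw. \<integral>\<^sub>pa. \<integral>\<^sub>pb. (case a of (m, x) \<Rightarrow> case b of (m', x') \<Rightarrow>
              if m < M then if m' < M then g w m x m' x' else 0 else 0) \<partial>(?P w u')
         \<partial>(?P w u) \<partial>(Pi_pmf {..<M} undefined (\<lambda>_. pw)))"
    unfolding codebook_def nn_integral_bind_pmf nn_integral_return_pmf[OF zero_le] fst_conv snd_conv
    by (simp add: nn_integral_Pi_pmf_component2[OF A u, where h = "\<lambda>a b. case a of (m, x) \<Rightarrow> case b of (m', x') \<Rightarrow>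
          if m < M then if m' < M then g w m x m' x' else 0 else 0" for w])
  also have "\<dots> = (\<integral>\<^sub>pw. \<integral>\<^sub>pm. \<integral>\<^sub>px. (if m < M then
        \<integral>\<^sub>pm'. \<integral>\<^sub>px'. (if m' < M then g w m x m' x' else 0) \<partial>(ex u' (w m'))
          \<partial>(index_pmf M (truncated B (r u')) w) else 0) \<partial>(ex u (w m))
         \<partial>(index_pmf M (truncated B (r u)) w) \<partial>(Pi_pmf {..<M} undefined (\<lambda>_. pw)))"
    unfolding nn_integral_bind_pmf nn_integral_return_pmf[OF zero_le] prod.case
    by (intro nn_integral_cong) simp
  also have "\<dots> \<le> (\<integral>\<^sub>pw. (\<Sum>m<M. ennreal (r u (w m) / M) * (\<integral>\<^sub>px.
        \<integral>\<^sub>pm'. \<integral>\<^sub>px'. (if m' < M then g w m x m' x' else 0) \<partial>(ex u' (w m'))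
          \<partial>(index_pmf M (truncated B (r u')) w) \<partial>(ex u (w m))))
         \<partial>(Pi_pmf {..<M} undefined (\<lambda>_. pw)))"
    by (intro nn_integral_mono outer)
  also have "\<dots> \<le> (\<integral>\<^sub>pw. (\<Sum>m<M. ennreal (r u (w m) / M) * (\<integral>\<^sub>px. (\<Sum>m'<M. ennreal (r u' (w m') / M) *
             (\<integral>\<^sub>px'. g w m x m' x' \<partial>(ex u' (w m')))) \<partial>(ex u (w m))))
           \<partial>(Pi_pmf {..<M} undefined (\<lambda>_. pw)))"
    by (intro nn_integral_mono sum_mono mult_left_mono inner) auto
  finally show ?thesis .
qed


lemma cancel_of_nat: "of_nat M * (ennreal (a / M) * b) = ennreal a * b"
proof -
  have "of_nat M * ennreal (a / M) = ennreal (real M * (a / M))"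
    by (simp add: ennreal_of_nat_eq_real_of_nat ennreal_mult' [symmetric])
  also have "real M * (a / M) = a"
    using M by simp
  finally show ?thesis
    by (simp add: mult.assoc[symmetric])
qed

text \<open>The M identically distributed choices cancel the factor 1/M. In the application the
  right-hand side is an average over the ideal law p(w,x|u).\<close>

lemma codebook_single_le1:
  assumes u: "u \<in> A"
  shows "(\<integral>\<^sub>pC. (case snd C u of (m, x) \<Rightarrow> if m < M then h (fst C m) x else 0) \<partial>(codebook A pw r ex M B))
    \<le> (\<integral>\<^sub>pw. ennreal (r u w) * (\<integral>\<^sub>px. h w x \<partial>(ex u w)) \<partial>pw)"
proof -
  let ?K = "\<lambda>w. ennreal (r u w / M) * (\<integral>\<^sub>px. h w x \<partial>(ex u w))"
  have "(\<integral>\<^sub>pC. (case snd C u of (m, x) \<Rightarrow> if m < M then h (fst C m) x else 0) \<partial>(codebook A pw r ex M B))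
      \<le> (\<integral>\<^sub>pw. (\<Sum>m<M. ?K (w m)) \<partial>(Pi_pmf {..<M} undefined (\<lambda>_. pw)))"
    by (rule codebook_single[OF u, where g = "\<lambda>w m x. h (w m) x"])
  also have "\<dots> = of_nat M * (\<integral>\<^sub>pw. ?K w \<partial>pw)"
    by (simp add: nn_integral_sum nn_integral_Pi_pmf_component[where h = ?K])
  also have "\<dots> = (\<integral>\<^sub>pw. ennreal (r u w) * (\<integral>\<^sub>px. h w x \<partial>(ex u w)) \<partial>pw)"
    by (simp add: cancel_of_nat nn_integral_cmult[symmetric])
  finally show ?thesis .
qed

text \<open>A word \<open>m'\<close> of the list is either the chosen one or independent of it. The
  first case has the single-word bound; the second keeps a factor \<open>M\<close> for the choice of
  \<open>m'\<close>.\<close>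

lemma codebook_single_le:
  assumes u: "u \<in> A"
  shows "(\<integral>\<^sub>pC. (case snd C u of (m, x) \<Rightarrow> if m < M then (\<Sum>m'<M. h (fst C m) x (fst C m')) else 0)
           \<partial>(codebook A pw r ex M B))
    \<le> (\<integral>\<^sub>pw. ennreal (r u w) * (\<integral>\<^sub>px. h w x w \<partial>(ex u w)) \<partial>pw)
      + of_nat M * (\<integral>\<^sub>pw. ennreal (r u w) * (\<integral>\<^sub>px. \<integral>\<^sub>pw'. h w x w' \<partial>pw \<partial>(ex u w)) \<partial>pw)"
proof -
  define K where "K a b = ennreal (r u a / M) * (\<integral>\<^sub>px. h a x b \<partial>(ex u a))" for a b
  have "(\<integral>\<^sub>pC. (case snd C u of (m, x) \<Rightarrow> if m < M then (\<Sum>m'<M. h (fst C m) x (fst C m')) else 0)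
           \<partial>(codebook A pw r ex M B))
      \<le> (\<integral>\<^sub>pw. (\<Sum>m<M. ennreal (r u (w m) / M) * (\<integral>\<^sub>px. (\<Sum>m'<M. h (w m) x (w m')) \<partial>(ex u (w m))))
           \<partial>(Pi_pmf {..<M} undefined (\<lambda>_. pw)))"
    by (rule codebook_single[OF u, where g = "\<lambda>w m x. \<Sum>m'<M. h (w m) x (w m')"])
  also have "\<dots> = (\<integral>\<^sub>pw. (\<Sum>m<M. \<Sum>m'<M. K (w m) (w m')) \<partial>(Pi_pmf {..<M} undefined (\<lambda>_. pw)))"
    by (simp add: K_def nn_integral_sum sum_distrib_left)
  also have "\<dots> \<le> of_nat M * (\<integral>\<^sub>pa. K a a \<partial>pw)
       + of_nat M * (of_nat M * (\<integral>\<^sub>pa. \<integral>\<^sub>pb. K a b \<partial>pw \<partial>pw))"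
    by (rule nn_integral_double_sum_iid_le)
  also have "of_nat M * (\<integral>\<^sub>pa. K a a \<partial>pw)
      = (\<integral>\<^sub>pw. ennreal (r u w) * (\<integral>\<^sub>px. h w x w \<partial>(ex u w)) \<partial>pw)"
    by (simp add: K_def cancel_of_nat nn_integral_cmult[symmetric])
  also have "of_nat M * (\<integral>\<^sub>pa. \<integral>\<^sub>pb. K a b \<partial>pw \<partial>pw)
      = (\<integral>\<^sub>pw. ennreal (r u w) * (\<integral>\<^sub>px. \<integral>\<^sub>pw'. h w x w' \<partial>pw \<partial>(ex u w)) \<partial>pw)"
  proof -
    have *: "(\<integral>\<^sub>pb. K a b \<partial>pw) = ennreal (r u a / M) *
        (\<integral>\<^sub>px. \<integral>\<^sub>pw'. h a x w' \<partial>pw \<partial>(ex u a))" for a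
      unfolding K_def by (simp add: nn_integral_cmult) (subst nn_integral_pmf_swap, rule refl)
    show ?thesis
      unfolding * by (simp add: nn_integral_cmult[symmetric] cancel_of_nat)
  qed
  finally show ?thesis .
qed

text \<open>M coincident index pairs of weight 1/M^2 each leave a factor 1/M for a shared index. The
  at most M^2 distinct pairs cancel both factors, as if the two codewords were drawn
  independently.\<close>

lemma codebook_pair_le:
  assumes u: "u \<in> A" "u' \<in> A" "u \<noteq> u'"
  shows "(\<integral>\<^sub>pC. (case snd C u of (m, x) \<Rightarrow> case snd C u' of (m', x') \<Rightarrow>
              if m < M then if m' < M then h (fst C m) x (fst C m') x' else 0 else 0)
           \<partial>(codebook A pw r ex M B))
    \<le> ennreal (1 / M) * (\<integral>\<^sub>pw. ennreal (r u w) * (\<integral>\<^sub>px. ennreal (r u' w) *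
            (\<integral>\<^sub>px'. h w x w x' \<partial>(ex u' w)) \<partial>(ex u w)) \<partial>pw)
      + (\<integral>\<^sub>pw. ennreal (r u w) * (\<integral>\<^sub>px. \<integral>\<^sub>pw'. ennreal (r u' w') *
            (\<integral>\<^sub>px'. h w x w' x' \<partial>(ex u' w')) \<partial>pw \<partial>(ex u w)) \<partial>pw)"
proof -
  define K where "K a b = ennreal (r u a / M) * (\<integral>\<^sub>px. ennreal (r u' b / M) *
            (\<integral>\<^sub>px'. h a x b x' \<partial>(ex u' b)) \<partial>(ex u a))" for a b
  have "(\<integral>\<^sub>pC. (case snd C u of (m, x) \<Rightarrow> case snd C u' of (m', x') \<Rightarrow>
              if m < M then if m' < M then h (fst C m) x (fst C m') x' else 0 else 0)
           \<partial>(codebook A pw r ex M B))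
     \<le> (\<integral>\<^sub>pw. (\<Sum>m<M. ennreal (r u (w m) / M) * (\<integral>\<^sub>px. (\<Sum>m'<M. ennreal (r u' (w m') / M) *
             (\<integral>\<^sub>px'. h (w m) x (w m') x' \<partial>(ex u' (w m')))) \<partial>(ex u (w m))))
           \<partial>(Pi_pmf {..<M} undefined (\<lambda>_. pw)))"
    by (rule codebook_pair[OF u, where g = "\<lambda>w m x m' x'. h (w m) x (w m') x'"])
  also have "\<dots> = (\<integral>\<^sub>pw. (\<Sum>m<M. \<Sum>m'<M. K (w m) (w m')) \<partial>(Pi_pmf {..<M} undefined (\<lambda>_. pw)))"
    by (simp add: K_def nn_integral_sum sum_distrib_left)
  also have "\<dots> \<le> of_nat M * (\<integral>\<^sub>pa. K a a \<partial>pw)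
       + of_nat M * (of_nat M * (\<integral>\<^sub>pa. \<integral>\<^sub>pb. K a b \<partial>pw \<partial>pw))"
    by (rule nn_integral_double_sum_iid_le)
  also have "of_nat M * (\<integral>\<^sub>pa. K a a \<partial>pw)
      = ennreal (1 / M) * (\<integral>\<^sub>pw. ennreal (r u w) * (\<integral>\<^sub>px. ennreal (r u' w) *
            (\<integral>\<^sub>px'. h w x w x' \<partial>(ex u' w)) \<partial>(ex u w)) \<partial>pw)"
  proof -
    have [simp]: "ennreal (r u' w / M) = ennreal (1 / M) * ennreal (r u' w)" for w
      using r by (simp add: ennreal_mult'[symmetric])
    show ?thesis
      by (simp add: K_def cancel_of_nat nn_integral_cmult[symmetric])
         (simp add: nn_integral_cmult mult_ac)
  qed
  also have "of_nat M * (of_nat M * (\<integral>\<^sub>pa. \<integral>\<^sub>pb. K a b \<partial>pw \<partial>pw))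
      = (\<integral>\<^sub>pw. ennreal (r u w) * (\<integral>\<^sub>px. \<integral>\<^sub>pw'. ennreal (r u' w') *
            (\<integral>\<^sub>px'. h w x w' x' \<partial>(ex u' w')) \<partial>pw \<partial>(ex u w)) \<partial>pw)"
  proof -
    have "of_nat M * (of_nat M * K a b) = ennreal (r u a) * (\<integral>\<^sub>px. ennreal (r u' b) *
            (\<integral>\<^sub>px'. h a x b x' \<partial>(ex u' b)) \<partial>(ex u a))" for a b
      by (simp add: K_def cancel_of_nat nn_integral_cmult[symmetric] mult.left_commute[of "of_nat M" "ennreal (r u a)"])
    moreover have "(\<integral>\<^sub>pb. ennreal (r u a) * (\<integral>\<^sub>px. ennreal (r u' b) *
            (\<integral>\<^sub>px'. h a x b x' \<partial>(ex u' b)) \<partial>(ex u a)) \<partial>pw)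
        = ennreal (r u a) * (\<integral>\<^sub>px. \<integral>\<^sub>pw'. ennreal (r u' w') *
            (\<integral>\<^sub>px'. h a x w' x' \<partial>(ex u' w')) \<partial>pw \<partial>(ex u a))" for a
      by (subst nn_integral_cmult, simp) (subst nn_integral_pmf_swap, simp add: nn_integral_cmult)
    ultimately show ?thesis
      by (simp add: nn_integral_cmult[symmetric])
  qed
  finally show ?thesis .
qed


section \<open>Second-moment bound for the encoding failure\<close>

lemma integrable_sample_mean_power:
  fixes f :: "'w \<Rightarrow> real"
  assumes "\<And>x. 0 \<le> f x" "\<And>x. f x \<le> B"
  shows "integrable (measure_pmf p) (\<lambda>w. sample_mean M f w ^ k)"
proof (rule measure_pmf.integrable_const_bound[where B = "B ^ k"])
  have "sample_mean M f w \<le> B" for w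
    using sum_mono[of "{..<M}" "\<lambda>m. f (w m)" "\<lambda>_. B"] assms(2) M by (simp add: sample_mean_def field_simps)
  then show "AE w in measure_pmf p. norm (sample_mean M f w ^ k) \<le> B ^ k"
    using sample_mean_nonneg[of M f] assms(1) M by (intro AE_I2) (simp add: power_mono)
qed auto

text \<open>The deficit is at most (1 - a) + |S - a| for the sample mean S. Values in [0, B] with
  mean at most 1 have second moment at most B, so S has variance at most B / M.\<close>

lemma expectation_sample_mean_deviation:
  fixes f :: "'w \<Rightarrow> real"
  assumes f: "\<And>x. 0 \<le> f x" "\<And>x. f x \<le> B" and B: "B > 0"
  defines "a \<equiv> measure_pmf.expectation pw f"
  assumes a: "a \<le> 1"
  shows "(\<integral>\<^sub>pw. ennreal (1 - min 1 (sample_mean M f w)) \<partial>(Pi_pmf {..<M} d (\<lambda>_. pw)))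
           \<le> ennreal (1 - a) + ennreal (2 * sqrt (B / M))"
proof -
  let ?P = "measure_pmf (Pi_pmf {..<M} d (\<lambda>_. pw))"
  let ?S = "sample_mean M f"
  have int_f: "integrable (measure_pmf pw) f" "integrable ?P (\<lambda>w. f (w m))" for m
    using f by (auto intro!: measure_pmf.integrable_const_bound[where B = B])
  have int_S: "integrable ?P ?S" "integrable ?P (\<lambda>w. (?S w)\<^sup>2)"
    using integrable_sample_mean_power[OF f, where k = 1] integrable_sample_mean_power[OF f, where k = 2] by auto
  have a0: "0 \<le> a"
    unfolding a_def using f by (intro integral_nonneg_AE) auto
  have nn_f: "(\<integral>\<^sub>px. ennreal (f x) \<partial>pw) = ennreal a"
    unfolding a_def using f int_f by (intro nn_integral_eq_integral) auto
  have ES: "(\<integral>w. ?S w \<partial>?P) = a"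
  proof -
    have "(\<integral>w. f (w m) \<partial>?P) = a" if "m < M" for m
      using that integral_map_pmf[of "\<lambda>w. w m" "Pi_pmf {..<M} d (\<lambda>_. pw)" f]
      by (simp add: Pi_pmf_component a_def)
    then have "(\<Sum>m<M. \<integral>w. f (w m) \<partial>?P) = M * a"
      by simp
    then show ?thesis
      using M int_f by (simp add: sample_mean_def)
  qed
  have diag: "of_nat M * (\<integral>\<^sub>px. ennreal (f x / M) * ennreal (f x / M) \<partial>pw) \<le> ennreal (B / M)"
  proof -
  have "of_nat M * (\<integral>\<^sub>px. ennreal (f x / M) * ennreal (f x / M) \<partial>pw)
      = (\<integral>\<^sub>px. ennreal (f x) * ennreal (f x / M) \<partial>pw)"
    by (simp add: cancel_of_nat nn_integral_cmult[symmetric])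
  also have "\<dots> \<le> (\<integral>\<^sub>px. ennreal (f x) * ennreal (B / M) \<partial>pw)"
    using f by (intro nn_integral_mono mult_left_mono ennreal_leI divide_right_mono) auto
  also have "\<dots> = ennreal a * ennreal (B / M)"
    by (simp add: nn_integral_multc nn_f)
  also have "\<dots> \<le> ennreal (B / M)"
    using a a0 B by (simp add: ennreal_mult'[symmetric] divide_right_mono mult_left_le_one_le)
    finally show ?thesis .
  qed
  have off: "of_nat M * (of_nat M * (\<integral>\<^sub>px. \<integral>\<^sub>py. ennreal (f x / M) * ennreal (f y / M) \<partial>pw \<partial>pw)) = ennreal (a\<^sup>2)"
  proof -
  have "of_nat M * (\<integral>\<^sub>px. \<integral>\<^sub>py. ennreal (f x / M) * ennreal (f y / M) \<partial>pw \<partial>pw)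
      = (\<integral>\<^sub>px. ennreal (f x) * (\<integral>\<^sub>py. ennreal (f y / M) \<partial>pw) \<partial>pw)"
    by (subst nn_integral_cmult, simp)+ (simp add: cancel_of_nat nn_integral_cmult[symmetric])
  then have "of_nat M * (of_nat M * (\<integral>\<^sub>px. \<integral>\<^sub>py. ennreal (f x / M) * ennreal (f y / M) \<partial>pw \<partial>pw))
      = of_nat M * (\<integral>\<^sub>px. ennreal (f x) * (\<integral>\<^sub>py. ennreal (f y / M) \<partial>pw) \<partial>pw)"
    by simp
  also have "\<dots> = ennreal a * (\<integral>\<^sub>py. of_nat M * (ennreal (f y / M) * 1) \<partial>pw)"
    by (subst nn_integral_cmult, simp) (simp add: nn_integral_multc nn_f mult_ac)
  also have "\<dots> = ennreal (a\<^sup>2)"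
    unfolding cancel_of_nat using a0 by (simp add: nn_f power2_eq_square ennreal_mult')
    finally show ?thesis .
  qed
  have "(\<integral>\<^sup>+w. ennreal ((?S w)\<^sup>2) \<partial>?P)
      = (\<integral>\<^sup>+w. (\<Sum>m<M. \<Sum>m'<M. ennreal (f (w m) / M) * (ennreal (f (w m') / M))) \<partial>?P)"
  proof (intro nn_integral_cong)
    fix w
    have "(?S w)\<^sup>2 = (\<Sum>m<M. \<Sum>m'<M. f (w m) / M * (f (w m') / M))"
      unfolding sample_mean_def power2_eq_square sum_divide_distrib sum_product ..
    then show "ennreal ((?S w)\<^sup>2) = (\<Sum>m<M. \<Sum>m'<M. ennreal (f (w m) / M) * ennreal (f (w m') / M))"
      using f by (simp only: sum_ennreal sum_nonneg ennreal_mult'' [symmetric] divide_nonneg_nonneg of_nat_0_le_iff mult_nonneg_nonneg)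
  qed
  also have "\<dots> \<le> of_nat M * (\<integral>\<^sub>px. ennreal (f x / M) * ennreal (f x / M) \<partial>pw)
     + of_nat M * (of_nat M * (\<integral>\<^sub>px. \<integral>\<^sub>py. ennreal (f x / M) * ennreal (f y / M) \<partial>pw \<partial>pw))"
    by (rule nn_integral_double_sum_iid_le)
  also have "\<dots> \<le> ennreal (B / M) + ennreal (a\<^sup>2)"
    by (intro add_mono diag off[THEN eq_refl])
  finally have "ennreal (\<integral>w. (?S w)\<^sup>2 \<partial>?P) \<le> ennreal (B / M + a\<^sup>2)"
    using int_S B by (subst (asm) nn_integral_eq_integral) (auto simp: ennreal_plus[symmetric] simp del: ennreal_plus)
  then have ES2: "(\<integral>w. (?S w)\<^sup>2 \<partial>?P) \<le> B / M + a\<^sup>2"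
    using B by (subst (asm) ennreal_le_iff) auto
  \<comment> \<open>A bound on the standard deviation. In |d| \<le> \<eta> + d^2 / \<eta> both
    summands then have mean at most \<eta>, which is the origin of the factor 2.\<close>
  define \<eta> where "\<eta> = sqrt (B / M)"
  have \<eta>: "\<eta> > 0" "\<eta>\<^sup>2 = B / M"
    using B M by (auto simp: \<eta>_def)
  have dev: "1 - min 1 s \<le> (1 - a) + (\<eta> + (s - a)\<^sup>2 / \<eta>)" for s
  proof -
    have "\<bar>s - a\<bar> \<le> \<eta> + (s - a)\<^sup>2 / \<eta>"
    proof (cases "\<bar>s - a\<bar> \<le> \<eta>")
      case True
      then show ?thesis
        using \<eta> by (intro order.trans[OF True]) auto
    next
      case False
      then have "\<bar>s - a\<bar> * \<eta> \<le> \<bar>s - a\<bar> * \<bar>s - a\<bar>"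
        by (intro mult_left_mono) auto
      then have "\<bar>s - a\<bar> \<le> (s - a)\<^sup>2 / \<eta>"
        using \<eta> by (simp add: field_simps power2_eq_square)
      then show ?thesis
        using \<eta> by linarith
    qed
    then show ?thesis
      using a by linarith
  qed
  have int_dev: "integrable ?P (\<lambda>w. (?S w - a)\<^sup>2)"
    using int_S by (simp add: power2_diff)
  have "(\<integral>w. (?S w - a)\<^sup>2 \<partial>?P) = (\<integral>w. (?S w)\<^sup>2 \<partial>?P) - a\<^sup>2"
    using int_S ES by (simp add: power2_diff) (simp add: power2_eq_square)
  also have "\<dots> \<le> \<eta>\<^sup>2"
    using ES2 \<eta> by simp
  finally have var: "(\<integral>w. (?S w - a)\<^sup>2 \<partial>?P) \<le> \<eta>\<^sup>2" .
  have "(\<integral>\<^sup>+w. ennreal (1 - min 1 (?S w)) \<partial>?P) \<le> (\<integral>\<^sup>+w. ennreal ((1 - a) + (\<eta> + (?S w - a)\<^sup>2 / \<eta>)) \<partial>?P)"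
    by (intro nn_integral_mono ennreal_leI dev)
  also have "\<dots> = ennreal (\<integral>w. (1 - a) + (\<eta> + (?S w - a)\<^sup>2 / \<eta>) \<partial>?P)"
    using int_dev a \<eta> by (intro nn_integral_eq_integral) auto
  also have "(\<integral>w. (1 - a) + (\<eta> + (?S w - a)\<^sup>2 / \<eta>) \<partial>?P) = (1 - a) + (\<eta> + (\<integral>w. (?S w - a)\<^sup>2 \<partial>?P) / \<eta>)"
    using int_dev by simp
  also have "\<dots> \<le> (1 - a) + (\<eta> + \<eta>\<^sup>2 / \<eta>)"
    using var \<eta> by (intro add_left_mono divide_right_mono) auto
  also have "\<dots> = (1 - a) + 2 * sqrt (B / M)"
    using \<eta>(1) by (simp add: power2_eq_square \<eta>_def[symmetric])
  finally show ?thesis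
    using a B by (simp add: ennreal_leI ennreal_plus[symmetric] del: ennreal_plus)
qed

text \<open>Since \<open>r u\<close> integrates to exactly 1, the mean lost by truncation equals the
  tail of \<open>r u\<close> beyond \<open>B\<close>, weighted by \<open>r u\<close> itself. The
  rest is the deviation of the sample mean.\<close>

lemma codebook_fail:
  assumes u: "u \<in> A" and B: "B > 0" and r1: "(\<integral>\<^sub>pw. ennreal (r u w) \<partial>pw) = 1"
  shows "(\<integral>\<^sub>pC. (if fst (snd C u) < M then 0 else 1) \<partial>(codebook A pw r ex M B))
    \<le> (\<integral>\<^sub>pw. (if r u w > B then ennreal (r u w) else 0) \<partial>pw) + ennreal (2 * sqrt (B / M))"
proof -
  let ?f = "truncated B (r u)"
  let ?a = "measure_pmf.expectation pw ?f"
  have f: "0 \<le> ?f x" "?f x \<le> B" for x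
    using r B by (auto simp: truncated_def)
  have int_f: "integrable (measure_pmf pw) ?f"
    using f by (intro measure_pmf.integrable_const_bound[where B = B]) auto
  have a: "(\<integral>\<^sub>pw. ennreal (?f w) \<partial>pw) = ennreal ?a"
    using f int_f by (intro nn_integral_eq_integral) auto
  have split: "1 = ennreal ?a + (\<integral>\<^sub>pw. (if r u w > B then ennreal (r u w) else 0) \<partial>pw)"
    unfolding a[symmetric] r1[symmetric]
    by (subst nn_integral_add[symmetric]) (auto intro!: nn_integral_cong simp: truncated_def)
  have a0: "0 \<le> ?a"
    using f by (intro integral_nonneg_AE) auto
  have "ennreal ?a \<le> 1"
    by (subst split) simp
  then have a1: "?a \<le> 1"
    by simp
  have tail: "ennreal (1 - ?a) = (\<integral>\<^sub>pw. (if r u w > B then ennreal (r u w) else 0) \<partial>pw)"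
    using arg_cong[OF split, of "\<lambda>x. x - ennreal ?a"] a0 by (simp add: ennreal_minus[symmetric] del: ennreal_minus)
  have "(\<integral>\<^sub>pC. (if fst (snd C u) < M then 0 else 1) \<partial>(codebook A pw r ex M B))
      = (\<integral>\<^sub>pw. ennreal (1 - min 1 (sample_mean M ?f w)) \<partial>(Pi_pmf {..<M} undefined (\<lambda>_. pw)))"
    unfolding codebook_def nn_integral_bind_pmf nn_integral_return_pmf[OF zero_le] fst_conv snd_conv
    using nn_integral_index_pmf_fail[OF M, where r = ?f, OF f(1)]
    by (simp add: nn_integral_Pi_pmf_component[OF A u, where h = "\<lambda>z. if fst z < M then 0 else 1"])
  also have "\<dots> \<le> ennreal (1 - ?a) + ennreal (2 * sqrt (B / M))"
    by (rule expectation_sample_mean_deviation[OF f B a1])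
  finally show ?thesis
    unfolding tail .
qed

end

section \<open>One-shot error bound for one receiver\<close>

text \<open>A word whose encoding failed, with index \<open>M1\<close>, is never a candidate. The
  word of the other user is quantified existentially, so an ambiguity about it alone is no
  error.\<close>

definition candidate ::
  "nat \<Rightarrow> nat \<Rightarrow> ('u \<Rightarrow> 'w1 \<Rightarrow> 'x \<Rightarrow> 'w2 \<Rightarrow> 'o \<Rightarrow> bool) \<Rightarrow> (nat \<Rightarrow> 'w1) \<times> ('u \<Rightarrow> nat \<times> 'x) \<Rightarrow> (nat \<Rightarrow> 'w2)
   \<Rightarrow> 'o \<Rightarrow> 'u \<Rightarrow> bool" where
  "candidate M1 M2 T C1 w2 obs u \<longleftrightarrow>
     (case snd C1 u of (m, x) \<Rightarrow> m < M1 \<and> (\<exists>m'<M2. T u (fst C1 m) x (w2 m') obs))"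

definition decoding_failure ::
  "'u set \<Rightarrow> nat \<Rightarrow> nat \<Rightarrow> ('u \<Rightarrow> 'w1 \<Rightarrow> 'x \<Rightarrow> 'w2 \<Rightarrow> 'o \<Rightarrow> bool) \<Rightarrow> (nat \<Rightarrow> 'w1) \<times> ('u \<Rightarrow> nat \<times> 'x)
   \<Rightarrow> (nat \<Rightarrow> 'w2) \<Rightarrow> 'o \<Rightarrow> 'u \<Rightarrow> bool" where
  "decoding_failure A M1 M2 T C1 w2 obs u \<longleftrightarrow>
     \<not> candidate M1 M2 T C1 w2 obs u \<or> (\<exists>u'\<in>A - {u}. candidate M1 M2 T C1 w2 obs u')"

lemma of_bool_Ex_le_sum:
  assumes "finite A"
  shows "of_bool (\<exists>x\<in>A. P x) \<le> (\<Sum>x\<in>A. of_bool (P x) :: ennreal)"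
proof (cases "\<exists>x\<in>A. P x")
  case True
  then obtain x where x: "x \<in> A" "P x"
    by auto
  then show ?thesis
    using member_le_sum[of x A "\<lambda>x. of_bool (P x) :: ennreal"] assms by auto
qed auto

text \<open>An error implies a failed encoding, a missed true tuple, or an accepted wrong word. The
  last two terms are cut off outside the proper indices, which gives them the form of the codebook
  averages above.\<close>

lemma of_bool_decoding_failure_le:
  fixes C2 :: "(nat \<Rightarrow> 'w2) \<times> ('v \<Rightarrow> nat \<times> 'z)"
  assumes A: "finite A"
  shows "(of_bool (decoding_failure A M1 M2 T C1 (fst C2) obs u) :: ennreal)
    \<le> (if fst (snd C1 u) < M1 then 0 else 1) + (if fst (snd C2 v) < M2 then 0 else 1)
      + (case snd C1 u of (m1, x1) \<Rightarrow> if m1 < M1 then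
          (case snd C2 v of (m2, x2) \<Rightarrow> if m2 < M2 then of_bool (\<not> T u (fst C1 m1) x1 (fst C2 m2) obs) else 0) else 0)
      + (\<Sum>u'\<in>A - {u}. case snd C1 u of (m1, x1) \<Rightarrow> case snd C1 u' of (m', x') \<Rightarrow> if m1 < M1 then if m' < M1 then
          (case snd C2 v of (m2, x2) \<Rightarrow> if m2 < M2 then
             (\<Sum>j<M2. of_bool (T u' (fst C1 m') x' (fst C2 j) obs)) else 0) else 0 else 0)"
    (is "?L \<le> ?F1 + ?F2 + ?T + ?S")
proof -
  obtain m1 x1 where 1: "snd C1 u = (m1, x1)" by fastforce
  obtain m2 x2 where 2: "snd C2 v = (m2, x2)" by fastforce
  show ?thesis
  proof (cases "m1 < M1 \<and> m2 < M2")
    case False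
    then have "1 \<le> ?F1 + ?F2"
      using 1 2 by auto
    moreover have "?L \<le> 1"
      by simp
    ultimately have "?L \<le> ?F1 + ?F2"
      by (rule order.trans[rotated])
    then show ?thesis
      by (rule add_increasing2[OF zero_le add_increasing2[OF zero_le]])
  next
    case True
    have "?L \<le> of_bool (\<not> candidate M1 M2 T C1 (fst C2) obs u) + of_bool (\<exists>u'\<in>A - {u}. candidate M1 M2 T C1 (fst C2) obs u')"
      by (auto simp: decoding_failure_def)
    also have "\<dots> \<le> ?T + ?S"
    proof (rule add_mono)
      show "of_bool (\<not> candidate M1 M2 T C1 (fst C2) obs u) \<le> ?T"
        using True 1 2 by (auto simp: candidate_def)
      have "of_bool (\<exists>u'\<in>A - {u}. candidate M1 M2 T C1 (fst C2) obs u')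
          \<le> (\<Sum>u'\<in>A - {u}. of_bool (candidate M1 M2 T C1 (fst C2) obs u') :: ennreal)"
        using A by (intro of_bool_Ex_le_sum) auto
      also have "\<dots> \<le> ?S"
      proof (rule sum_mono)
        fix u'
        obtain m' x' where 3: "snd C1 u' = (m', x')" by fastforce
        have "of_bool (\<exists>j<M2. T u' (fst C1 m') x' (fst C2 j) obs)
            \<le> (\<Sum>j<M2. of_bool (T u' (fst C1 m') x' (fst C2 j) obs) :: ennreal)"
          using of_bool_Ex_le_sum[of "{..<M2}" "\<lambda>j. T u' (fst C1 m') x' (fst C2 j) obs"]
          by (simp only: Bex_def lessThan_iff finite_lessThan)
        then show "of_bool (candidate M1 M2 T C1 (fst C2) obs u') \<le>
           (case snd C1 u of (m1, x1) \<Rightarrow> case snd C1 u' of (m', x') \<Rightarrow> if m1 < M1 then if m' < M1 then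
          (case snd C2 v of (m2, x2) \<Rightarrow> if m2 < M2 then
             (\<Sum>j<M2. of_bool (T u' (fst C1 m') x' (fst C2 j) obs) :: ennreal) else 0) else 0 else 0)"
          using True 1 2 3 by (cases "m' < M1") (simp_all add: candidate_def del: sum_of_bool_eq of_bool_eq_iff)
      qed
      finally show "of_bool (\<exists>u'\<in>A - {u}. candidate M1 M2 T C1 (fst C2) obs u') \<le> ?S" .
    qed
    also have "\<dots> \<le> (?F1 + ?F2) + (?T + ?S)"
      by (intro add_increasing zero_le order.refl)
    finally show ?thesis
      by (simp only: add.assoc)
  qed
qed

section \<open>Averaging confusion terms over the transmission of the other user\<close>

lemma nn_integral_pmf_add:
  "(\<integral>\<^sub>px. f x + g x \<partial>p) = (\<integral>\<^sub>px. f x \<partial>p) + (\<integral>\<^sub>px. g x \<partial>p)"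
  by (simp add: nn_integral_add)

lemma nn_integral_pmf_sum:
  "(\<integral>\<^sub>px. (\<Sum>i\<in>I. f i x) \<partial>p) = (\<Sum>i\<in>I. \<integral>\<^sub>px. f i x \<partial>p)"
  by (simp add: nn_integral_sum)

lemma nn_integral_weighted_le:
  assumes "(\<integral>\<^sub>pw. ennreal (r w) \<partial>p) \<le> 1" "\<And>w. f w \<le> c"
  shows "(\<integral>\<^sub>pw. ennreal (r w) * f w \<partial>p) \<le> c"
proof -
  have "(\<integral>\<^sub>pw. ennreal (r w) * f w \<partial>p) \<le> (\<integral>\<^sub>pw. ennreal (r w) * c \<partial>p)"
    by (intro nn_integral_mono mult_left_mono assms) auto
  also have "\<dots> = (\<integral>\<^sub>pw. ennreal (r w) \<partial>p) * c"
    by (simp add: nn_integral_multc)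
  also have "\<dots> \<le> 1 * c"
    by (intro mult_right_mono assms) auto
  finally show ?thesis
    by simp
qed

lemma sum_weighted_swap:
  fixes F :: "'u \<Rightarrow> 'z \<Rightarrow> 'v \<Rightarrow> ennreal" and d :: "'v \<Rightarrow> ennreal"
  shows "(\<Sum>u\<in>A. \<integral>\<^sub>pz. c u z * (\<integral>\<^sub>pv. d v * F u z v \<partial>q) \<partial>(p u))
    = (\<integral>\<^sub>pv. d v * (\<Sum>u\<in>A. \<integral>\<^sub>pz. c u z * F u z v \<partial>(p u)) \<partial>q)"
proof -
  have "(\<integral>\<^sub>pz. c u z * (\<integral>\<^sub>pv. d v * F u z v \<partial>q) \<partial>(p u))
      = (\<integral>\<^sub>pv. d v * (\<integral>\<^sub>pz. c u z * F u z v \<partial>(p u)) \<partial>q)" for u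
  proof -
    have "(\<integral>\<^sub>pz. c u z * (\<integral>\<^sub>pv. d v * F u z v \<partial>q) \<partial>(p u))
        = (\<integral>\<^sub>pz. \<integral>\<^sub>pv. c u z * (d v * F u z v) \<partial>q \<partial>(p u))"
      by (simp add: nn_integral_cmult)
    also have "\<dots> = (\<integral>\<^sub>pv. \<integral>\<^sub>pz. d v * (c u z * F u z v) \<partial>(p u) \<partial>q)"
      by (subst nn_integral_pmf_swap) (simp add: mult.left_commute)
    also have "\<dots> = (\<integral>\<^sub>pv. d v * (\<integral>\<^sub>pz. c u z * F u z v \<partial>(p u)) \<partial>q)"
      by (simp add: nn_integral_cmult)
    finally show ?thesis .
  qed
  then show ?thesis
    by (simp add: nn_integral_sum sum_distrib_left)
qed

text \<open>The ideal average over the true codeword of the other user and the resulting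
  observation; \<open>ch\<close> is the channel with the input of the decoded user held
  fixed.\<close>

definition code_average ::
  "'w pmf \<Rightarrow> ('w \<Rightarrow> real) \<Rightarrow> ('w \<Rightarrow> 'x pmf) \<Rightarrow> ('x \<Rightarrow> 'y pmf) \<Rightarrow> ('y \<Rightarrow> 'o) \<Rightarrow> ('w \<Rightarrow> 'o \<Rightarrow> ennreal) \<Rightarrow> ennreal" where
  "code_average pw r ex ch obs \<psi> =
     (\<integral>\<^sub>pw. ennreal (r w) * (\<integral>\<^sub>px. \<integral>\<^sub>py. \<psi> w (obs y) \<partial>(ch x) \<partial>(ex w)) \<partial>pw)"

lemma code_average_le:
  assumes "(\<integral>\<^sub>pw. ennreal (r w) \<partial>pw) \<le> 1" "\<And>w ob. \<psi> w ob \<le> c"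
  shows "code_average pw r ex ch obs \<psi> \<le> c"
  unfolding code_average_def
  by (intro nn_integral_weighted_le assms nn_integral_pmf_le_const)

text \<open>The sum over wrong words moves inside the average over the true transmission, whose
  total weight is at most 1. A bound for each fixed codeword and observation therefore
  suffices.\<close>

lemma code_average_sum_le:
  assumes "(\<integral>\<^sub>pw. ennreal (r w) \<partial>pw) \<le> 1"
    and "\<And>w ob. (\<Sum>u\<in>A. \<integral>\<^sub>pz. c u z * t u z w ob \<partial>(p u)) \<le> \<beta>"
  shows "(\<Sum>u\<in>A. \<integral>\<^sub>pz. c u z * code_average pw r ex ch obs (t u z) \<partial>(p u)) \<le> \<beta>"
proof -
  \<comment> \<open>The average sees only codeword and observation; collecting them in one pmf makes
    the exchange a single swap.\<close>
  define q where "q = do { w \<leftarrow> pw; x \<leftarrow> ex w; y \<leftarrow> ch x; return_pmf (w, obs y) }"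
  have avg: "code_average pw r ex ch obs \<psi> = (\<integral>\<^sub>pv. ennreal (r (fst v)) * \<psi> (fst v) (snd v) \<partial>q)" for \<psi>
    by (simp add: code_average_def q_def nn_integral_cmult)
  have "(\<Sum>u\<in>A. \<integral>\<^sub>pz. c u z * code_average pw r ex ch obs (t u z) \<partial>(p u))
      = code_average pw r ex ch obs (\<lambda>w ob. \<Sum>u\<in>A. \<integral>\<^sub>pz. c u z * t u z w ob \<partial>(p u))"
    unfolding avg sum_weighted_swap ..
  also have "\<dots> \<le> \<beta>"
    by (intro code_average_le assms)
  finally show ?thesis .
qed


context
  fixes S :: "'s pmf" and a1 :: "'s \<Rightarrow> 'u1" and a2 :: "'s \<Rightarrow> 'u2"
    and ch :: "'x1 \<Rightarrow> 'x2 \<Rightarrow> 'y pmf" and obs :: "'s \<Rightarrow> 'y \<Rightarrow> 'o"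
    and A1 :: "'u1 set" and A2 :: "'u2 set"
    and pw1 :: "'w1 pmf" and r1 :: "'u1 \<Rightarrow> 'w1 \<Rightarrow> real" and ex1 :: "'u1 \<Rightarrow> 'w1 \<Rightarrow> 'x1 pmf" and M1 :: nat and B1 :: real
    and pw2 :: "'w2 pmf" and r2 :: "'u2 \<Rightarrow> 'w2 \<Rightarrow> real" and ex2 :: "'u2 \<Rightarrow> 'w2 \<Rightarrow> 'x2 pmf" and M2 :: nat and B2 :: real
    and T :: "'u1 \<Rightarrow> 'w1 \<Rightarrow> 'x1 \<Rightarrow> 'w2 \<Rightarrow> 'o \<Rightarrow> bool"
    and \<beta>a \<beta>b \<beta>c \<beta>d :: ennreal
  assumes A: "finite A1" "finite A2" "\<And>s. a1 s \<in> A1" "\<And>s. a2 s \<in> A2"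
    and M: "M1 > 0" "M2 > 0"
    and r: "\<And>u w. 0 \<le> r1 u w" "\<And>u w. 0 \<le> r2 u w"
    and r_le: "\<And>u. (\<integral>\<^sub>pw. ennreal (r1 u w) \<partial>pw1) \<le> 1"
      "\<And>u. (\<integral>\<^sub>pw. ennreal (r2 u w) \<partial>pw2) \<le> 1"
    and a: "\<And>w w2 ob. (\<Sum>u\<in>A1. ennreal (r1 u w) *
          (\<integral>\<^sub>px. of_bool (T u w x w2 ob) \<partial>(ex1 u w))) \<le> \<beta>a"
    and b: "\<And>w2 ob. (\<Sum>u\<in>A1. \<integral>\<^sub>pw. ennreal (r1 u w) *
          (\<integral>\<^sub>px. of_bool (T u w x w2 ob) \<partial>(ex1 u w)) \<partial>pw1) \<le> \<beta>b"
    and c: "\<And>w ob. (\<Sum>u\<in>A1. ennreal (r1 u w) * (\<integral>\<^sub>px. \<integral>\<^sub>pw2.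
          of_bool (T u w x w2 ob) \<partial>pw2 \<partial>(ex1 u w))) \<le> \<beta>c"
    and d: "\<And>ob. (\<Sum>u\<in>A1. \<integral>\<^sub>pw. ennreal (r1 u w) * (\<integral>\<^sub>px. \<integral>\<^sub>pw2.
          of_bool (T u w x w2 ob) \<partial>pw2 \<partial>(ex1 u w)) \<partial>pw1) \<le> \<beta>d"
begin

text \<open>The wrong word \<open>u\<close> uses the true codeword \<open>w\<close>. The two
  summands belong to the true word of the other user and to an independent one, for which the
  averaged function ignores its first argument. Enlarging the sum to all of \<open>A1\<close> only
  increases it.\<close>

lemma confusion_same_le:
  "(\<Sum>u\<in>A1 - D. ennreal (r1 u w) * (\<integral>\<^sub>px. (code_average pw2 (r2 v) (ex2 v) k g (\<lambda>w2 ob. of_bool (T u w x w2 ob))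
      + of_nat M2 * code_average pw2 (r2 v) (ex2 v) k g (\<lambda>_ ob. \<integral>\<^sub>pw2. of_bool (T u w x w2 ob) \<partial>pw2))
        \<partial>(ex1 u w))) \<le> \<beta>a + of_nat M2 * \<beta>c"
proof -
  have "(\<Sum>u\<in>A1 - D. ennreal (r1 u w) * (\<integral>\<^sub>px. (code_average pw2 (r2 v) (ex2 v) k g (\<lambda>w2 ob. of_bool (T u w x w2 ob))
      + of_nat M2 * code_average pw2 (r2 v) (ex2 v) k g (\<lambda>_ ob. \<integral>\<^sub>pw2. of_bool (T u w x w2 ob) \<partial>pw2))
        \<partial>(ex1 u w)))
     \<le> (\<Sum>u\<in>A1. ennreal (r1 u w) * (\<integral>\<^sub>px. (code_average pw2 (r2 v) (ex2 v) k g (\<lambda>w2 ob. of_bool (T u w x w2 ob))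
      + of_nat M2 * code_average pw2 (r2 v) (ex2 v) k g (\<lambda>_ ob. \<integral>\<^sub>pw2. of_bool (T u w x w2 ob) \<partial>pw2))
        \<partial>(ex1 u w)))"
    using A(1) by (intro sum_mono2) auto
  also have "\<dots> = (\<Sum>u\<in>A1. \<integral>\<^sub>px. ennreal (r1 u w) * code_average pw2 (r2 v) (ex2 v) k g (\<lambda>w2 ob. of_bool (T u w x w2 ob)) \<partial>(ex1 u w))
     + of_nat M2 * (\<Sum>u\<in>A1. \<integral>\<^sub>px. ennreal (r1 u w) * code_average pw2 (r2 v) (ex2 v) k g
          (\<lambda>_ ob. \<integral>\<^sub>pw2. of_bool (T u w x w2 ob) \<partial>pw2) \<partial>(ex1 u w))"
    by (simp add: nn_integral_add nn_integral_cmult distrib_left sum.distrib sum_distrib_left mult.left_commute)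
  also have "\<dots> \<le> \<beta>a + of_nat M2 * \<beta>c"
    using a c by (intro add_mono mult_left_mono code_average_sum_le r_le zero_le) (simp_all add: nn_integral_cmult)
  finally show ?thesis .
qed

text \<open>The counterpart with a fresh codeword for \<open>u\<close>: the pair of codeword and
  input now plays the role of \<open>z\<close> in \<open>code_average_sum_le\<close>.\<close>

lemma confusion_other_le:
  "(\<Sum>u\<in>A1 - D. \<integral>\<^sub>pw. ennreal (r1 u w) * (\<integral>\<^sub>px. (code_average pw2 (r2 v) (ex2 v) k g (\<lambda>w2 ob. of_bool (T u w x w2 ob))
      + of_nat M2 * code_average pw2 (r2 v) (ex2 v) k g (\<lambda>_ ob. \<integral>\<^sub>pw2. of_bool (T u w x w2 ob) \<partial>pw2))
        \<partial>(ex1 u w)) \<partial>pw1) \<le> \<beta>b + of_nat M2 * \<beta>d"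
proof -
  define p where "p u = do { w \<leftarrow> pw1; x \<leftarrow> ex1 u w; return_pmf (w, x) }" for u
  have p: "(\<integral>\<^sub>pz. ennreal (r1 u (fst z)) * f (fst z) (snd z) \<partial>(p u))
      = (\<integral>\<^sub>pw. ennreal (r1 u w) * (\<integral>\<^sub>px. f w x \<partial>(ex1 u w)) \<partial>pw1)" for u f
    by (simp add: p_def nn_integral_cmult)
  have "(\<Sum>u\<in>A1 - D. \<integral>\<^sub>pw. ennreal (r1 u w) * (\<integral>\<^sub>px. (code_average pw2 (r2 v) (ex2 v) k g (\<lambda>w2 ob. of_bool (T u w x w2 ob))
      + of_nat M2 * code_average pw2 (r2 v) (ex2 v) k g (\<lambda>_ ob. \<integral>\<^sub>pw2. of_bool (T u w x w2 ob) \<partial>pw2))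
        \<partial>(ex1 u w)) \<partial>pw1)
     \<le> (\<Sum>u\<in>A1. \<integral>\<^sub>pw. ennreal (r1 u w) * (\<integral>\<^sub>px. (code_average pw2 (r2 v) (ex2 v) k g (\<lambda>w2 ob. of_bool (T u w x w2 ob))
      + of_nat M2 * code_average pw2 (r2 v) (ex2 v) k g (\<lambda>_ ob. \<integral>\<^sub>pw2. of_bool (T u w x w2 ob) \<partial>pw2))
        \<partial>(ex1 u w)) \<partial>pw1)"
    using A(1) by (intro sum_mono2) auto
  also have "\<dots> = (\<Sum>u\<in>A1. \<integral>\<^sub>pz. ennreal (r1 u (fst z)) * code_average pw2 (r2 v) (ex2 v) k g (\<lambda>w2 ob. of_bool (T u (fst z) (snd z) w2 ob)) \<partial>(p u))
     + of_nat M2 * (\<Sum>u\<in>A1. \<integral>\<^sub>pz. ennreal (r1 u (fst z)) * code_average pw2 (r2 v) (ex2 v) k g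
          (\<lambda>_ ob. \<integral>\<^sub>pw2. of_bool (T u (fst z) (snd z) w2 ob) \<partial>pw2) \<partial>(p u))"
    unfolding p[where f = "\<lambda>w x. code_average pw2 (r2 v) (ex2 v) k g (\<lambda>w2 ob. of_bool (T u w x w2 ob))" for u]
      p[where f = "\<lambda>w x. code_average pw2 (r2 v) (ex2 v) k g (\<lambda>_ ob. \<integral>\<^sub>pw2. of_bool (T u w x w2 ob) \<partial>pw2)" for u]
    by (simp add: nn_integral_add nn_integral_cmult distrib_left sum.distrib sum_distrib_left mult.left_commute)
  also have "\<dots> \<le> \<beta>b + of_nat M2 * \<beta>d"
    using b d
      p[where f = "\<lambda>w x. of_bool (T u w x w2 ob)" for u w2 ob]
      p[where f = "\<lambda>w x. \<integral>\<^sub>pw2. of_bool (T u w x w2 ob) \<partial>pw2" for u ob]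
    by (intro add_mono mult_left_mono code_average_sum_le r_le zero_le) simp_all
  finally show ?thesis .
qed

text \<open>A wrong source word shares the index of the true one (\<open>\<beta>a\<close>, \<open>\<beta>c\<close>) or not (\<open>\<beta>b\<close>, \<open>\<beta>d\<close>), and it is
  accepted with the true codeword of the other user (\<open>\<beta>a\<close>, \<open>\<beta>b\<close>) or with a wrong one (\<open>\<beta>c\<close>, \<open>\<beta>d\<close>).\<close>

lemma random_coding_error_le:
  "(\<integral>\<^sub>pC1. \<integral>\<^sub>pC2. \<integral>\<^sub>ps. \<integral>\<^sub>py. of_bool (decoding_failure A1 M1 M2 T C1 (fst C2) (obs s y) (a1 s))
       \<partial>(ch (snd (snd C1 (a1 s))) (snd (snd C2 (a2 s)))) \<partial>S
       \<partial>(codebook A2 pw2 r2 ex2 M2 B2) \<partial>(codebook A1 pw1 r1 ex1 M1 B1))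
   \<le> (\<integral>\<^sub>ps. (\<integral>\<^sub>pC1. (if fst (snd C1 (a1 s)) < M1 then 0 else 1) \<partial>(codebook A1 pw1 r1 ex1 M1 B1)) \<partial>S)
     + (\<integral>\<^sub>ps. (\<integral>\<^sub>pC2. (if fst (snd C2 (a2 s)) < M2 then 0 else 1) \<partial>(codebook A2 pw2 r2 ex2 M2 B2)) \<partial>S)
     + (\<integral>\<^sub>ps. \<integral>\<^sub>pw1. ennreal (r1 (a1 s) w1) * (\<integral>\<^sub>px1. \<integral>\<^sub>pw2. ennreal (r2 (a2 s) w2) * (\<integral>\<^sub>px2. \<integral>\<^sub>py.
            of_bool (\<not> T (a1 s) w1 x1 w2 (obs s y)) \<partial>(ch x1 x2) \<partial>(ex2 (a2 s) w2))
            \<partial>pw2 \<partial>(ex1 (a1 s) w1)) \<partial>pw1 \<partial>S)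
     + (ennreal (1 / M1) * (\<beta>a + of_nat M2 * \<beta>c) + (\<beta>b + of_nat M2 * \<beta>d))"
proof -
  let ?C1 = "measure_pmf (codebook A1 pw1 r1 ex1 M1 B1)" and ?C2 = "measure_pmf (codebook A2 pw2 r2 ex2 M2 B2)"
  let ?F1 = "\<lambda>s. \<integral>\<^sup>+C1. (if fst (snd C1 (a1 s)) < M1 then 0 else 1 :: ennreal) \<partial>?C1"
  let ?F2 = "\<lambda>s. \<integral>\<^sup>+C2. (if fst (snd C2 (a2 s)) < M2 then 0 else 1 :: ennreal) \<partial>?C2"
  let ?R = "ennreal (1 / M1) * (\<beta>a + of_nat M2 * \<beta>c) + (\<beta>b + of_nat M2 * \<beta>d)"
  let ?T = "\<lambda>s. \<integral>\<^sub>pw1. ennreal (r1 (a1 s) w1) * (\<integral>\<^sub>px1. \<integral>\<^sub>pw2. ennreal (r2 (a2 s) w2) * (\<integral>\<^sub>px2. \<integral>\<^sub>py.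
            of_bool (\<not> T (a1 s) w1 x1 w2 (obs s y)) \<partial>(ch x1 x2) \<partial>(ex2 (a2 s) w2))
            \<partial>pw2 \<partial>(ex1 (a1 s) w1)) \<partial>pw1"
  \<comment> \<open>The source block is held fixed and averaged last, which is possible because the
    codebooks are drawn independently of it.\<close>
  have main: "(\<integral>\<^sup>+C1. \<integral>\<^sup>+C2. \<integral>\<^sub>py. of_bool (decoding_failure A1 M1 M2 T C1 (fst C2) (obs s y) (a1 s))
       \<partial>(ch (snd (snd C1 (a1 s))) (snd (snd C2 (a2 s)))) \<partial>?C2 \<partial>?C1)
     \<le> ?F1 s + ?F2 s + ?T s + ?R" for s
  proof -
    define u where "u = a1 s"
    define v where "v = a2 s"
    have u: "u \<in> A1" and v: "v \<in> A2"
      using A by (auto simp: u_def v_def)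
    define tr where "tr w1 x1 w2 x2 = (\<integral>\<^sub>py. of_bool (\<not> T u w1 x1 w2 (obs s y)) \<partial>(ch x1 x2))" for w1 x1 w2 x2
    define cf where "cf u' w' x' w2 x1 x2 = (\<integral>\<^sub>py. of_bool (T u' w' x' w2 (obs s y)) \<partial>(ch x1 x2))" for u' w' x' w2 x1 x2
    define \<Phi> where "\<Phi> x1 = code_average pw2 (r2 v) (ex2 v) (ch x1) (obs s)" for x1
    \<comment> \<open>Bounds the expected number of words of user 2 that make the wrong triple
      acceptable: the true word, and \<open>M2\<close> words independent of the observation.\<close>
    define H where "H x1 u' w' x' = \<Phi> x1 (\<lambda>w2 ob. of_bool (T u' w' x' w2 ob))
        + of_nat M2 * \<Phi> x1 (\<lambda>_ ob. \<integral>\<^sub>pw2. of_bool (T u' w' x' w2 ob) \<partial>pw2)" for x1 u' w' x'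
    have true_term: "(\<integral>\<^sup>+C1. (case snd C1 u of (m1, x1) \<Rightarrow> if m1 < M1 then
          (\<integral>\<^sup>+C2. (case snd C2 v of (m2, x2) \<Rightarrow> if m2 < M2 then tr (fst C1 m1) x1 (fst C2 m2) x2 else 0) \<partial>?C2) else 0) \<partial>?C1)
        \<le> ?T s"
    proof -
      have "(\<integral>\<^sup>+C1. (case snd C1 u of (m1, x1) \<Rightarrow> if m1 < M1 then
          (\<integral>\<^sup>+C2. (case snd C2 v of (m2, x2) \<Rightarrow> if m2 < M2 then tr (fst C1 m1) x1 (fst C2 m2) x2 else 0) \<partial>?C2) else 0) \<partial>?C1)
         \<le> (\<integral>\<^sup>+C1. (case snd C1 u of (m1, x1) \<Rightarrow> if m1 < M1 then
          (\<integral>\<^sub>pw2. ennreal (r2 v w2) * (\<integral>\<^sub>px2. tr (fst C1 m1) x1 w2 x2 \<partial>(ex2 v w2)) \<partial>pw2) else 0) \<partial>?C1)"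
        using codebook_single_le1[OF A(2) M(2), where r = r2, OF r(2) v, where h = "tr w x" for w x]
        by (intro nn_integral_mono) (auto split: prod.split)
      also have "\<dots> \<le> ?T s"
        unfolding tr_def u_def[symmetric] v_def[symmetric]
        by (rule codebook_single_le1[OF A(1) M(1) r(1) u, where h = "\<lambda>w1 x1. \<integral>\<^sub>pw2. ennreal (r2 v w2) *
            (\<integral>\<^sub>px2. \<integral>\<^sub>py. of_bool (\<not> T u w1 x1 w2 (obs s y)) \<partial>(ch x1 x2) \<partial>(ex2 v w2)) \<partial>pw2"])
      finally show ?thesis .
    qed
    have conf_term: "(\<Sum>u'\<in>A1 - {u}. \<integral>\<^sup>+C1. (case snd C1 u of (m1, x1) \<Rightarrow> case snd C1 u' of (m', x') \<Rightarrow>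
          if m1 < M1 then if m' < M1 then
          (\<integral>\<^sup>+C2. (case snd C2 v of (m2, x2) \<Rightarrow> if m2 < M2 then (\<Sum>j<M2. cf u' (fst C1 m') x' (fst C2 j) x1 x2) else 0) \<partial>?C2)
          else 0 else 0) \<partial>?C1) \<le> ?R"
    proof -
      have inner: "(\<integral>\<^sup>+C2. (case snd C2 v of (m2, x2) \<Rightarrow> if m2 < M2 then (\<Sum>j<M2. cf u' w' x' (fst C2 j) x1 x2) else 0) \<partial>?C2)
          \<le> H x1 u' w' x'" for u' w' x' x1
      proof -
        have "(\<integral>\<^sup>+C2. (case snd C2 v of (m2, x2) \<Rightarrow> if m2 < M2 then (\<Sum>j<M2. cf u' w' x' (fst C2 j) x1 x2) else 0) \<partial>?C2)
          \<le> (\<integral>\<^sub>pw2. ennreal (r2 v w2) * (\<integral>\<^sub>px2. cf u' w' x' w2 x1 x2 \<partial>(ex2 v w2)) \<partial>pw2)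
            + of_nat M2 * (\<integral>\<^sub>pw. ennreal (r2 v w) * (\<integral>\<^sub>px2. \<integral>\<^sub>pw2. cf u' w' x' w2 x1 x2 \<partial>pw2 \<partial>(ex2 v w)) \<partial>pw2)"
          by (rule codebook_single_le[OF A(2) M(2) r(2) v, where h = "\<lambda>_ x2 w2. cf u' w' x' w2 x1 x2"])
        \<comment> \<open>The codebook bound draws the independent word before the channel output,
          \<open>code_average\<close> after it.\<close>
        also have "\<dots> = H x1 u' w' x'"
          unfolding H_def \<Phi>_def code_average_def cf_def
          by (subst (3) nn_integral_pmf_swap) (rule refl)
        finally show ?thesis .
      qed
      have outer: "(\<integral>\<^sup>+C1. (case snd C1 u of (m1, x1) \<Rightarrow> case snd C1 u' of (m', x') \<Rightarrow>
          if m1 < M1 then if m' < M1 then H x1 u' (fst C1 m') x' else 0 else 0) \<partial>?C1)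
          \<le> ennreal (1 / M1) * (\<integral>\<^sub>pw. ennreal (r1 u w) * (\<integral>\<^sub>px. ennreal (r1 u' w) *
               (\<integral>\<^sub>px'. H x u' w x' \<partial>(ex1 u' w)) \<partial>(ex1 u w)) \<partial>pw1)
           + (\<integral>\<^sub>pw. ennreal (r1 u w) * (\<integral>\<^sub>px. \<integral>\<^sub>pw'. ennreal (r1 u' w') *
               (\<integral>\<^sub>px'. H x u' w' x' \<partial>(ex1 u' w')) \<partial>pw1 \<partial>(ex1 u w)) \<partial>pw1)"
        if u': "u' \<in> A1 - {u}" for u'
        using u' by (intro codebook_pair_le[OF A(1) M(1) r(1), where h = "\<lambda>w x w' x'. H x u' w' x'"] u) auto
      have "(\<Sum>u'\<in>A1 - {u}. \<integral>\<^sup>+C1. (case snd C1 u of (m1, x1) \<Rightarrow> case snd C1 u' of (m', x') \<Rightarrow>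
          if m1 < M1 then if m' < M1 then
          (\<integral>\<^sup>+C2. (case snd C2 v of (m2, x2) \<Rightarrow> if m2 < M2 then (\<Sum>j<M2. cf u' (fst C1 m') x' (fst C2 j) x1 x2) else 0) \<partial>?C2)
          else 0 else 0) \<partial>?C1)
        \<le> (\<Sum>u'\<in>A1 - {u}. \<integral>\<^sup>+C1. (case snd C1 u of (m1, x1) \<Rightarrow> case snd C1 u' of (m', x') \<Rightarrow>
          if m1 < M1 then if m' < M1 then H x1 u' (fst C1 m') x' else 0 else 0) \<partial>?C1)"
        using inner by (intro sum_mono nn_integral_mono) (auto split: prod.split)
      also have "\<dots> \<le> (\<Sum>u'\<in>A1 - {u}. ennreal (1 / M1) * (\<integral>\<^sub>pw. ennreal (r1 u w) * (\<integral>\<^sub>px. ennreal (r1 u' w) *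
               (\<integral>\<^sub>px'. H x u' w x' \<partial>(ex1 u' w)) \<partial>(ex1 u w)) \<partial>pw1)
           + (\<integral>\<^sub>pw. ennreal (r1 u w) * (\<integral>\<^sub>px. \<integral>\<^sub>pw'. ennreal (r1 u' w') *
               (\<integral>\<^sub>px'. H x u' w' x' \<partial>(ex1 u' w')) \<partial>pw1 \<partial>(ex1 u w)) \<partial>pw1))"
        by (intro sum_mono outer)
      \<comment> \<open>The sum over wrong words goes to the place where the true \<open>w\<close>
        and \<open>x\<close> are already fixed, because the confusion bounds hold for each such
        pair.\<close>
      also have "\<dots> = ennreal (1 / M1) * (\<integral>\<^sub>pw. ennreal (r1 u w) * (\<integral>\<^sub>px. (\<Sum>u'\<in>A1 - {u}. ennreal (r1 u' w) *
               (\<integral>\<^sub>px'. H x u' w x' \<partial>(ex1 u' w))) \<partial>(ex1 u w)) \<partial>pw1)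
           + (\<integral>\<^sub>pw. ennreal (r1 u w) * (\<integral>\<^sub>px. (\<Sum>u'\<in>A1 - {u}. \<integral>\<^sub>pw'. ennreal (r1 u' w') *
               (\<integral>\<^sub>px'. H x u' w' x' \<partial>(ex1 u' w')) \<partial>pw1) \<partial>(ex1 u w)) \<partial>pw1)"
        by (simp add: sum.distrib sum_distrib_left nn_integral_sum)
      also have "\<dots> \<le> ?R"
        unfolding H_def \<Phi>_def
        by (intro add_mono mult_left_mono nn_integral_weighted_le r_le nn_integral_pmf_le_const
             confusion_same_le confusion_other_le zero_le)
      finally show ?thesis .
    qed
    have "(\<integral>\<^sup>+C1. \<integral>\<^sup>+C2. \<integral>\<^sub>py. of_bool (decoding_failure A1 M1 M2 T C1 (fst C2) (obs s y) u)
       \<partial>(ch (snd (snd C1 u)) (snd (snd C2 v))) \<partial>?C2 \<partial>?C1)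
      \<le> (\<integral>\<^sup>+C1. \<integral>\<^sup>+C2. \<integral>\<^sub>py. ((if fst (snd C1 u) < M1 then 0 else 1) + (if fst (snd C2 v) < M2 then 0 else 1)
      + (case snd C1 u of (m1, x1) \<Rightarrow> if m1 < M1 then
          (case snd C2 v of (m2, x2) \<Rightarrow> if m2 < M2 then of_bool (\<not> T u (fst C1 m1) x1 (fst C2 m2) (obs s y)) else 0) else 0)
      + (\<Sum>u'\<in>A1 - {u}. case snd C1 u of (m1, x1) \<Rightarrow> case snd C1 u' of (m', x') \<Rightarrow> if m1 < M1 then if m' < M1 then
          (case snd C2 v of (m2, x2) \<Rightarrow> if m2 < M2 then
             (\<Sum>j<M2. of_bool (T u' (fst C1 m') x' (fst C2 j) (obs s y))) else 0) else 0 else 0))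
       \<partial>(ch (snd (snd C1 u)) (snd (snd C2 v))) \<partial>?C2 \<partial>?C1)"
      by (intro nn_integral_mono of_bool_decoding_failure_le A)
    also have "\<dots> = (\<integral>\<^sup>+C1. (if fst (snd C1 u) < M1 then 0 else 1) \<partial>?C1) + (\<integral>\<^sup>+C2. (if fst (snd C2 v) < M2 then 0 else 1) \<partial>?C2)
      + (\<integral>\<^sup>+C1. (case snd C1 u of (m1, x1) \<Rightarrow> if m1 < M1 then
          (\<integral>\<^sup>+C2. (case snd C2 v of (m2, x2) \<Rightarrow> if m2 < M2 then tr (fst C1 m1) x1 (fst C2 m2) x2 else 0) \<partial>?C2) else 0) \<partial>?C1)
      + (\<Sum>u'\<in>A1 - {u}. \<integral>\<^sup>+C1. (case snd C1 u of (m1, x1) \<Rightarrow> case snd C1 u' of (m', x') \<Rightarrow>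
          if m1 < M1 then if m' < M1 then
          (\<integral>\<^sup>+C2. (case snd C2 v of (m2, x2) \<Rightarrow> if m2 < M2 then (\<Sum>j<M2. cf u' (fst C1 m') x' (fst C2 j) x1 x2) else 0) \<partial>?C2)
          else 0 else 0) \<partial>?C1)"
    proof -
      have 1: "(\<integral>\<^sup>+C2. \<integral>\<^sub>py. (case snd C1 u of (m1, x1) \<Rightarrow> if m1 < M1 then
          (case snd C2 v of (m2, x2) \<Rightarrow> if m2 < M2 then of_bool (\<not> T u (fst C1 m1) x1 (fst C2 m2) (obs s y)) else 0) else 0)
           \<partial>(ch (snd (snd C1 u)) (snd (snd C2 v))) \<partial>?C2)
        = (case snd C1 u of (m1, x1) \<Rightarrow> if m1 < M1 then
          (\<integral>\<^sup>+C2. (case snd C2 v of (m2, x2) \<Rightarrow> if m2 < M2 then tr (fst C1 m1) x1 (fst C2 m2) x2 else 0) \<partial>?C2) else 0)" for C1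
        by (auto simp: tr_def split: prod.split intro!: nn_integral_cong)
      have 2: "(\<integral>\<^sup>+C2. \<integral>\<^sub>py. (case snd C1 u of (m1, x1) \<Rightarrow> case snd C1 u' of (m', x') \<Rightarrow> if m1 < M1 then if m' < M1 then
          (case snd C2 v of (m2, x2) \<Rightarrow> if m2 < M2 then
             (\<Sum>j<M2. of_bool (T u' (fst C1 m') x' (fst C2 j) (obs s y))) else 0) else 0 else 0)
           \<partial>(ch (snd (snd C1 u)) (snd (snd C2 v))) \<partial>?C2)
        = (case snd C1 u of (m1, x1) \<Rightarrow> case snd C1 u' of (m', x') \<Rightarrow>
          if m1 < M1 then if m' < M1 then
          (\<integral>\<^sup>+C2. (case snd C2 v of (m2, x2) \<Rightarrow> if m2 < M2 then (\<Sum>j<M2. cf u' (fst C1 m') x' (fst C2 j) x1 x2) else 0) \<partial>?C2)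
          else 0 else 0)" for C1 u'
        by (auto simp: cf_def nn_integral_sum simp del: sum_of_bool_eq split: prod.split intro!: nn_integral_cong)
      show ?thesis
        by (simp only: nn_integral_pmf_add nn_integral_pmf_sum nn_integral_pmf_const 1 2)
    qed
    also have "\<dots> \<le> ?F1 s + ?F2 s + ?T s + ?R"
      using true_term conf_term unfolding u_def v_def by (intro add_mono order.refl)
    finally show ?thesis
      unfolding u_def v_def .
  qed
  have "(\<integral>\<^sup>+C1. \<integral>\<^sup>+C2. \<integral>\<^sub>ps. \<integral>\<^sub>py. of_bool (decoding_failure A1 M1 M2 T C1 (fst C2) (obs s y) (a1 s))
       \<partial>(ch (snd (snd C1 (a1 s))) (snd (snd C2 (a2 s)))) \<partial>S \<partial>?C2 \<partial>?C1)
     = (\<integral>\<^sub>ps. \<integral>\<^sup>+C1. \<integral>\<^sup>+C2. \<integral>\<^sub>py. of_bool (decoding_failure A1 M1 M2 T C1 (fst C2) (obs s y) (a1 s))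
       \<partial>(ch (snd (snd C1 (a1 s))) (snd (snd C2 (a2 s)))) \<partial>?C2 \<partial>?C1 \<partial>S)"
    by (subst (2) nn_integral_pmf_swap) (rule nn_integral_pmf_swap)
  also have "\<dots> \<le> (\<integral>\<^sub>ps. ?F1 s + ?F2 s + ?T s + ?R \<partial>S)"
    by (intro nn_integral_mono main)
  also have "\<dots> = (\<integral>\<^sub>ps. ?F1 s \<partial>S) + (\<integral>\<^sub>ps. ?F2 s \<partial>S) + (\<integral>\<^sub>ps. ?T s \<partial>S) + ?R"
    by (simp add: nn_integral_add)
  finally show ?thesis .
qed

end

section \<open>Information densities\<close>

lemma integrable_pmf_finite_type [simp]:
  fixes f :: "'a::finite \<Rightarrow> real"
  shows "integrable (measure_pmf p) f"
  by (rule integrable_measure_pmf_finite) simp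

lemma expectation_finite_type:
  fixes f :: "'a::finite \<Rightarrow> real"
  shows "measure_pmf.expectation p f = (\<Sum>x\<in>UNIV. pmf p x * f x)"
  by (subst integral_measure_pmf_real[of UNIV]) (auto simp: mult.commute)

lemma nn_integral_finite_type:
  fixes f :: "'a::finite \<Rightarrow> real"
  assumes "\<And>x. 0 \<le> f x"
  shows "(\<integral>\<^sub>px. ennreal (f x) \<partial>p) = ennreal (\<Sum>x\<in>UNIV. pmf p x * f x)"
  using assms by (simp add: nn_integral_eq_integral expectation_finite_type)

text \<open>This is p(x|y,z) / p(x|z), whose logarithm has mean I(X;Y|Z). Without the logarithm it
  multiplies over a block, and impossible letters simply have value 0.\<close>

definition info_density ::
  "'a pmf \<Rightarrow> ('a \<Rightarrow> 'x) \<Rightarrow> ('a \<Rightarrow> 'y) \<Rightarrow> ('a \<Rightarrow> 'z) \<Rightarrow> 'x \<Rightarrow> 'y \<Rightarrow> 'z \<Rightarrow> real" where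
  "info_density p X Y Z x y z =
     pmf (map_pmf (\<lambda>\<omega>. (X \<omega>, Y \<omega>, Z \<omega>)) p) (x, y, z) * pmf (map_pmf Z p) z
     / (pmf (map_pmf (\<lambda>\<omega>. (X \<omega>, Z \<omega>)) p) (x, z) * pmf (map_pmf (\<lambda>\<omega>. (Y \<omega>, Z \<omega>)) p) (y, z))"

lemma info_density_nonneg: "0 \<le> info_density p X Y Z x y z"
  by (simp add: info_density_def)

lemma pmf_map_pos: "\<omega> \<in> set_pmf p \<Longrightarrow> 0 < pmf (map_pmf X p) (X \<omega>)"
  by (rule pmf_positive) simp

lemma info_density_pos:
  assumes "\<omega> \<in> set_pmf p"
  shows "0 < info_density p X Y Z (X \<omega>) (Y \<omega>) (Z \<omega>)"
  unfolding info_density_def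
  using pmf_map_pos[OF assms, of "\<lambda>\<omega>. (X \<omega>, Y \<omega>, Z \<omega>)"] pmf_map_pos[OF assms, of Z]
    pmf_map_pos[OF assms, of "\<lambda>\<omega>. (X \<omega>, Z \<omega>)"] pmf_map_pos[OF assms, of "\<lambda>\<omega>. (Y \<omega>, Z \<omega>)"]
  by simp

lemma simple_distributed_pmf_finite:
  fixes p :: "'b::finite pmf"
  shows "simple_distributed (measure_pmf p) X (\<lambda>x. pmf (map_pmf X p) x)"
  by (intro measure_pmf.simple_distributedI) (auto simp: simple_function_def pmf_map)

lemma pmf_cmi_eq_expectation:
  fixes p :: "'a::finite pmf"
  shows "pmf_cmi p X Y Z = measure_pmf.expectation p (\<lambda>\<omega>. log 2 (info_density p X Y Z (X \<omega>) (Y \<omega>) (Z \<omega>)))"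
proof -
  interpret information_space "measure_pmf p" 2
    by standard simp
  let ?T = "\<lambda>\<omega>. (X \<omega>, Y \<omega>, Z \<omega>)"
  have "pmf_cmi p X Y Z = (\<Sum>(x, y, z)\<in>range ?T. pmf (map_pmf ?T p) (x, y, z) *
      log 2 (pmf (map_pmf ?T p) (x, y, z) / (pmf (map_pmf (\<lambda>\<omega>. (X \<omega>, Z \<omega>)) p) (x, z) *
        (pmf (map_pmf (\<lambda>\<omega>. (Y \<omega>, Z \<omega>)) p) (y, z) / pmf (map_pmf Z p) z))))"
    unfolding pmf_cmi_def
    by (subst conditional_mutual_information_eq[OF simple_distributed_pmf_finite simple_distributed_pmf_finite
          simple_distributed_pmf_finite simple_distributed_pmf_finite]) auto
  also have "\<dots> = (\<Sum>t\<in>range ?T. log 2 (info_density p X Y Z (fst t) (fst (snd t)) (snd (snd t))) * pmf (map_pmf ?T p) t)"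
    by (simp add: info_density_def case_prod_unfold mult.commute)
  also have "\<dots> = measure_pmf.expectation (map_pmf ?T p) (\<lambda>t. log 2 (info_density p X Y Z (fst t) (fst (snd t)) (snd (snd t))))"
    by (subst integral_measure_pmf_real[of "range ?T"]) auto
  finally show ?thesis
    by simp
qed

lemma pmf_entropy_eq_expectation:
  fixes p :: "'a::finite pmf"
  shows "pmf_entropy p X = - measure_pmf.expectation p (\<lambda>\<omega>. log 2 (pmf (map_pmf X p) (X \<omega>)))"
proof -
  interpret information_space "measure_pmf p" 2
    by standard simp
  have "pmf_entropy p X = - (\<Sum>x\<in>range X. pmf (map_pmf X p) x * log 2 (pmf (map_pmf X p) x))"
    unfolding pmf_entropy_def
    by (subst entropy_simple_distributed[OF simple_distributed_pmf_finite]) auto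
  also have "(\<Sum>x\<in>range X. pmf (map_pmf X p) x * log 2 (pmf (map_pmf X p) x))
      = measure_pmf.expectation (map_pmf X p) (\<lambda>x. log 2 (pmf (map_pmf X p) x))"
    by (subst integral_measure_pmf_real[of "range X"]) (auto simp: mult.commute)
  finally show ?thesis
    by simp
qed

lemma pmf_cmi_nonneg:
  fixes p :: "'a::finite pmf"
  shows "0 \<le> pmf_cmi p X Y Z"
proof -
  interpret information_space "measure_pmf p" 2
    by standard simp
  show ?thesis
    unfolding pmf_cmi_def by (rule conditional_mutual_information_nonneg) (auto simp: simple_function_def)
qed

lemma pmf_cmi_map:
  fixes p :: "'a::finite pmf" and f :: "'a \<Rightarrow> 'b::finite"
  shows "pmf_cmi (map_pmf f p) X Y Z = pmf_cmi p (\<lambda>\<omega>. X (f \<omega>)) (\<lambda>\<omega>. Y (f \<omega>)) (\<lambda>\<omega>. Z (f \<omega>))"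
  by (simp add: pmf_cmi_eq_expectation info_density_def map_pmf_comp)

lemma pmf_entropy_map:
  fixes p :: "'a::finite pmf" and f :: "'a \<Rightarrow> 'b::finite"
  shows "pmf_entropy (map_pmf f p) X = pmf_entropy p (\<lambda>\<omega>. X (f \<omega>))"
  by (simp add: pmf_entropy_eq_expectation map_pmf_comp)

text \<open>Relabelling the condition injectively leaves all four probabilities of the density
  unchanged. This reconciles the two orders in which the receivers list W1 and W2.\<close>

lemma pmf_cmi_inj_cond:
  fixes p :: "'a::finite pmf"
  assumes "inj h"
  shows "pmf_cmi p X Y (\<lambda>\<omega>. h (Z \<omega>)) = pmf_cmi p X Y Z"
proof -
  have *: "pmf (map_pmf (\<lambda>\<omega>. g (V \<omega>)) p) (g v) = pmf (map_pmf V p) v" if "inj g"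
    for g :: "'v \<Rightarrow> 'w" and V v
    using pmf_map_inj'[OF that, of "map_pmf V p" v] by (simp add: map_pmf_comp)
  have "info_density p X Y (\<lambda>\<omega>. h (Z \<omega>)) x y (h z) = info_density p X Y Z x y z" for x y z
    unfolding info_density_def
    using *[OF assms, of Z z]
      *[of "\<lambda>(x, z). (x, h z)" "\<lambda>\<omega>. (X \<omega>, Z \<omega>)" "(x, z)"]
      *[of "\<lambda>(y, z). (y, h z)" "\<lambda>\<omega>. (Y \<omega>, Z \<omega>)" "(y, z)"]
      *[of "\<lambda>(x, y, z). (x, y, h z)" "\<lambda>\<omega>. (X \<omega>, Y \<omega>, Z \<omega>)" "(x, y, z)"] assms
    by (auto simp: inj_def)
  then show ?thesis
    by (simp add: pmf_cmi_eq_expectation)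
qed

lemma sum_pmf_fst:
  fixes p :: "('x::finite \<times> 'y) pmf"
  shows "(\<Sum>x\<in>UNIV. pmf p (x, y)) = pmf (map_pmf snd p) y"
proof -
  have "pmf (map_pmf snd p) y = measure_pmf.prob p ((\<lambda>x. (x, y)) ` UNIV)"
    by (auto simp: pmf_map intro!: arg_cong[where f = "measure_pmf.prob p"])
  also have "\<dots> = sum (pmf p) ((\<lambda>x. (x, y)) ` UNIV)"
    by (rule measure_measure_pmf_finite) auto
  also have "\<dots> = (\<Sum>x\<in>UNIV. pmf p (x, y))"
    by (subst sum.reindex) (auto simp: inj_on_def)
  finally show ?thesis ..
qed

text \<open>\<open>k\<close> stands for p(x|z), and p(x|z) times the density is p(x|y,z), which sums
  to at most 1. So the density has mean at most 1 when \<open>x\<close> is drawn independently of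
  \<open>y\<close> given \<open>z\<close>, which is the input to Markov's inequality for wrong
  words.\<close>

lemma sum_info_density_le_1:
  fixes X :: "'a \<Rightarrow> 'x::finite"
  assumes k: "\<And>x. 0 \<le> k x" "\<And>x. pmf (map_pmf (\<lambda>\<omega>. (X \<omega>, Z \<omega>)) p) (x, z) = k x * pmf (map_pmf Z p) z"
  shows "(\<Sum>x\<in>UNIV. k x * info_density p X Y Z x y z) \<le> 1"
proof -
  let ?yz = "pmf (map_pmf (\<lambda>\<omega>. (Y \<omega>, Z \<omega>)) p) (y, z)"
  let ?xyz = "\<lambda>x. pmf (map_pmf (\<lambda>\<omega>. (X \<omega>, Y \<omega>, Z \<omega>)) p) (x, y, z)"
  have "k x * info_density p X Y Z x y z \<le> ?xyz x / ?yz" for x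
    using k(1)[of x] by (auto simp: info_density_def k(2) mult_eq_0_iff)
  then have "(\<Sum>x\<in>UNIV. k x * info_density p X Y Z x y z) \<le> (\<Sum>x\<in>UNIV. ?xyz x / ?yz)"
    by (intro sum_mono)
  also have "\<dots> = ?yz / ?yz"
    by (simp add: sum_divide_distrib[symmetric] sum_pmf_fst map_pmf_comp)
  also have "\<dots> \<le> 1"
    by simp
  finally show ?thesis .
qed

text \<open>The moment generating function is 1 at 0 and its derivative there is the mean, which is
  negative, so it drops below 1 just to the right of 0.\<close>

lemma exp_moment_less_1:
  assumes "finite (set_pmf p)" and "measure_pmf.expectation p g < 0"
  obtains l :: real where "l > 0" "measure_pmf.expectation p (\<lambda>x. exp (l * g x)) < 1"
proof -
  have E: "measure_pmf.expectation p f = (\<Sum>x\<in>set_pmf p. f x * pmf p x)" for f :: "'a \<Rightarrow> real"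
    using assms(1) by (intro integral_measure_pmf_real) auto
  define \<phi> where "\<phi> l = (\<Sum>x\<in>set_pmf p. exp (l * g x) * pmf p x)" for l
  have "DERIV \<phi> 0 :> (\<Sum>x\<in>set_pmf p. g x * pmf p x)"
    unfolding \<phi>_def by (auto intro!: derivative_eq_intros simp: mult.commute)
  moreover have "(\<Sum>x\<in>set_pmf p. g x * pmf p x) < 0"
    using assms(2) E[of g] by simp
  ultimately obtain d where d: "d > 0" "\<And>h. 0 < h \<Longrightarrow> h < d \<Longrightarrow> \<phi> (0 + h) < \<phi> 0"
    using DERIV_neg_dec_right by blast
  have "\<phi> 0 = 1"
    using E[of "\<lambda>_. 1"] by (simp add: \<phi>_def)
  then have "\<phi> (d / 2) < 1"
    using d(2)[of "d / 2"] d(1) by simp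
  then show ?thesis
    using that[of "d / 2"] d(1) E[of "\<lambda>x. exp (d / 2 * g x)"] by (simp add: \<phi>_def)
qed

lemma powr_moment_less_1:
  fixes f :: "'a \<Rightarrow> real"
  assumes fin: "finite (set_pmf p)" and pos: "\<And>x. x \<in> set_pmf p \<Longrightarrow> f x > 0"
    and neg: "measure_pmf.expectation p (\<lambda>x. log 2 (f x)) < 0"
  obtains l where "l > 0" "(\<integral>\<^sub>px. ennreal (f x powr l) \<partial>p) < 1"
proof -
  have "measure_pmf.expectation p (\<lambda>x. ln (f x)) = measure_pmf.expectation p (\<lambda>x. ln 2 * log 2 (f x))"
    by (simp add: log_def)
  also have "\<dots> = ln 2 * measure_pmf.expectation p (\<lambda>x. log 2 (f x))"
    by simp
  also have "\<dots> < 0"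
    using neg by (simp add: mult_pos_neg)
  finally obtain l where l: "l > 0" "measure_pmf.expectation p (\<lambda>x. exp (l * ln (f x))) < 1"
    using exp_moment_less_1[OF fin] by blast
  have "measure_pmf.expectation p (\<lambda>x. f x powr l) = measure_pmf.expectation p (\<lambda>x. exp (l * ln (f x)))"
    by (intro integral_cong_AE) (auto simp: AE_measure_pmf_iff powr_def dest!: pos)
  moreover have "(\<integral>\<^sub>px. ennreal (f x powr l) \<partial>p) = ennreal (measure_pmf.expectation p (\<lambda>x. f x powr l))"
    using fin by (intro nn_integral_eq_integral integrable_measure_pmf_finite) auto
  ultimately show ?thesis
    using that[of l] l by (simp add: ennreal_less_one_iff)
qed

section \<open>Splitting p(w,x|u,q) into a likelihood ratio and a kernel\<close>

definition w_marginal :: "'u pmf \<Rightarrow> ('u \<Rightarrow> 'q \<Rightarrow> ('w \<times> 'x) pmf) \<Rightarrow> 'q \<Rightarrow> 'w pmf" where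
  "w_marginal P e q = bind_pmf P (\<lambda>u. map_pmf fst (e u q))"

definition wx_marginal :: "'u pmf \<Rightarrow> ('u \<Rightarrow> 'q \<Rightarrow> ('w \<times> 'x) pmf) \<Rightarrow> 'q \<Rightarrow> ('w \<times> 'x) pmf" where
  "wx_marginal P e q = bind_pmf P (\<lambda>u. e u q)"

text \<open>Letters \<open>w\<close> of marginal probability 0 get the ratio 0, and \<open>x_kernel\<close> is arbitrary at letters \<open>w\<close>
  that \<open>u\<close> cannot produce. Neither affects averages over \<open>w_marginal\<close> weighted by \<open>w_ratio\<close>.\<close>

definition w_ratio :: "'u pmf \<Rightarrow> ('u \<Rightarrow> 'q \<Rightarrow> ('w \<times> 'x) pmf) \<Rightarrow> 'q \<Rightarrow> 'u \<Rightarrow> 'w \<Rightarrow> real" where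
  "w_ratio P e q u w = pmf (map_pmf fst (e u q)) w / pmf (w_marginal P e q) w"

definition x_kernel :: "('u \<Rightarrow> 'q \<Rightarrow> ('w \<times> 'x) pmf) \<Rightarrow> 'q \<Rightarrow> 'u \<Rightarrow> 'w \<Rightarrow> 'x pmf" where
  "x_kernel e q u w = map_pmf snd (cond_pmf (e u q) {z. fst z = w})"

lemma w_ratio_nonneg: "0 \<le> w_ratio P e q u w"
  by (simp add: w_ratio_def)

lemma map_fst_wx_marginal: "map_pmf fst (wx_marginal P e q) = w_marginal P e q"
  by (simp add: wx_marginal_def w_marginal_def map_bind_pmf)

text \<open>Chain rule p(w|u) p(x|u,w) = p(w,x|u). Where the kernel is arbitrary, both sides are
  0.\<close>

lemma pmf_x_kernel: "pmf (map_pmf fst (e u q)) w * pmf (x_kernel e q u w) x = pmf (e u q) (w, x)"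
proof (cases "w \<in> fst ` set_pmf (e u q)")
  case True
  then have ne: "set_pmf (e u q) \<inter> {z. fst z = w} \<noteq> {}"
    by auto
  have "pmf (x_kernel e q u w) x = measure_pmf.prob (cond_pmf (e u q) {z. fst z = w}) {(w, x)}"
    unfolding x_kernel_def pmf_map
    by (rule measure_pmf.finite_measure_eq_AE) (auto simp: AE_measure_pmf_iff set_cond_pmf[OF ne])
  also have "\<dots> = pmf (cond_pmf (e u q) {z. fst z = w}) (w, x)"
    by (rule measure_pmf_single)
  also have "\<dots> = pmf (e u q) (w, x) / measure_pmf.prob (e u q) {z. fst z = w}"
    by (simp add: pmf_cond[OF ne])
  also have "{z. fst z = w} = fst -` {w}"
    by auto
  finally have "pmf (x_kernel e q u w) x = pmf (e u q) (w, x) / pmf (map_pmf fst (e u q)) w"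
    by (simp add: pmf_map)
  moreover have "pmf (map_pmf fst (e u q)) w \<noteq> 0"
    using True by (auto simp: pmf_eq_0_set_pmf)
  ultimately show ?thesis
    by simp
next
  case False
  then have "pmf (map_pmf fst (e u q)) w = 0" "pmf (e u q) (w, x) = 0"
    by (force simp: pmf_eq_0_set_pmf image_iff)+
  then show ?thesis
    by simp
qed

lemma bind_x_kernel: "bind_pmf (map_pmf fst (e u q)) (\<lambda>w. map_pmf (Pair w) (x_kernel e q u w)) = e u q"
proof (rule pmf_eqI, safe)
  fix w x
  show "pmf (bind_pmf (map_pmf fst (e u q)) (\<lambda>w. map_pmf (Pair w) (x_kernel e q u w))) (w, x) = pmf (e u q) (w, x)"
    by (subst pmf_bind_inj_point[where a = w])
       (auto simp: pmf_eq_0_set_pmf pmf_map_inj' inj_def pmf_x_kernel)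
qed

lemma w_marginal_ratio_le: "pmf (w_marginal P e q) w * w_ratio P e q u w \<le> pmf (map_pmf fst (e u q)) w"
  by (simp add: w_ratio_def)

lemma w_marginal_ratio:
  assumes "u \<in> set_pmf P"
  shows "pmf (w_marginal P e q) w * w_ratio P e q u w = pmf (map_pmf fst (e u q)) w"
proof (cases "pmf (w_marginal P e q) w = 0")
  case True
  then have "w \<notin> set_pmf (map_pmf fst (e u q))"
    using assms by (auto simp: pmf_eq_0_set_pmf w_marginal_def)
  then have "pmf (map_pmf fst (e u q)) w = 0"
    by (simp add: pmf_eq_0_set_pmf)
  then show ?thesis
    by (simp add: True)
qed (simp add: w_ratio_def)

text \<open>Change of measure: the ratio turns p(w) into p(w|u), and the kernel then restores
  p(w,x|u). For \<open>u\<close> of probability 0, mass can be lost at letters with p(w) = 0, hence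
  the inequality.\<close>

lemma nn_integral_w_ratio_le:
  "(\<integral>\<^sub>pw. ennreal (w_ratio P e q u w) * (\<integral>\<^sub>px. f w x \<partial>(x_kernel e q u w)) \<partial>(w_marginal P e q))
   \<le> (\<integral>\<^sub>pz. f (fst z) (snd z) \<partial>(e u q))"
proof -
  let ?I = "\<lambda>w. \<integral>\<^sub>px. f w x \<partial>(x_kernel e q u w)"
  have "(\<integral>\<^sub>pw. ennreal (w_ratio P e q u w) * ?I w \<partial>(w_marginal P e q))
      = (\<integral>\<^sup>+w. ennreal (pmf (w_marginal P e q) w * w_ratio P e q u w) * ?I w \<partial>count_space UNIV)"
    by (simp add: nn_integral_measure_pmf ennreal_mult' mult.assoc)
  also have "\<dots> \<le> (\<integral>\<^sup>+w. ennreal (pmf (map_pmf fst (e u q)) w) * ?I w \<partial>count_space UNIV)"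
    by (intro nn_integral_mono mult_right_mono ennreal_leI w_marginal_ratio_le) auto
  also have "\<dots> = (\<integral>\<^sub>pw. ?I w \<partial>(map_pmf fst (e u q)))"
    by (subst (2) nn_integral_measure_pmf) (rule refl)
  also have "\<dots> = (\<integral>\<^sup>+z. f (fst z) (snd z) \<partial>measure_pmf
      (bind_pmf (map_pmf fst (e u q)) (\<lambda>w. map_pmf (Pair w) (x_kernel e q u w))))"
    by simp
  finally show ?thesis
    unfolding bind_x_kernel .
qed

lemma nn_integral_w_ratio_le_1: "(\<integral>\<^sub>pw. ennreal (w_ratio P e q u w) \<partial>(w_marginal P e q)) \<le> 1"
  using nn_integral_w_ratio_le[of P e q u "\<lambda>_ _. 1"] by simp

lemma nn_integral_w_ratio_eq_1:
  assumes "u \<in> set_pmf P"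
  shows "(\<integral>\<^sub>pw. ennreal (w_ratio P e q u w) \<partial>(w_marginal P e q)) = 1"
proof -
  have "(\<integral>\<^sub>pw. ennreal (w_ratio P e q u w) \<partial>(w_marginal P e q))
      = (\<integral>\<^sup>+w. ennreal (pmf (w_marginal P e q) w * w_ratio P e q u w) \<partial>count_space UNIV)"
    by (simp add: nn_integral_measure_pmf ennreal_mult')
  also have "\<dots> = 1"
    unfolding w_marginal_ratio[OF assms] by (simp add: nn_integral_pmf)
  finally show ?thesis .
qed

text \<open>Averaging p(x|u,w) with the posterior weights p(u) p(w|u) / p(w) gives p(x|w). Source
  letters outside the support are removed by the factor \<open>pmf P u\<close>.\<close>

lemma w_marginal_kernel:
  fixes P :: "'u::finite pmf"
  shows "pmf (w_marginal P e q) w * (\<Sum>u\<in>UNIV. pmf P u * w_ratio P e q u w * pmf (x_kernel e q u w) x)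
     = pmf (wx_marginal P e q) (w, x)"
proof -
  have "pmf P u * (pmf (w_marginal P e q) w * w_ratio P e q u w) = pmf P u * pmf (map_pmf fst (e u q)) w" for u
    by (cases "u \<in> set_pmf P") (auto simp: w_marginal_ratio set_pmf_iff)
  then have "pmf (w_marginal P e q) w * (pmf P u * w_ratio P e q u w * pmf (x_kernel e q u w) x)
      = pmf P u * pmf (e u q) (w, x)" for u
    using pmf_x_kernel[of e u q w x] by (metis (no_types, opaque_lifting) mult.assoc mult.left_commute)
  then show ?thesis
    unfolding sum_distrib_left wx_marginal_def pmf_bind expectation_finite_type by (intro sum.cong refl)
qed

section \<open>Block codebooks\<close>

definition block_marginal :: "'u pmf \<Rightarrow> ('u \<Rightarrow> 'q \<Rightarrow> ('w \<times> 'x) pmf) \<Rightarrow> nat \<Rightarrow> (nat \<Rightarrow> 'q) \<Rightarrow> (nat \<Rightarrow> 'w) pmf" where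
  "block_marginal P e n q = Pi_pmf {..<n} undefined (\<lambda>i. w_marginal P e (q i))"

definition block_ratio ::
  "'u pmf \<Rightarrow> ('u \<Rightarrow> 'q \<Rightarrow> ('w \<times> 'x) pmf) \<Rightarrow> nat \<Rightarrow> (nat \<Rightarrow> 'q) \<Rightarrow> (nat \<Rightarrow> 'u) \<Rightarrow> (nat \<Rightarrow> 'w) \<Rightarrow> real" where
  "block_ratio P e n q u w = (\<Prod>i<n. w_ratio P e (q i) (u i) (w i))"

definition block_kernel ::
  "('u \<Rightarrow> 'q \<Rightarrow> ('w \<times> 'x) pmf) \<Rightarrow> nat \<Rightarrow> (nat \<Rightarrow> 'q) \<Rightarrow> (nat \<Rightarrow> 'u) \<Rightarrow> (nat \<Rightarrow> 'w) \<Rightarrow> (nat \<Rightarrow> 'x) pmf" where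
  "block_kernel e n q u w = Pi_pmf {..<n} undefined (\<lambda>i. x_kernel e (q i) (u i) (w i))"

text \<open>Rounding up keeps the list nonempty and, for nonnegative \<open>R\<close>, at most
  doubles 2^(nR).\<close>

definition message_count :: "real \<Rightarrow> nat \<Rightarrow> nat" where
  "message_count R n = nat \<lceil>2 powr (real n * R)\<rceil>"

definition user_codebook ::
  "'u pmf \<Rightarrow> ('u \<Rightarrow> 'q \<Rightarrow> ('w \<times> 'x) pmf) \<Rightarrow> real \<Rightarrow> real \<Rightarrow> nat \<Rightarrow> (nat \<Rightarrow> 'q)
   \<Rightarrow> ((nat \<Rightarrow> nat \<Rightarrow> 'w) \<times> ((nat \<Rightarrow> 'u) \<Rightarrow> nat \<times> (nat \<Rightarrow> 'x))) pmf" where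
  "user_codebook P e R c n q =
     codebook (blocks n) (block_marginal P e n q) (block_ratio P e n q) (block_kernel e n q)
       (message_count R n) (2 powr (real n * c))"

lemma finite_blocks: "finite (blocks n :: (nat \<Rightarrow> 'a::finite) set)"
  by (simp add: blocks_def finite_PiE)

lemma restrict_in_blocks: "(\<lambda>i\<in>{..<n}. f i) \<in> blocks n"
  by (simp add: blocks_def)

lemma message_count_pos: "0 < message_count R n"
  by (simp add: message_count_def)

lemma message_count_ge: "2 powr (real n * R) \<le> real (message_count R n)"
  by (simp add: message_count_def real_nat_ceiling_ge)

lemma message_count_le:
  assumes "0 \<le> R"
  shows "real (message_count R n) \<le> 2 * 2 powr (real n * R)"
proof -
  have "1 \<le> 2 powr (real n * R)"
    using assms by (simp add: ge_one_powr_ge_zero)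
  moreover have "real (message_count R n) \<le> 2 powr (real n * R) + 1"
    unfolding message_count_def by (simp add: of_nat_nat)
  ultimately show ?thesis
    by linarith
qed

lemma block_ratio_nonneg: "0 \<le> block_ratio P e n q u w"
  by (simp add: block_ratio_def prod_nonneg w_ratio_nonneg)

lemma ennreal_block_ratio: "ennreal (block_ratio P e n q u w) = (\<Prod>i<n. ennreal (w_ratio P e (q i) (u i) (w i)))"
  by (simp add: block_ratio_def prod_ennreal w_ratio_nonneg)

lemma nn_integral_block_ratio:
  "(\<integral>\<^sub>pw. ennreal (block_ratio P e n q u w) \<partial>(block_marginal P e n q))
    = (\<Prod>i<n. \<integral>\<^sub>pw. ennreal (w_ratio P e (q i) (u i) w) \<partial>(w_marginal P e (q i)))"
  unfolding ennreal_block_ratio block_marginal_def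
  by (rule nn_integral_prod_Pi_pmf[where f = "\<lambda>i w. ennreal (w_ratio P e (q i) (u i) w)"]) simp

lemma nn_integral_block_ratio_le_1:
  "(\<integral>\<^sub>pw. ennreal (block_ratio P e n q u w) \<partial>(block_marginal P e n q)) \<le> 1"
  unfolding nn_integral_block_ratio by (intro prod_le_1) (simp add: nn_integral_w_ratio_le_1)

lemma nn_integral_block_ratio_eq_1:
  assumes "\<And>i. i < n \<Longrightarrow> u i \<in> set_pmf P"
  shows "(\<integral>\<^sub>pw. ennreal (block_ratio P e n q u w) \<partial>(block_marginal P e n q)) = 1"
  unfolding nn_integral_block_ratio using assms by (intro prod.neutral) (simp add: nn_integral_w_ratio_eq_1)

lemma two_powr_power: "(2 powr y :: real) ^ n = 2 powr (real n * y)"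
  by (simp add: powr_def exp_of_nat_mult[symmetric] mult.assoc)

lemma ennreal_power_tendsto_0:
  fixes x :: ennreal
  assumes "x < 1"
  shows "(\<lambda>n. x ^ n) \<longlonglongrightarrow> 0"
proof -
  obtain r where r: "x = ennreal r" "0 \<le> r"
    using assms by (cases x) auto
  then have "r < 1"
    using assms by (simp add: ennreal_less_one_iff)
  then have "(\<lambda>n. ennreal (r ^ n)) \<longlonglongrightarrow> ennreal 0"
    using r by (intro tendsto_ennrealI LIMSEQ_power_zero) auto
  then show ?thesis
    using r by (simp add: ennreal_power)
qed

text \<open>Chernoff's device: the indicator of the exceedance is bounded by a product of
  single-letter powers, whose average factorizes.\<close>

lemma prod_gt_powr_imp:
  fixes f :: "nat \<Rightarrow> real"
  assumes "\<And>i. 0 \<le> f i" "l > 0" "2 powr (real n * c) < (\<Prod>i<n. f i)"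
  shows "1 \<le> (\<Prod>i<n. (f i / 2 powr c) powr l)"
proof -
  have "2 powr (real n * c) = (2 powr c) ^ n"
    by (rule two_powr_power[symmetric])
  then have "1 \<le> (\<Prod>i<n. f i / 2 powr c)"
    using assms(3) by (simp add: prod_dividef)
  then have "1 \<le> (\<Prod>i<n. f i / 2 powr c) powr l"
    using assms(2) by (simp add: ge_one_powr_ge_zero)
  then show ?thesis
    using assms(1) by (simp add: prod_powr_distrib)
qed

text \<open>Both terms of \<open>codebook_fail\<close> decay exponentially: the tail because the
  mean log-ratio is below \<open>c\<close>, the deviation because \<open>c < R\<close> makes
  truncation level over list size vanish.\<close>

lemma user_codebook_failure_tendsto_0:
  fixes pq :: "'q::finite pmf" and S :: "'s::finite pmf" and a :: "'s \<Rightarrow> 'u::finite"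
    and e :: "'u \<Rightarrow> 'q \<Rightarrow> ('w::finite \<times> 'x::finite) pmf"
  defines "P \<equiv> map_pmf a S"
  defines "L \<equiv> do { q \<leftarrow> pq; s \<leftarrow> S; z \<leftarrow> e (a s) q; return_pmf (q, s, z) }"
  assumes c: "measure_pmf.expectation L (\<lambda>(q, s, z). log 2 (w_ratio P e q (a s) (fst z))) < c" and R: "c < R"
  shows "(\<lambda>n. \<integral>\<^sub>pq. \<integral>\<^sub>ps. \<integral>\<^sub>pC. (if fst (snd C (\<lambda>i\<in>{..<n}. a (s i))) < message_count R n then 0 else 1)
            \<partial>(user_codebook P e R c n q) \<partial>(Pi_pmf {..<n} undefined (\<lambda>_. S))
            \<partial>(Pi_pmf {..<n} undefined (\<lambda>_. pq))) \<longlonglongrightarrow> 0"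
proof -
  define f :: "'q \<times> 's \<times> 'w \<times> 'x \<Rightarrow> real" where "f = (\<lambda>(q, s, z). w_ratio P e q (a s) (fst z) / 2 powr c)"
  have pos: "0 < w_ratio P e q (a s) (fst z)" if "(q, s, z) \<in> set_pmf L" for q s z
  proof -
    have z: "s \<in> set_pmf S" "z \<in> set_pmf (e (a s) q)"
      using that by (auto simp: L_def)
    then have "fst z \<in> set_pmf (w_marginal P e q)" "fst z \<in> set_pmf (map_pmf fst (e (a s) q))"
      by (auto simp: w_marginal_def P_def)
    then show ?thesis
      by (auto simp: w_ratio_def intro!: divide_pos_pos pmf_positive simp del: set_map_pmf)
  qed
  have "measure_pmf.expectation L (\<lambda>x. log 2 (f x))
      = measure_pmf.expectation L (\<lambda>x. (case x of (q, s, z) \<Rightarrow> log 2 (w_ratio P e q (a s) (fst z))) - c)"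
    by (intro integral_cong_AE)
       (auto simp: AE_measure_pmf_iff f_def log_divide dest!: pos)
  also have "\<dots> < 0"
    using c by simp
  finally have neg: "measure_pmf.expectation L (\<lambda>x. log 2 (f x)) < 0" .
  have f_pos: "f x > 0" if "x \<in> set_pmf L" for x
    using pos[of "fst x" "fst (snd x)" "snd (snd x)"] that by (simp add: f_def case_prod_unfold)
  obtain l where l: "l > 0" and mom: "(\<integral>\<^sub>px. ennreal (f x powr l) \<partial>L) < 1"
    by (rule powr_moment_less_1[OF _ f_pos neg]) simp_all
  \<comment> \<open>\<open>G1\<close>, \<open>G2\<close> and \<open>\<epsilon>\<close> average this
    one-letter weight in the order in which the block average is taken, so the block tail becomes
    \<open>\<epsilon> ^ n\<close>.\<close>
  define g where "g q s w = ennreal (w_ratio P e q (a s) w) * ennreal ((w_ratio P e q (a s) w / 2 powr c) powr l)" for q s w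
  define G1 where "G1 q s = (\<integral>\<^sub>pw. g q s w \<partial>(w_marginal P e q))" for q s
  define G2 where "G2 q = (\<integral>\<^sub>ps. G1 q s \<partial>S)" for q
  define \<epsilon> where "\<epsilon> = (\<integral>\<^sub>pq. G2 q \<partial>pq)"
  have "\<epsilon> \<le> (\<integral>\<^sub>px. ennreal (f x powr l) \<partial>L)"
    unfolding \<epsilon>_def G2_def G1_def g_def L_def f_def
    using nn_integral_w_ratio_le[of P e _ _ "\<lambda>w x. ennreal ((w_ratio P e q (a s) w / 2 powr c) powr l)" for q s]
    by (auto intro!: nn_integral_mono)
  with mom have \<epsilon>: "\<epsilon> < 1"
    by simp
  \<comment> \<open>Chosen so that \<open>\<delta> ^ n\<close> is the square root of 2^(nc) /
    2^(nR).\<close>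
  define \<delta> :: real where "\<delta> = 2 powr ((c - R) / 2)"
  have \<delta>: "0 \<le> \<delta>" "\<delta> < 1"
    using R by (auto simp: \<delta>_def powr_less_one)
  let ?E = "\<lambda>n. \<integral>\<^sub>pq. \<integral>\<^sub>ps. \<integral>\<^sub>pC. (if fst (snd C (\<lambda>i\<in>{..<n}. a (s i))) < message_count R n then 0 else 1)
            \<partial>(user_codebook P e R c n q) \<partial>(Pi_pmf {..<n} undefined (\<lambda>_. S))
            \<partial>(Pi_pmf {..<n} undefined (\<lambda>_. pq))"
  have bound: "?E n \<le> \<epsilon> ^ n + ennreal (2 * \<delta> ^ n)" for n
  proof -
    let ?M = "message_count R n" and ?B = "2 powr (real n * c)"
    have sqrt_le: "2 * sqrt (?B / ?M) \<le> 2 * \<delta> ^ n"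
    proof -
      have "?B / ?M \<le> ?B / 2 powr (real n * R)"
        using message_count_ge[of n R] message_count_pos[of R n] by (intro divide_left_mono mult_pos_pos) auto
      also have "\<dots> = (\<delta> ^ n)\<^sup>2"
        unfolding \<delta>_def two_powr_power powr_diff[symmetric]
          by (rule arg_cong[where f = "(powr) 2"]) (simp add: right_diff_distrib)
      finally show ?thesis
        using \<delta> by (simp add: real_le_lsqrt)
    qed
    have letter: "(\<integral>\<^sub>pC. (if fst (snd C (\<lambda>i\<in>{..<n}. a (s i))) < ?M then 0 else 1) \<partial>(user_codebook P e R c n q))
        \<le> (\<Prod>i<n. G1 (q i) (s i)) + ennreal (2 * \<delta> ^ n)"
      if s: "s \<in> set_pmf (Pi_pmf {..<n} undefined (\<lambda>_. S))" for q s
    proof -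
      let ?u = "\<lambda>i\<in>{..<n}. a (s i)"
      have "s i \<in> set_pmf S" if "i < n" for i
        using s that by (auto simp: set_Pi_pmf PiE_dflt_def)
      \<comment> \<open>Normalization is available for letters of positive probability, hence the
        restriction to source blocks in the support.\<close>
      then have one: "(\<integral>\<^sub>pw. ennreal (block_ratio P e n q ?u w) \<partial>(block_marginal P e n q)) = 1"
        by (intro nn_integral_block_ratio_eq_1) (simp add: P_def)
      have "(\<integral>\<^sub>pC. (if fst (snd C ?u) < ?M then 0 else 1) \<partial>(user_codebook P e R c n q))
          \<le> (\<integral>\<^sub>pw. (if block_ratio P e n q ?u w > ?B then ennreal (block_ratio P e n q ?u w) else 0)
              \<partial>(block_marginal P e n q)) + ennreal (2 * sqrt (?B / ?M))"
        unfolding user_codebook_def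
        by (rule codebook_fail[where r = "block_ratio P e n q",
              OF finite_blocks message_count_pos block_ratio_nonneg restrict_in_blocks _ one]) simp
      also have "\<dots> \<le> (\<integral>\<^sub>pw. (\<Prod>i<n. g (q i) (s i) (w i)) \<partial>(block_marginal P e n q)) + ennreal (2 * \<delta> ^ n)"
      proof (intro add_mono nn_integral_mono ennreal_leI sqrt_le)
        fix w
        show "(if block_ratio P e n q ?u w > ?B then ennreal (block_ratio P e n q ?u w) else 0) \<le> (\<Prod>i<n. g (q i) (s i) (w i))"
        proof (cases "block_ratio P e n q ?u w > ?B")
          case True
          then have "1 \<le> (\<Prod>i<n. (w_ratio P e (q i) (a (s i)) (w i) / 2 powr c) powr l)"
            by (intro prod_gt_powr_imp l w_ratio_nonneg) (simp add: block_ratio_def)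
          then have "ennreal 1 \<le> ennreal (\<Prod>i<n. (w_ratio P e (q i) (a (s i)) (w i) / 2 powr c) powr l)"
            by (rule ennreal_leI)
          then have "ennreal (block_ratio P e n q ?u w) * 1
             \<le> ennreal (block_ratio P e n q ?u w) * (\<Prod>i<n. ennreal ((w_ratio P e (q i) (a (s i)) (w i) / 2 powr c) powr l))"
            by (intro mult_left_mono) (simp_all add: prod_ennreal)
          also have "\<dots> = (\<Prod>i<n. g (q i) (s i) (w i))"
            by (simp add: ennreal_block_ratio g_def prod.distrib)
          finally show ?thesis
            using True by simp
        qed simp
      qed
      also have "(\<integral>\<^sub>pw. (\<Prod>i<n. g (q i) (s i) (w i)) \<partial>(block_marginal P e n q)) = (\<Prod>i<n. G1 (q i) (s i))"
        unfolding block_marginal_def G1_def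
        by (rule nn_integral_prod_Pi_pmf[where f = "\<lambda>i w. g (q i) (s i) w"]) simp
      finally show ?thesis .
    qed
    have "?E n \<le> (\<integral>\<^sub>pq. \<integral>\<^sub>ps. (\<Prod>i<n. G1 (q i) (s i)) + ennreal (2 * \<delta> ^ n)
        \<partial>(Pi_pmf {..<n} undefined (\<lambda>_. S)) \<partial>(Pi_pmf {..<n} undefined (\<lambda>_. pq)))"
      using letter by (intro nn_integral_mono nn_integral_mono_AE) (simp add: AE_measure_pmf_iff)
    also have "\<dots> = (\<integral>\<^sub>pq. \<integral>\<^sub>ps. (\<Prod>i<n. G1 (q i) (s i))
        \<partial>(Pi_pmf {..<n} undefined (\<lambda>_. S)) \<partial>(Pi_pmf {..<n} undefined (\<lambda>_. pq))) + ennreal (2 * \<delta> ^ n)"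
      by (simp add: nn_integral_pmf_add)
    also have "(\<integral>\<^sub>pq. \<integral>\<^sub>ps. (\<Prod>i<n. G1 (q i) (s i))
        \<partial>(Pi_pmf {..<n} undefined (\<lambda>_. S)) \<partial>(Pi_pmf {..<n} undefined (\<lambda>_. pq))) = \<epsilon> ^ n"
      using nn_integral_prod_Pi_pmf[of "{..<n}" undefined "\<lambda>_. S" "\<lambda>i s. G1 (q i) s" for q]
        nn_integral_prod_Pi_pmf[of "{..<n}" undefined "\<lambda>_. pq" "\<lambda>i q. G2 q"]
      by (simp add: G2_def[symmetric] \<epsilon>_def[symmetric])
    finally show ?thesis .
  qed
  have "(\<lambda>n. \<epsilon> ^ n + ennreal (2 * \<delta> ^ n)) \<longlonglongrightarrow> 0 + ennreal (2 * 0)"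
    using \<epsilon> \<delta> by (intro tendsto_add tendsto_ennrealI tendsto_mult tendsto_const LIMSEQ_power_zero ennreal_power_tendsto_0)
       auto
  then have lim: "(\<lambda>n. \<epsilon> ^ n + ennreal (2 * \<delta> ^ n)) \<longlonglongrightarrow> 0"
    by simp
  show ?thesis
    by (rule tendsto_sandwich[OF always_eventually always_eventually tendsto_const lim]) (use bound in auto)
qed

section \<open>Letter densities of a receiver\<close>

text \<open>Comparing laws through averages turns a reordering of independent draws into an exchange
  of integrals.\<close>

lemma pmf_eqI_nn_integral:
  assumes "\<And>f. (\<integral>\<^sub>px. f x \<partial>p) = (\<integral>\<^sub>px. f x \<partial>q)"
  shows "p = q"
proof (rule pmf_eqI)
  fix x
  have "emeasure (measure_pmf p) {x} = emeasure (measure_pmf q) {x}"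
    using assms[of "indicator {x}"] by simp
  then show "pmf p x = pmf q x"
    by (simp add: emeasure_pmf_single)
qed

definition exceeds ::
  "nat \<Rightarrow> real \<Rightarrow> ('q \<Rightarrow> 'u \<Rightarrow> 'w1 \<Rightarrow> 'x \<Rightarrow> 'w2 \<Rightarrow> 'o \<Rightarrow> real) \<Rightarrow> (nat \<Rightarrow> 'q) \<Rightarrow> (nat \<Rightarrow> 'u) \<Rightarrow> (nat \<Rightarrow> 'w1)
    \<Rightarrow> (nat \<Rightarrow> 'x) \<Rightarrow> (nat \<Rightarrow> 'w2) \<Rightarrow> (nat \<Rightarrow> 'o) \<Rightarrow> bool" where
  "exceeds n t d q u w x w2 ob \<longleftrightarrow> 2 powr (real n * t) \<le> (\<Prod>i<n. d (q i) (u i) (w i) (x i) (w2 i) (ob i))"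

text \<open>Markov's inequality in pointwise form, with a bound that factorizes over
  letters.\<close>

lemma of_bool_exceeds_le:
  assumes "\<And>q u w x w2 ob. 0 \<le> d q u w x w2 ob"
  shows "of_bool (exceeds n t d q u w x w2 ob)
    \<le> ennreal (2 powr (- real n * t)) * (\<Prod>i<n. ennreal (d (q i) (u i) (w i) (x i) (w2 i) (ob i)))"
proof (cases "exceeds n t d q u w x w2 ob")
  case True
  let ?d = "\<Prod>i<n. d (q i) (u i) (w i) (x i) (w2 i) (ob i)"
  have "1 = 2 powr (- real n * t) * 2 powr (real n * t)"
    by (simp add: powr_add[symmetric])
  also have "\<dots> \<le> 2 powr (- real n * t) * ?d"
    using True by (intro mult_left_mono) (auto simp: exceeds_def)
  finally have "ennreal 1 \<le> ennreal (2 powr (- real n * t) * ?d)"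
    by (rule ennreal_leI)
  then show ?thesis
    using True assms by (simp add: ennreal_mult' prod_ennreal)
qed simp

text \<open>User 1 is the one whose source is decoded, and \<open>ob\<close> collects the channel output and the side
  information; the other receiver is the instance with the two users exchanged.\<close>

locale receiver =
  fixes pq :: "'q::finite pmf" and S :: "'s::finite pmf"
    and a1 :: "'s \<Rightarrow> 'u1::finite" and a2 :: "'s \<Rightarrow> 'u2::finite" and P1 :: "'u1 pmf" and P2 :: "'u2 pmf"
    and e1 :: "'u1 \<Rightarrow> 'q \<Rightarrow> ('w1::finite \<times> 'x1::finite) pmf" and e2 :: "'u2 \<Rightarrow> 'q \<Rightarrow> ('w2::finite \<times> 'x2::finite) pmf"
    and ch :: "'x1 \<Rightarrow> 'x2 \<Rightarrow> 'y::finite pmf" and ob :: "'s \<Rightarrow> 'y \<Rightarrow> 'o"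
  assumes independent: "map_pmf (\<lambda>s. (a1 s, a2 s)) S = pair_pmf P1 P2"
begin

definition joint :: "('q \<times> 's \<times> ('w1 \<times> 'x1) \<times> ('w2 \<times> 'x2) \<times> 'y) pmf" where
  "joint = do { q \<leftarrow> pq; s \<leftarrow> S; z1 \<leftarrow> e1 (a1 s) q; z2 \<leftarrow> e2 (a2 s) q; y \<leftarrow> ch (snd z1) (snd z2);
     return_pmf (q, s, z1, z2, y) }"

definition "cQ = (\<lambda>(q, s, z1, z2, y). q)"
definition "cU = (\<lambda>(q, s, z1, z2, y). a1 s)"
definition "cW1 = (\<lambda>(q, s, z1, z2, y). fst z1)"
definition "cX1 = (\<lambda>(q, s, z1, z2, y). snd z1)"
definition "cW2 = (\<lambda>(q, s, z1, z2, y). fst z2)"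
definition "cO = (\<lambda>(q, s, z1, z2, y). ob s y)"

text \<open>The factor \<open>pmf P1 u\<close> turns counting of source words into averaging: the expected logarithm of
  each density is a conditional mutual information minus the source entropy.\<close>

definition "densA q u w x w2 o' =
  pmf P1 u * info_density joint cX1 cO (\<lambda>\<omega>. (cW1 \<omega>, cW2 \<omega>, cQ \<omega>)) x o' (w, w2, q)"
definition "densB q u w x w2 o' =
  pmf P1 u * info_density joint cX1 cO (\<lambda>\<omega>. (cW2 \<omega>, cQ \<omega>)) x o' (w2, q)"
definition "densC q u w x w2 o' =
  pmf P1 u * info_density joint (\<lambda>\<omega>. (cW2 \<omega>, cX1 \<omega>)) cO (\<lambda>\<omega>. (cW1 \<omega>, cQ \<omega>)) (w2, x) o' (w, q)"
definition "densD q u w x w2 o' =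
  pmf P1 u * info_density joint (\<lambda>\<omega>. (cW2 \<omega>, cX1 \<omega>)) cO cQ (w2, x) o' q"

abbreviation "WX1 \<equiv> wx_marginal P1 e1"
abbreviation "PW1 \<equiv> w_marginal P1 e1"
abbreviation "PW2 \<equiv> w_marginal P2 e2"

lemma map_S: "map_pmf a1 S = P1" "map_pmf a2 S = P2"
proof -
  show "map_pmf a1 S = P1"
    using arg_cong[OF independent, of "map_pmf fst"] by (simp add: map_pmf_comp map_fst_pair_pmf)
  show "map_pmf a2 S = P2"
    using arg_cong[OF independent, of "map_pmf snd"] by (simp add: map_pmf_comp map_snd_pair_pmf)
qed

text \<open>Once sources and outputs are forgotten, the users are independent given Q, because their
  sources are independent. This determines p(x,z) and p(z) in all four densities.\<close>

lemma map_joint_base: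
  "map_pmf (\<lambda>(q, s, z1, z2, y). (q, z1, fst z2)) joint = do { q \<leftarrow> pq; z \<leftarrow> pair_pmf (WX1 q) (PW2 q); return_pmf (q, z) }"
proof (rule pmf_eqI_nn_integral)
  fix f :: "'q \<times> ('w1 \<times> 'x1) \<times> 'w2 \<Rightarrow> ennreal"
  have S: "(\<integral>\<^sub>ps. g (a1 s) (a2 s) \<partial>S) = (\<integral>\<^sub>pu1. \<integral>\<^sub>pu2. g u1 u2 \<partial>P2 \<partial>P1)" for g
  proof -
    have "(\<integral>\<^sub>ps. g (a1 s) (a2 s) \<partial>S) = (\<integral>\<^sub>pz. g (fst z) (snd z) \<partial>(map_pmf (\<lambda>s. (a1 s, a2 s)) S))"
      by simp
    then show ?thesis
      unfolding independent by (simp add: nn_integral_pair_pmf')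
  qed
  have "(\<integral>\<^sub>px. f x \<partial>(map_pmf (\<lambda>(q, s, z1, z2, y). (q, z1, fst z2)) joint))
    = (\<integral>\<^sub>pq. \<integral>\<^sub>ps. \<integral>\<^sub>pz1. \<integral>\<^sub>pz2. f (q, z1, fst z2) \<partial>(e2 (a2 s) q) \<partial>(e1 (a1 s) q) \<partial>S \<partial>pq)"
    by (simp add: joint_def)
  also have "\<dots> = (\<integral>\<^sub>pq. \<integral>\<^sub>pu1. \<integral>\<^sub>pu2. \<integral>\<^sub>pz1. \<integral>\<^sub>pz2. f (q, z1, fst z2) \<partial>(e2 u2 q) \<partial>(e1 u1 q) \<partial>P2 \<partial>P1 \<partial>pq)"
    by (subst S) (rule refl)
  also have "\<dots> = (\<integral>\<^sub>pq. \<integral>\<^sub>pu1. \<integral>\<^sub>pz1. \<integral>\<^sub>pu2. \<integral>\<^sub>pz2. f (q, z1, fst z2) \<partial>(e2 u2 q) \<partial>P2 \<partial>(e1 u1 q) \<partial>P1 \<partial>pq)"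
    by (subst nn_integral_pmf_swap[where q = P2]) (rule refl)
  also have "\<dots> = (\<integral>\<^sub>px. f x \<partial>(do { q \<leftarrow> pq; z \<leftarrow> pair_pmf (WX1 q) (PW2 q); return_pmf (q, z) }))"
    by (simp add: nn_integral_pair_pmf' wx_marginal_def w_marginal_def)
  finally show "(\<integral>\<^sub>px. f x \<partial>(map_pmf (\<lambda>(q, s, z1, z2, y). (q, z1, fst z2)) joint))
    = (\<integral>\<^sub>px. f x \<partial>(do { q \<leftarrow> pq; z \<leftarrow> pair_pmf (WX1 q) (PW2 q); return_pmf (q, z) }))" .
qed

text \<open>\<open>g\<close> selects variables and \<open>h\<close> arranges them together with
  \<open>q\<close>. Injectivity of \<open>h\<close> lets both be read off a value, so one lemma
  serves all the marginals below.\<close>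

lemma pmf_joint_marginal:
  assumes inj: "\<And>q v q' v'. h q v = h q' v' \<Longrightarrow> q = q' \<and> v = v'"
  shows "pmf (map_pmf (\<lambda>(q, s, z1, z2, y). h q (g z1 (fst z2))) joint) (h q v)
    = pmf pq q * pmf (map_pmf (\<lambda>z. g (fst z) (snd z)) (pair_pmf (WX1 q) (PW2 q))) v"
proof -
  have "map_pmf (\<lambda>(q, s, z1, z2, y). h q (g z1 (fst z2))) joint
      = map_pmf (\<lambda>(q, z). h q (g (fst z) (snd z))) (map_pmf (\<lambda>(q, s, z1, z2, y). (q, z1, fst z2)) joint)"
    by (simp add: map_pmf_comp case_prod_unfold)
  also have "\<dots> = do { q \<leftarrow> pq; map_pmf (h q) (map_pmf (\<lambda>z. g (fst z) (snd z)) (pair_pmf (WX1 q) (PW2 q))) }"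
    unfolding map_joint_base by (simp add: map_bind_pmf map_pmf_comp) (simp add: map_pmf_def)
  also have "pmf \<dots> (h q v) = pmf pq q * pmf (map_pmf (\<lambda>z. g (fst z) (snd z)) (pair_pmf (WX1 q) (PW2 q))) v"
    using inj by (subst pmf_bind_inj_point[where a = q])
      (auto simp: pmf_eq_0_set_pmf pmf_map_inj' inj_def)
  finally show ?thesis .
qed

lemma map_pair_fst: "map_pmf (\<lambda>z. (f (fst z), snd z)) (pair_pmf A B) = pair_pmf (map_pmf f A) B"
  by (simp add: pair_map_pmf1 apfst_def map_prod_def case_prod_unfold)

lemma pmf_XZ:
  "pmf (map_pmf (\<lambda>\<omega>. (cX1 \<omega>, cW1 \<omega>, cW2 \<omega>, cQ \<omega>)) joint) (x, w, w2, q) = pmf pq q * (pmf (WX1 q) (w, x) * pmf (PW2 q) w2)"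
  "pmf (map_pmf (\<lambda>\<omega>. (cX1 \<omega>, cW2 \<omega>, cQ \<omega>)) joint) (x, w2, q) = pmf pq q * (pmf (map_pmf snd (WX1 q)) x * pmf (PW2 q) w2)"
  "pmf (map_pmf (\<lambda>\<omega>. ((cW2 \<omega>, cX1 \<omega>), cW1 \<omega>, cQ \<omega>)) joint) ((w2, x), w, q) = pmf pq q * (pmf (WX1 q) (w, x) * pmf (PW2 q) w2)"
  "pmf (map_pmf (\<lambda>\<omega>. ((cW2 \<omega>, cX1 \<omega>), cQ \<omega>)) joint) ((w2, x), q) = pmf pq q * (pmf (map_pmf snd (WX1 q)) x * pmf (PW2 q) w2)"
  using pmf_joint_marginal[of "\<lambda>q ((w, x), w2). (x, w, w2, q)" "\<lambda>z1 w2. (z1, w2)" q "((w, x), w2)"]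
    pmf_joint_marginal[of "\<lambda>q (x, w2). (x, w2, q)" "\<lambda>z1 w2. (snd z1, w2)" q "(x, w2)"]
    pmf_joint_marginal[of "\<lambda>q ((w, x), w2). ((w2, x), w, q)" "\<lambda>z1 w2. (z1, w2)" q "((w, x), w2)"]
    pmf_joint_marginal[of "\<lambda>q (x, w2). ((w2, x), q)" "\<lambda>z1 w2. (snd z1, w2)" q "(x, w2)"]
  by (auto simp: cX1_def cW1_def cW2_def cQ_def case_prod_unfold map_pair_fst pmf_pair prod_eq_iff)

lemma pmf_Z:
  "pmf (map_pmf (\<lambda>\<omega>. (cW1 \<omega>, cW2 \<omega>, cQ \<omega>)) joint) (w, w2, q) = pmf pq q * (pmf (PW1 q) w * pmf (PW2 q) w2)"
  "pmf (map_pmf (\<lambda>\<omega>. (cW2 \<omega>, cQ \<omega>)) joint) (w2, q) = pmf pq q * pmf (PW2 q) w2"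
  "pmf (map_pmf (\<lambda>\<omega>. (cW1 \<omega>, cQ \<omega>)) joint) (w, q) = pmf pq q * pmf (PW1 q) w"
  "pmf (map_pmf cQ joint) q = pmf pq q"
proof -
  have 3: "map_pmf (\<lambda>z. fst (fst z)) (pair_pmf A B) = map_pmf fst A" for A :: "('w1 \<times> 'x1) pmf" and B :: "'w2 pmf"
    using arg_cong[OF map_fst_pair_pmf[of A B], of "map_pmf fst"] by (simp only: map_pmf_comp)
  have 4: "map_pmf snd (pair_pmf A B) = B" for A :: "('w1 \<times> 'x1) pmf" and B :: "'w2 pmf"
    by (rule map_snd_pair_pmf)
  show "pmf (map_pmf (\<lambda>\<omega>. (cW1 \<omega>, cW2 \<omega>, cQ \<omega>)) joint) (w, w2, q) = pmf pq q * (pmf (PW1 q) w * pmf (PW2 q) w2)"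
    using pmf_joint_marginal[of "\<lambda>q (w, w2). (w, w2, q)" "\<lambda>z1 w2. (fst z1, w2)" q "(w, w2)"]
    by (auto simp: cW1_def cW2_def cQ_def case_prod_unfold map_pair_fst pmf_pair prod_eq_iff map_fst_wx_marginal)
  show "pmf (map_pmf (\<lambda>\<omega>. (cW2 \<omega>, cQ \<omega>)) joint) (w2, q) = pmf pq q * pmf (PW2 q) w2"
    using pmf_joint_marginal[of "\<lambda>q w2. (w2, q)" "\<lambda>z1 w2. w2" q w2]
    by (auto simp: cW2_def cQ_def case_prod_unfold 4)
  show "pmf (map_pmf (\<lambda>\<omega>. (cW1 \<omega>, cQ \<omega>)) joint) (w, q) = pmf pq q * pmf (PW1 q) w"
    using pmf_joint_marginal[of "\<lambda>q w. (w, q)" "\<lambda>z1 w2. fst z1" q w]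
    by (auto simp: cW1_def cQ_def case_prod_unfold 3 map_fst_wx_marginal)
  show "pmf (map_pmf cQ joint) q = pmf pq q"
    using pmf_joint_marginal[of "\<lambda>q (u :: unit). q" "\<lambda>z1 w2. ()" q "()"]
    by (auto simp: cQ_def case_prod_unfold)
qed

text \<open>This is p(x|w,q) at letters \<open>w\<close> of positive probability, written so that
  sums over source letters produce it directly.\<close>

definition "kern q w x = (\<Sum>u\<in>UNIV. pmf P1 u * w_ratio P1 e1 q u w * pmf (x_kernel e1 q u w) x)"

lemma kern: "0 \<le> kern q w x" "pmf (PW1 q) w * kern q w x = pmf (WX1 q) (w, x)"
  unfolding kern_def by (auto intro!: sum_nonneg mult_nonneg_nonneg w_ratio_nonneg w_marginal_kernel)

text \<open>\<open>pmf P1 u\<close> times the ratio is p(u|w,q), so the sum over source letters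
  averages p(x|u,w,q) to p(x|w,q).\<close>

lemma sum_ratio_kernel:
  assumes "\<And>x. 0 \<le> f x"
  shows "(\<Sum>u\<in>UNIV. ennreal (w_ratio P1 e1 q u w) * (\<integral>\<^sub>px. ennreal (pmf P1 u * f x) \<partial>(x_kernel e1 q u w)))
    = ennreal (\<Sum>x\<in>UNIV. kern q w x * f x)"
proof -
  have "(\<Sum>u\<in>UNIV. ennreal (w_ratio P1 e1 q u w) * (\<integral>\<^sub>px. ennreal (pmf P1 u * f x) \<partial>(x_kernel e1 q u w)))
      = (\<Sum>u\<in>UNIV. ennreal (w_ratio P1 e1 q u w * (\<Sum>x\<in>UNIV. pmf (x_kernel e1 q u w) x * (pmf P1 u * f x))))"
    using assms by (intro sum.cong refl, subst nn_integral_finite_type) (simp_all add: ennreal_mult'[symmetric] w_ratio_nonneg)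
  also have "\<dots> = ennreal (\<Sum>u\<in>UNIV. w_ratio P1 e1 q u w * (\<Sum>x\<in>UNIV. pmf (x_kernel e1 q u w) x * (pmf P1 u * f x)))"
    using assms by (intro sum_ennreal mult_nonneg_nonneg sum_nonneg w_ratio_nonneg) auto
  also have "(\<Sum>u\<in>UNIV. w_ratio P1 e1 q u w * (\<Sum>x\<in>UNIV. pmf (x_kernel e1 q u w) x * (pmf P1 u * f x)))
      = (\<Sum>u\<in>UNIV. \<Sum>x\<in>UNIV. pmf P1 u * w_ratio P1 e1 q u w * pmf (x_kernel e1 q u w) x * f x)"
    by (simp add: sum_distrib_left mult_ac)
  also have "\<dots> = (\<Sum>x\<in>UNIV. kern q w x * f x)"
    unfolding kern_def sum_distrib_right by (rule sum.swap)
  finally show ?thesis .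
qed

lemma sum_ratio_marginal:
  assumes "\<And>w x. 0 \<le> f w x"
  shows "(\<Sum>u\<in>UNIV. \<integral>\<^sub>pw. ennreal (w_ratio P1 e1 q u w) * (\<integral>\<^sub>px. ennreal (pmf P1 u * f w x) \<partial>(x_kernel e1 q u w))
       \<partial>(PW1 q))
    = ennreal (\<Sum>w\<in>UNIV. \<Sum>x\<in>UNIV. pmf (WX1 q) (w, x) * f w x)"
proof -
  have "(\<Sum>u\<in>UNIV. \<integral>\<^sub>pw. ennreal (w_ratio P1 e1 q u w) * (\<integral>\<^sub>px. ennreal (pmf P1 u * f w x) \<partial>(x_kernel e1 q u w))
       \<partial>(PW1 q))
    = (\<integral>\<^sub>pw. ennreal (\<Sum>x\<in>UNIV. kern q w x * f w x) \<partial>(PW1 q))"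
    using assms by (simp add: nn_integral_pmf_sum[symmetric] sum_ratio_kernel)
  also have "\<dots> = ennreal (\<Sum>w\<in>UNIV. pmf (PW1 q) w * (\<Sum>x\<in>UNIV. kern q w x * f w x))"
    using assms by (intro nn_integral_finite_type sum_nonneg mult_nonneg_nonneg kern)
  also have "(\<Sum>w\<in>UNIV. pmf (PW1 q) w * (\<Sum>x\<in>UNIV. kern q w x * f w x)) = (\<Sum>w\<in>UNIV. \<Sum>x\<in>UNIV. pmf (WX1 q) (w, x) * f w x)"
    by (simp add: sum_distrib_left kern(2)[symmetric] mult.assoc)
  finally show ?thesis .
qed

lemma sum_wx_snd: "(\<Sum>w\<in>UNIV. \<Sum>x\<in>UNIV. pmf (WX1 q) (w, x) * f x) = (\<Sum>x\<in>UNIV. pmf (map_pmf snd (WX1 q)) x * f x)"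
  by (subst sum.swap) (simp add: sum_pmf_fst[symmetric] sum_distrib_right)

text \<open>A wrong word that shares \<open>w\<close> has an input of law p(x|w,q), which equals
  p(x|w,w2,q) by the independence of the users.\<close>

lemma densA_le:
  "(\<Sum>u\<in>UNIV. ennreal (w_ratio P1 e1 q u w) * (\<integral>\<^sub>px. ennreal (densA q u w x w2 o') \<partial>(x_kernel e1 q u w))) \<le> 1"
  unfolding densA_def
  by (subst sum_ratio_kernel[OF info_density_nonneg], subst ennreal_le_1, rule sum_info_density_le_1)
     (simp_all add: kern(1) pmf_XZ pmf_Z kern(2)[symmetric] mult_ac)

text \<open>With a fresh codeword the wrong input has law p(x|q), so this density conditions on
  \<open>w2\<close> and \<open>q\<close> alone.\<close>

lemma densB_le:
  "(\<Sum>u\<in>UNIV. \<integral>\<^sub>pw. ennreal (w_ratio P1 e1 q u w) * (\<integral>\<^sub>px. ennreal (densB q u w x w2 o') \<partial>(x_kernel e1 q u w))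
     \<partial>(PW1 q)) \<le> 1"
  unfolding densB_def
  by (subst sum_ratio_marginal[OF info_density_nonneg], subst ennreal_le_1, subst sum_wx_snd, rule sum_info_density_le_1)
     (simp_all add: pmf_XZ pmf_Z mult_ac)

lemma nn_integral_PW2:
  fixes f :: "'w2 \<Rightarrow> real"
  assumes "\<And>w2. 0 \<le> f w2" "0 \<le> c"
  shows "(\<integral>\<^sub>pw2. ennreal (c * f w2) \<partial>(PW2 q)) = ennreal (c * (\<Sum>w2\<in>UNIV. pmf (PW2 q) w2 * f w2))"
  using assms by (simp add: nn_integral_finite_type sum_distrib_left mult.left_commute)

text \<open>Now \<open>w2\<close> is fresh and \<open>w\<close> is shared: (w2, x) has law p(w2|q)
  p(x|w,q), its conditional law given (w, q).\<close>

lemma densC_le: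
  "(\<Sum>u\<in>UNIV. ennreal (w_ratio P1 e1 q u w) * (\<integral>\<^sub>px. \<integral>\<^sub>pw2. ennreal (densC q u w x w2 o') \<partial>(PW2 q)
      \<partial>(x_kernel e1 q u w))) \<le> 1"
proof -
  let ?i = "\<lambda>x w2. info_density joint (\<lambda>\<omega>. (cW2 \<omega>, cX1 \<omega>)) cO (\<lambda>\<omega>. (cW1 \<omega>, cQ \<omega>)) (w2, x) o' (w, q)"
  have "(\<Sum>x\<in>UNIV. kern q w x * (\<Sum>w2\<in>UNIV. pmf (PW2 q) w2 * ?i x w2))
      = (\<Sum>(w2, x)\<in>UNIV. (pmf (PW2 q) w2 * kern q w x) * ?i x w2)"
    by (simp add: sum_distrib_left mult_ac UNIV_Times_UNIV[symmetric] sum.cartesian_product[symmetric] del: UNIV_Times_UNIV)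
       (rule sum.swap)
  also have "\<dots> = (\<Sum>z\<in>UNIV. (pmf (PW2 q) (fst z) * kern q w (snd z)) *
      info_density joint (\<lambda>\<omega>. (cW2 \<omega>, cX1 \<omega>)) cO (\<lambda>\<omega>. (cW1 \<omega>, cQ \<omega>)) z o' (w, q))"
    by (simp add: case_prod_unfold)
  also have "\<dots> \<le> 1"
    by (rule sum_info_density_le_1) (auto simp: kern(1) pmf_XZ pmf_Z kern(2)[symmetric] mult_ac)
  finally have "(\<Sum>x\<in>UNIV. kern q w x * (\<Sum>w2\<in>UNIV. pmf (PW2 q) w2 * ?i x w2)) \<le> 1" .
  moreover have "0 \<le> (\<Sum>w2\<in>UNIV. pmf (PW2 q) w2 * ?i x w2)" for x
    by (intro sum_nonneg mult_nonneg_nonneg info_density_nonneg pmf_nonneg)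
  ultimately show ?thesis
    unfolding densC_def by (simp add: nn_integral_PW2 info_density_nonneg sum_ratio_kernel)
qed

text \<open>Both codewords are fresh, so (w2, x) has law p(w2|q) p(x|q) and the density conditions
  on \<open>q\<close> only.\<close>

lemma densD_le:
  "(\<Sum>u\<in>UNIV. \<integral>\<^sub>pw. ennreal (w_ratio P1 e1 q u w) * (\<integral>\<^sub>px. \<integral>\<^sub>pw2. ennreal (densD q u w x w2 o') \<partial>(PW2 q)
      \<partial>(x_kernel e1 q u w)) \<partial>(PW1 q)) \<le> 1"
proof -
  let ?i = "\<lambda>x w2. info_density joint (\<lambda>\<omega>. (cW2 \<omega>, cX1 \<omega>)) cO cQ (w2, x) o' q"
  have "(\<Sum>x\<in>UNIV. pmf (map_pmf snd (WX1 q)) x * (\<Sum>w2\<in>UNIV. pmf (PW2 q) w2 * ?i x w2))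
      = (\<Sum>(w2, x)\<in>UNIV. (pmf (PW2 q) w2 * pmf (map_pmf snd (WX1 q)) x) * ?i x w2)"
    by (simp add: sum_distrib_left mult_ac UNIV_Times_UNIV[symmetric] sum.cartesian_product[symmetric] del: UNIV_Times_UNIV)
       (rule sum.swap)
  also have "\<dots> = (\<Sum>z\<in>UNIV. (pmf (PW2 q) (fst z) * pmf (map_pmf snd (WX1 q)) (snd z)) *
      info_density joint (\<lambda>\<omega>. (cW2 \<omega>, cX1 \<omega>)) cO cQ z o' q)"
    by (simp add: case_prod_unfold)
  also have "\<dots> \<le> 1"
    by (rule sum_info_density_le_1) (auto simp: pmf_XZ pmf_Z mult_ac)
  finally have "(\<Sum>x\<in>UNIV. pmf (map_pmf snd (WX1 q)) x * (\<Sum>w2\<in>UNIV. pmf (PW2 q) w2 * ?i x w2)) \<le> 1" .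
  moreover have "0 \<le> (\<Sum>w2\<in>UNIV. pmf (PW2 q) w2 * ?i x w2)" for x
    by (intro sum_nonneg mult_nonneg_nonneg info_density_nonneg pmf_nonneg)
  ultimately show ?thesis
    unfolding densD_def by (simp add: nn_integral_PW2 info_density_nonneg sum_ratio_marginal sum_wx_snd)
qed

lemma dens_nonneg: "0 \<le> densA q u w x w2 o'" "0 \<le> densB q u w x w2 o'" "0 \<le> densC q u w x w2 o'" "0 \<le> densD q u w x w2 o'"
  by (simp_all add: densA_def densB_def densC_def densD_def info_density_nonneg)

end

section \<open>Vanishing error of one receiver\<close>

lemma sum_blocks_prod:
  fixes f :: "nat \<Rightarrow> 'u::finite \<Rightarrow> ennreal"
  shows "(\<Sum>u\<in>blocks n. \<Prod>i<n. f i (u i)) = (\<Prod>i<n. \<Sum>u\<in>UNIV. f i u)"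
  unfolding blocks_def by (rule prod_sum_PiE[symmetric]) auto

text \<open>In the application \<open>b\<close> is the Markov factor 2^(-nt). The sum over source
  blocks of a product over letters is a product of single-letter sums, each at most 1.\<close>

lemma block_sum_same_le:
  fixes P :: "'u::finite pmf" and D :: "nat \<Rightarrow> 'u \<Rightarrow> 'x \<Rightarrow> ennreal"
  assumes g: "\<And>u x. g u x \<le> b * (\<Prod>i<n. D i (u i) (x i))"
    and D: "\<And>i. (\<Sum>u\<in>UNIV. ennreal (w_ratio P e (q i) u (w i)) * (\<integral>\<^sub>px. D i u x \<partial>(x_kernel e (q i) u (w i)))) \<le> 1"
  shows "(\<Sum>u\<in>blocks n. ennreal (block_ratio P e n q u w) * (\<integral>\<^sub>px. g u x \<partial>(block_kernel e n q u w))) \<le> b"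
proof -
  let ?I = "\<lambda>i u. ennreal (w_ratio P e (q i) u (w i)) * (\<integral>\<^sub>px. D i u x \<partial>(x_kernel e (q i) u (w i)))"
  have "(\<Sum>u\<in>blocks n. ennreal (block_ratio P e n q u w) * (\<integral>\<^sub>px. g u x \<partial>(block_kernel e n q u w)))
    \<le> (\<Sum>u\<in>blocks n. ennreal (block_ratio P e n q u w) *
        (\<integral>\<^sub>px. b * (\<Prod>i<n. D i (u i) (x i)) \<partial>(block_kernel e n q u w)))"
    by (intro sum_mono mult_left_mono nn_integral_mono g) auto
  also have "\<dots> = (\<Sum>u\<in>blocks n. b * (\<Prod>i<n. ?I i (u i)))"
    using nn_integral_prod_Pi_pmf[of "{..<n}" undefined "\<lambda>i. x_kernel e (q i) (u i) (w i)" "\<lambda>i x. D i (u i) x" for u]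
    by (simp add: nn_integral_cmult ennreal_block_ratio prod.distrib block_kernel_def mult.left_commute)
  also have "\<dots> = b * (\<Prod>i<n. \<Sum>u\<in>UNIV. ?I i u)"
    unfolding sum_distrib_left[symmetric] by (subst sum_blocks_prod[where f = ?I]) (rule refl)
  also have "\<dots> \<le> b * 1"
    by (intro mult_left_mono prod_le_1) (auto simp: D)
  finally show ?thesis
    by simp
qed

lemma block_sum_other_le:
  fixes P :: "'u::finite pmf" and D :: "nat \<Rightarrow> 'u \<Rightarrow> 'w \<Rightarrow> 'x \<Rightarrow> ennreal"
  assumes g: "\<And>u w x. g u w x \<le> b * (\<Prod>i<n. D i (u i) (w i) (x i))"
    and D: "\<And>i. (\<Sum>u\<in>UNIV. \<integral>\<^sub>pw. ennreal (w_ratio P e (q i) u w) * (\<integral>\<^sub>px. D i u w x \<partial>(x_kernel e (q i) u w))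
      \<partial>(w_marginal P e (q i))) \<le> 1"
  shows "(\<Sum>u\<in>blocks n. \<integral>\<^sub>pw. ennreal (block_ratio P e n q u w) * (\<integral>\<^sub>px. g u w x \<partial>(block_kernel e n q u w))
      \<partial>(block_marginal P e n q)) \<le> b"
proof -
  let ?I = "\<lambda>i u w. ennreal (w_ratio P e (q i) u w) * (\<integral>\<^sub>px. D i u w x \<partial>(x_kernel e (q i) u w))"
  have "(\<Sum>u\<in>blocks n. \<integral>\<^sub>pw. ennreal (block_ratio P e n q u w) * (\<integral>\<^sub>px. g u w x \<partial>(block_kernel e n q u w))
      \<partial>(block_marginal P e n q))
    \<le> (\<Sum>u\<in>blocks n. \<integral>\<^sub>pw. ennreal (block_ratio P e n q u w) *
        (\<integral>\<^sub>px. b * (\<Prod>i<n. D i (u i) (w i) (x i)) \<partial>(block_kernel e n q u w)) \<partial>(block_marginal P e n q))"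
    by (intro sum_mono mult_left_mono nn_integral_mono g) auto
  also have "\<dots> = (\<Sum>u\<in>blocks n. b * (\<integral>\<^sub>pw. (\<Prod>i<n. ?I i (u i) (w i)) \<partial>(block_marginal P e n q)))"
    using nn_integral_prod_Pi_pmf[of "{..<n}" undefined "\<lambda>i. x_kernel e (q i) (u i) (w i)" "\<lambda>i x. D i (u i) (w i) x" for u w]
    by (simp add: nn_integral_cmult ennreal_block_ratio prod.distrib block_kernel_def mult.left_commute)
  also have "\<dots> = (\<Sum>u\<in>blocks n. b * (\<Prod>i<n. \<integral>\<^sub>pw. ?I i (u i) w \<partial>(w_marginal P e (q i))))"
    using nn_integral_prod_Pi_pmf[of "{..<n}" undefined "\<lambda>i. w_marginal P e (q i)" "\<lambda>i w. ?I i (u i) w" for u]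
    by (simp add: block_marginal_def)
  also have "\<dots> = b * (\<Prod>i<n. \<Sum>u\<in>UNIV. \<integral>\<^sub>pw. ?I i u w \<partial>(w_marginal P e (q i)))"
    unfolding sum_distrib_left[symmetric]
    by (subst sum_blocks_prod[where f = "\<lambda>i u. \<integral>\<^sub>pw. ?I i u w \<partial>(w_marginal P e (q i))"]) (rule refl)
  also have "\<dots> \<le> b * 1"
    by (intro mult_left_mono prod_le_1) (auto simp: D)
  finally show ?thesis
    by simp
qed

text \<open>The value at 0 is infinite because a block containing a letter of density 0 is never typical;
  under the joint law such letters have probability 0.\<close>

definition inverse_moment :: "real \<Rightarrow> real \<Rightarrow> real \<Rightarrow> ennreal" where
  "inverse_moment t l x = (if x = 0 then \<top> else ennreal ((2 powr t / x) powr l))"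

lemma prod_inverse_moment_ge_1:
  assumes "\<And>i. 0 \<le> f i" "l > 0" "\<not> 2 powr (real n * t) \<le> (\<Prod>i<n. f i)"
  shows "1 \<le> (\<Prod>i<n. inverse_moment t l (f i))"
proof (cases "\<exists>i<n. f i = 0")
  case True
  \<comment> \<open>In \<open>ennreal\<close>, 0 times infinity is 0: one infinite factor makes the
    product infinite only if no factor vanishes.\<close>
  have "inverse_moment t l x \<noteq> 0" if "0 \<le> x" for x
    using that by (auto simp: inverse_moment_def ennreal_eq_0_iff not_le)
  then have "(\<Prod>i<n. inverse_moment t l (f i)) = \<top>"
    using True assms(1) by (subst ennreal_prod_eq_top) (auto simp: inverse_moment_def)
  then show ?thesis
    by simp
next
  case False
  then have pos: "0 < f i" if "i < n" for i
    using that assms(1)[of i] by (auto simp: order.strict_iff_order)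
  then have "0 < (\<Prod>i<n. f i)"
    by (intro prod_pos) auto
  then have "1 \<le> (\<Prod>i<n. 2 powr t / f i)"
    using assms(3) by (simp add: prod_dividef two_powr_power)
  then have "1 \<le> (\<Prod>i<n. 2 powr t / f i) powr l"
    using assms(2) by (simp add: ge_one_powr_ge_zero)
  also have "\<dots> = (\<Prod>i<n. (2 powr t / f i) powr l)"
    by (rule prod_powr_distrib)
  finally have "ennreal 1 \<le> ennreal (\<Prod>i<n. (2 powr t / f i) powr l)"
    by (rule ennreal_leI)
  also have "\<dots> = (\<Prod>i<n. inverse_moment t l (f i))"
    using False by (subst prod_ennreal[symmetric]) (auto simp: inverse_moment_def intro!: prod.cong)
  finally show ?thesis
    by simp
qed

section \<open>Chernoff bound for the true tuple\<close>

context receiver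
begin

definition chan :: "nat \<Rightarrow> (nat \<Rightarrow> 'x1) \<Rightarrow> (nat \<Rightarrow> 'x2) \<Rightarrow> (nat \<Rightarrow> 'y) pmf" where
  "chan n x1 x2 = Pi_pmf {..<n} undefined (\<lambda>i. ch (x1 i) (x2 i))"

definition obs :: "nat \<Rightarrow> (nat \<Rightarrow> 's) \<Rightarrow> (nat \<Rightarrow> 'y) \<Rightarrow> nat \<Rightarrow> 'o" where
  "obs n s y = (\<lambda>i\<in>{..<n}. ob (s i) (y i))"

abbreviation sblock :: "nat \<Rightarrow> (nat \<Rightarrow> 's) pmf" where
  "sblock n \<equiv> Pi_pmf {..<n} undefined (\<lambda>_. S)"

abbreviation qblock :: "nat \<Rightarrow> (nat \<Rightarrow> 'q) pmf" where
  "qblock n \<equiv> Pi_pmf {..<n} undefined (\<lambda>_. pq)"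

abbreviation u1block :: "nat \<Rightarrow> (nat \<Rightarrow> 's) \<Rightarrow> nat \<Rightarrow> 'u1" where
  "u1block n s \<equiv> (\<lambda>i\<in>{..<n}. a1 (s i))"

abbreviation u2block :: "nat \<Rightarrow> (nat \<Rightarrow> 's) \<Rightarrow> nat \<Rightarrow> 'u2" where
  "u2block n s \<equiv> (\<lambda>i\<in>{..<n}. a2 (s i))"

definition typical where
  "typical n ta tb tc td q u w x w2 o' \<longleftrightarrow>
     exceeds n ta densA q u w x w2 o' \<and> exceeds n tb densB q u w x w2 o' \<and>
     exceeds n tc densC q u w x w2 o' \<and> exceeds n td densD q u w x w2 o'"

context
  fixes d :: "'q \<Rightarrow> 'u1 \<Rightarrow> 'w1 \<Rightarrow> 'x1 \<Rightarrow> 'w2 \<Rightarrow> 'o \<Rightarrow> real"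
  assumes d: "\<And>q u w x w2 o'. 0 \<le> d q u w x w2 o'"
begin

lemma nn_integral_exceeds_w2_le:
  "(\<integral>\<^sub>pw2. of_bool (exceeds n t d q u w x w2 o') \<partial>(block_marginal P2 e2 n q))
    \<le> ennreal (2 powr (- real n * t)) * (\<Prod>i<n. \<integral>\<^sub>pw2. ennreal (d (q i) (u i) (w i) (x i) w2 (o' i)) \<partial>(PW2 (q i)))"
proof -
  have "(\<integral>\<^sub>pw2. of_bool (exceeds n t d q u w x w2 o') \<partial>(block_marginal P2 e2 n q))
    \<le> (\<integral>\<^sub>pw2. ennreal (2 powr (- real n * t)) * (\<Prod>i<n. ennreal (d (q i) (u i) (w i) (x i) (w2 i) (o' i)))
        \<partial>(block_marginal P2 e2 n q))"
    by (intro nn_integral_mono of_bool_exceeds_le d)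
  also have "\<dots> = ennreal (2 powr (- real n * t)) * (\<Prod>i<n. \<integral>\<^sub>pw2. ennreal (d (q i) (u i) (w i) (x i) w2 (o' i)) \<partial>(PW2 (q i)))"
    using nn_integral_prod_Pi_pmf[of "{..<n}" undefined "\<lambda>i. PW2 (q i)" "\<lambda>i w2. ennreal (d (q i) (u i) (w i) (x i) w2 (o' i))"]
    by (simp add: nn_integral_cmult block_marginal_def)
  finally show ?thesis .
qed

text \<open>The weight, under the reweighted law, of true tuples below the threshold of
  \<open>d\<close>. Its nesting copies the true-tuple term of the one-shot bound.\<close>

definition missed :: "nat \<Rightarrow> real \<Rightarrow> ennreal" where
  "missed n t = (\<integral>\<^sub>pq. \<integral>\<^sub>ps. \<integral>\<^sub>pw1. ennreal (block_ratio P1 e1 n q (u1block n s) w1) * (\<integral>\<^sub>px1. \<integral>\<^sub>pw2.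
      ennreal (block_ratio P2 e2 n q (u2block n s) w2) * (\<integral>\<^sub>px2. \<integral>\<^sub>py.
        of_bool (\<not> exceeds n t d q (u1block n s) w1 x1 w2 (obs n s y))
      \<partial>(chan n x1 x2) \<partial>(block_kernel e2 n q (u2block n s) w2))
      \<partial>(block_marginal P2 e2 n q) \<partial>(block_kernel e1 n q (u1block n s) w1))
      \<partial>(block_marginal P1 e1 n q) \<partial>(sblock n) \<partial>(qblock n))"

text \<open>As \<open>t\<close> lies below the mean log-density, 2^t over the density has a negative
  mean logarithm, and one of its positive powers has mean below 1.\<close>

lemma missed_tendsto_0:
  assumes pos: "\<And>q s z1 z2 y. (q, s, z1, z2, y) \<in> set_pmf joint \<Longrightarrow> 0 < d q (a1 s) (fst z1) (snd z1) (fst z2) (ob s y)"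
    and t: "t < measure_pmf.expectation joint (\<lambda>(q, s, z1, z2, y). log 2 (d q (a1 s) (fst z1) (snd z1) (fst z2) (ob s y)))"
  shows "(\<lambda>n. missed n t) \<longlonglongrightarrow> 0"
proof -
  define f :: "'q \<times> 's \<times> ('w1 \<times> 'x1) \<times> ('w2 \<times> 'x2) \<times> 'y \<Rightarrow> real"
    where "f = (\<lambda>(q, s, z1, z2, y). 2 powr t / d q (a1 s) (fst z1) (snd z1) (fst z2) (ob s y))"
  have "measure_pmf.expectation joint (\<lambda>x. log 2 (f x))
      = measure_pmf.expectation joint (\<lambda>x. t - (case x of (q, s, z1, z2, y) \<Rightarrow> log 2 (d q (a1 s) (fst z1) (snd z1) (fst z2) (ob s y))))"
    by (intro integral_cong_AE) (auto simp: AE_measure_pmf_iff f_def log_divide dest!: pos)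
  also have "\<dots> < 0"
    using t by simp
  finally have neg: "measure_pmf.expectation joint (\<lambda>x. log 2 (f x)) < 0" .
  have f_pos: "f x > 0" if "x \<in> set_pmf joint" for x
    using that pos by (auto simp: f_def split: prod.splits)
  obtain l where l: "l > 0" and mom: "(\<integral>\<^sub>px. ennreal (f x powr l) \<partial>joint) < 1"
    by (rule powr_moment_less_1[OF _ f_pos neg]) simp_all
  \<comment> \<open>The layers \<open>h5\<close> to \<open>h0\<close> integrate out one variable at
    a time in the nesting of \<open>missed\<close>; each block integral takes the product of one
    layer to the product of the next.\<close>
  define h where "h q s w1 x1 w2 y = inverse_moment t l (d q (a1 s) w1 x1 w2 (ob s y))" for q s w1 x1 w2 y
  define h5 where "h5 q s w1 x1 w2 x2 = (\<integral>\<^sub>py. h q s w1 x1 w2 y \<partial>(ch x1 x2))" for q s w1 x1 w2 x2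
  define h4 where "h4 q s w1 x1 w2 = ennreal (w_ratio P2 e2 q (a2 s) w2) *
      (\<integral>\<^sub>px2. h5 q s w1 x1 w2 x2 \<partial>(x_kernel e2 q (a2 s) w2))" for q s w1 x1 w2
  define h3 where "h3 q s w1 x1 = (\<integral>\<^sub>pw2. h4 q s w1 x1 w2 \<partial>(PW2 q))" for q s w1 x1
  define h2 where "h2 q s w1 = ennreal (w_ratio P1 e1 q (a1 s) w1) *
      (\<integral>\<^sub>px1. h3 q s w1 x1 \<partial>(x_kernel e1 q (a1 s) w1))" for q s w1
  define h1 where "h1 q s = (\<integral>\<^sub>pw1. h2 q s w1 \<partial>(PW1 q))" for q s
  define h0 where "h0 q = (\<integral>\<^sub>ps. h1 q s \<partial>S)" for q
  define \<epsilon> where "\<epsilon> = (\<integral>\<^sub>pq. h0 q \<partial>pq)"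
  \<comment> \<open>The reweighting is removed for the inner user and then for the outer one, which
    leaves an average under \<open>joint\<close>.\<close>
  have "\<epsilon> \<le> (\<integral>\<^sub>pq. \<integral>\<^sub>ps. \<integral>\<^sub>pz1. \<integral>\<^sub>pz2. h5 q s (fst z1) (snd z1) (fst z2) (snd z2)
      \<partial>(e2 (a2 s) q) \<partial>(e1 (a1 s) q) \<partial>S \<partial>pq)"
  proof -
    have "h3 q s w1 x1 \<le> (\<integral>\<^sub>pz2. h5 q s w1 x1 (fst z2) (snd z2) \<partial>(e2 (a2 s) q))" for q s w1 x1
      unfolding h3_def h4_def by (rule nn_integral_w_ratio_le)
    then have "(\<integral>\<^sub>pz1. h3 q s (fst z1) (snd z1) \<partial>(e1 (a1 s) q)) \<le>
        (\<integral>\<^sub>pz1. \<integral>\<^sub>pz2. h5 q s (fst z1) (snd z1) (fst z2) (snd z2) \<partial>(e2 (a2 s) q) \<partial>(e1 (a1 s) q))" for q s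
      by (intro nn_integral_mono)
    moreover have "h1 q s \<le> (\<integral>\<^sub>pz1. h3 q s (fst z1) (snd z1) \<partial>(e1 (a1 s) q))" for q s
      unfolding h1_def h2_def by (rule nn_integral_w_ratio_le)
    ultimately show ?thesis
      unfolding \<epsilon>_def h0_def by (intro nn_integral_mono) (rule order.trans)
  qed
  also have "\<dots> = (\<integral>\<^sub>px. (case x of (q, s, z1, z2, y) \<Rightarrow> h q s (fst z1) (snd z1) (fst z2) y) \<partial>joint)"
    by (simp add: joint_def h5_def)
  also have "\<dots> = (\<integral>\<^sub>px. ennreal (f x powr l) \<partial>joint)"
    by (intro nn_integral_cong_AE) (auto simp: AE_measure_pmf_iff h_def f_def inverse_moment_def dest!: pos)
  finally have \<epsilon>: "\<epsilon> < 1"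
    using mom by simp
  have bound: "missed n t \<le> \<epsilon> ^ n" for n
  proof -
    have "of_bool (\<not> exceeds n t d q (u1block n s) w1 x1 w2 (obs n s y)) \<le> (\<Prod>i<n. h (q i) (s i) (w1 i) (x1 i) (w2 i) (y i))"
      for q s w1 x1 w2 y
    proof (cases "exceeds n t d q (u1block n s) w1 x1 w2 (obs n s y)")
      case False
      then have "1 \<le> (\<Prod>i<n. inverse_moment t l (d (q i) (a1 (s i)) (w1 i) (x1 i) (w2 i) (ob (s i) (y i))))"
        by (intro prod_inverse_moment_ge_1 d l) (simp add: exceeds_def obs_def)
      then show ?thesis
        using False by (simp add: h_def)
    qed simp
    then have "missed n t \<le> (\<integral>\<^sub>pq. \<integral>\<^sub>ps. \<integral>\<^sub>pw1. ennreal (block_ratio P1 e1 n q (u1block n s) w1) * (\<integral>\<^sub>px1. \<integral>\<^sub>pw2.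
      ennreal (block_ratio P2 e2 n q (u2block n s) w2) * (\<integral>\<^sub>px2. \<integral>\<^sub>py.
        (\<Prod>i<n. h (q i) (s i) (w1 i) (x1 i) (w2 i) (y i))
      \<partial>(chan n x1 x2) \<partial>(block_kernel e2 n q (u2block n s) w2))
      \<partial>(block_marginal P2 e2 n q) \<partial>(block_kernel e1 n q (u1block n s) w1))
      \<partial>(block_marginal P1 e1 n q) \<partial>(sblock n) \<partial>(qblock n))"
      unfolding missed_def by (intro nn_integral_mono mult_left_mono) auto
    also have "\<dots> = \<epsilon> ^ n"
    proof -
      have 5: "(\<integral>\<^sub>py. (\<Prod>i<n. h (q i) (s i) (w1 i) (x1 i) (w2 i) (y i)) \<partial>(chan n x1 x2))
          = (\<Prod>i<n. h5 (q i) (s i) (w1 i) (x1 i) (w2 i) (x2 i))" for q s w1 x1 w2 x2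
        unfolding chan_def h5_def
        by (rule nn_integral_prod_Pi_pmf[where f = "\<lambda>i y. h (q i) (s i) (w1 i) (x1 i) (w2 i) y"]) simp
      have 4: "ennreal (block_ratio P2 e2 n q (u2block n s) w2) * (\<integral>\<^sub>px2. (\<Prod>i<n. h5 (q i) (s i) (w1 i) (x1 i) (w2 i) (x2 i))
          \<partial>(block_kernel e2 n q (u2block n s) w2))
          = (\<Prod>i<n. h4 (q i) (s i) (w1 i) (x1 i) (w2 i))" for q s w1 x1 w2
        unfolding block_kernel_def h4_def ennreal_block_ratio prod.distrib
        by (subst nn_integral_prod_Pi_pmf[where f = "\<lambda>i x2. h5 (q i) (s i) (w1 i) (x1 i) (w2 i) x2"]) simp_all
      have 3: "(\<integral>\<^sub>pw2. (\<Prod>i<n. h4 (q i) (s i) (w1 i) (x1 i) (w2 i)) \<partial>(block_marginal P2 e2 n q))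
          = (\<Prod>i<n. h3 (q i) (s i) (w1 i) (x1 i))" for q s w1 x1
        unfolding block_marginal_def h3_def
        by (rule nn_integral_prod_Pi_pmf[where f = "\<lambda>i w2. h4 (q i) (s i) (w1 i) (x1 i) w2"]) simp
      have 2: "ennreal (block_ratio P1 e1 n q (u1block n s) w1) * (\<integral>\<^sub>px1. (\<Prod>i<n. h3 (q i) (s i) (w1 i) (x1 i))
          \<partial>(block_kernel e1 n q (u1block n s) w1))
          = (\<Prod>i<n. h2 (q i) (s i) (w1 i))" for q s w1
        unfolding block_kernel_def h2_def ennreal_block_ratio prod.distrib
        by (subst nn_integral_prod_Pi_pmf[where f = "\<lambda>i x1. h3 (q i) (s i) (w1 i) x1"]) simp_all
      have 1: "(\<integral>\<^sub>pw1. (\<Prod>i<n. h2 (q i) (s i) (w1 i)) \<partial>(block_marginal P1 e1 n q)) = (\<Prod>i<n. h1 (q i) (s i))" for q s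
        unfolding block_marginal_def h1_def
        by (rule nn_integral_prod_Pi_pmf[where f = "\<lambda>i w1. h2 (q i) (s i) w1"]) simp
      have 0: "(\<integral>\<^sub>ps. (\<Prod>i<n. h1 (q i) (s i)) \<partial>(sblock n)) = (\<Prod>i<n. h0 (q i))" for q
        unfolding h0_def by (rule nn_integral_prod_Pi_pmf[where f = "\<lambda>i s. h1 (q i) s"]) simp
      have "(\<integral>\<^sub>pq. (\<Prod>i<n. h0 (q i)) \<partial>(qblock n)) = (\<Prod>i<n. \<epsilon>)"
        unfolding \<epsilon>_def by (rule nn_integral_prod_Pi_pmf[where f = "\<lambda>i q. h0 q"]) simp
      then show ?thesis
        unfolding 5 4 3 2 1 0 by simp
    qed
    finally show ?thesis .
  qed
  show ?thesis
    by (rule tendsto_sandwich[OF always_eventually always_eventually tendsto_const ennreal_power_tendsto_0[OF \<epsilon>]])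
       (use bound in auto)
qed

end

end

lemma two_powr_tendsto_0:
  assumes "x > 0"
  shows "(\<lambda>n. 2 powr (- real n * x) :: real) \<longlonglongrightarrow> 0"
proof -
  have "(\<lambda>n. (2 powr - x :: real) ^ n) \<longlonglongrightarrow> 0"
    using assms by (intro LIMSEQ_power_zero) (simp add: powr_less_one)
  then show ?thesis
    by (simp add: two_powr_power)
qed

text \<open>The four terms decay with exponents ta + R1, tc + R1 - R2, tb and td - R2. The constants
  2 come from rounding up the list size of user 2.\<close>

lemma confusion_bound_tendsto_0:
  assumes "0 \<le> R2" "0 < ta + R1" "0 < tb" "0 < tc + R1 - R2" "0 < td - R2"
  shows "(\<lambda>n. ennreal (1 / message_count R1 n) * (ennreal (2 powr (- real n * ta)) + of_nat (message_count R2 n) * ennreal (2 powr (- real n * tc)))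
     + (ennreal (2 powr (- real n * tb)) + of_nat (message_count R2 n) * ennreal (2 powr (- real n * td)))) \<longlonglongrightarrow> 0"
proof -
  define b where "b n = 2 powr (- real n * (ta + R1)) + 2 * 2 powr (- real n * (tc + R1 - R2))
      + (2 powr (- real n * tb) + 2 * 2 powr (- real n * (td - R2)))" for n
  have "b \<longlonglongrightarrow> 0 + 2 * 0 + (0 + 2 * 0)"
    unfolding b_def by (intro tendsto_add tendsto_mult tendsto_const two_powr_tendsto_0 assms)
  then have lim: "(\<lambda>n. ennreal (b n)) \<longlonglongrightarrow> 0"
    using tendsto_ennrealI[of b 0] by simp
  have "ennreal (1 / message_count R1 n) * (ennreal (2 powr (- real n * ta)) + of_nat (message_count R2 n) * ennreal (2 powr (- real n * tc)))
     + (ennreal (2 powr (- real n * tb)) + of_nat (message_count R2 n) * ennreal (2 powr (- real n * td))) \<le> ennreal (b n)" for n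
  proof -
    let ?M1 = "real (message_count R1 n)" and ?M2 = "real (message_count R2 n)"
    have M1: "1 / ?M1 \<le> 2 powr (- real n * R1)"
    proof -
      have "1 / ?M1 \<le> 1 / 2 powr (real n * R1)"
        using message_count_ge[of n R1] message_count_pos[of R1 n] by (intro divide_left_mono mult_pos_pos) auto
      then show ?thesis
        by (simp add: powr_minus_divide)
    qed
    have M2: "?M2 \<le> 2 * 2 powr (real n * R2)"
      by (rule message_count_le) fact
    have a: "1 / ?M1 * 2 powr (- real n * ta) \<le> 2 powr (- real n * (ta + R1))"
    proof -
      have "1 / ?M1 * 2 powr (- real n * ta) \<le> 2 powr (- real n * R1) * 2 powr (- real n * ta)"
        by (intro mult_right_mono M1) auto
      also have "\<dots> = 2 powr (- real n * (ta + R1))"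
        unfolding powr_add[symmetric] by (rule arg_cong[where f = "(powr) 2"]) (simp add: algebra_simps)
      finally show ?thesis .
    qed
    have c: "1 / ?M1 * (?M2 * 2 powr (- real n * tc)) \<le> 2 * 2 powr (- real n * (tc + R1 - R2))"
    proof -
      have "1 / ?M1 * (?M2 * 2 powr (- real n * tc)) \<le> 2 powr (- real n * R1) * ((2 * 2 powr (real n * R2)) * 2 powr (- real n * tc))"
        by (intro mult_mono M1 M2 mult_right_mono) auto
      also have "\<dots> = 2 * (2 powr (- real n * R1) * 2 powr (real n * R2) * 2 powr (- real n * tc))"
        by simp
      also have "\<dots> = 2 * 2 powr (- real n * (tc + R1 - R2))"
        unfolding powr_add[symmetric] by (rule arg_cong[where f = "\<lambda>y. 2 * 2 powr y"]) (simp add: algebra_simps)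
      finally show ?thesis .
    qed
    have d: "?M2 * 2 powr (- real n * td) \<le> 2 * 2 powr (- real n * (td - R2))"
    proof -
      have "?M2 * 2 powr (- real n * td) \<le> (2 * 2 powr (real n * R2)) * 2 powr (- real n * td)"
        by (intro mult_right_mono M2) auto
      also have "\<dots> = 2 * (2 powr (real n * R2) * 2 powr (- real n * td))"
        by simp
      also have "\<dots> = 2 * 2 powr (- real n * (td - R2))"
        unfolding powr_add[symmetric] by (rule arg_cong[where f = "\<lambda>y. 2 * 2 powr y"]) (simp add: algebra_simps)
      finally show ?thesis .
    qed
    have "1 / ?M1 * (2 powr (- real n * ta) + ?M2 * 2 powr (- real n * tc)) + (2 powr (- real n * tb) + ?M2 * 2 powr (- real n * td)) \<le> b n"
      using a c d unfolding b_def distrib_left by linarith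
    then have "ennreal (1 / ?M1 * (2 powr (- real n * ta) + ?M2 * 2 powr (- real n * tc)) + (2 powr (- real n * tb) + ?M2 * 2 powr (- real n * td)))
        \<le> ennreal (b n)"
      by (rule ennreal_leI)
    moreover have "ennreal (1 / ?M1 * (2 powr (- real n * ta) + ?M2 * 2 powr (- real n * tc)) + (2 powr (- real n * tb) + ?M2 * 2 powr (- real n * td)))
      = ennreal (1 / ?M1) * (ennreal (2 powr (- real n * ta)) + ennreal ?M2 * ennreal (2 powr (- real n * tc)))
       + (ennreal (2 powr (- real n * tb)) + ennreal ?M2 * ennreal (2 powr (- real n * td)))"
      by (simp only: ennreal_plus ennreal_mult mult_nonneg_nonneg add_nonneg_nonneg powr_ge_zero of_nat_0_le_iff
          zero_le_divide_1_iff)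
    ultimately show ?thesis
      by (simp only: ennreal_of_nat_eq_real_of_nat)
  qed
  then show ?thesis
    by (intro tendsto_sandwich[OF always_eventually always_eventually tendsto_const lim]) auto
qed

context receiver
begin

lemma of_bool_not_typical_le:
  "of_bool (\<not> typical n ta tb tc td q u w x w2 o') \<le>
    (of_bool (\<not> exceeds n ta densA q u w x w2 o') + of_bool (\<not> exceeds n tb densB q u w x w2 o')
     + of_bool (\<not> exceeds n tc densC q u w x w2 o') + of_bool (\<not> exceeds n td densD q u w x w2 o') :: ennreal)"
  by (auto simp: typical_def)

text \<open>Both codebooks depend on the same time-sharing block, which is therefore averaged
  outermost.\<close>

definition average_error where
  "average_error ta tb tc td R1 c1 R2 c2 n =
     (\<integral>\<^sub>pq. \<integral>\<^sub>pC1. \<integral>\<^sub>pC2. \<integral>\<^sub>ps. \<integral>\<^sub>py.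
        of_bool (decoding_failure (blocks n) (message_count R1 n) (message_count R2 n) (typical n ta tb tc td q)
          C1 (fst C2) (obs n s y) (u1block n s))
        \<partial>(chan n (snd (snd C1 (u1block n s))) (snd (snd C2 (u2block n s)))) \<partial>(sblock n)
        \<partial>(user_codebook P2 e2 R2 c2 n q) \<partial>(user_codebook P1 e1 R1 c1 n q) \<partial>(qblock n))"

lemma average_error_tendsto_0:
  fixes R1 R2 c1 c2 :: real
  assumes fail1: "(\<lambda>n. \<integral>\<^sub>pq. \<integral>\<^sub>ps. \<integral>\<^sub>pC. (if fst (snd C (u1block n s)) < message_count R1 n then 0 else 1)
            \<partial>(user_codebook P1 e1 R1 c1 n q) \<partial>(sblock n) \<partial>(qblock n)) \<longlonglongrightarrow> 0"
    and fail2: "(\<lambda>n. \<integral>\<^sub>pq. \<integral>\<^sub>ps. \<integral>\<^sub>pC. (if fst (snd C (u2block n s)) < message_count R2 n then 0 else 1)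
            \<partial>(user_codebook P2 e2 R2 c2 n q) \<partial>(sblock n) \<partial>(qblock n)) \<longlonglongrightarrow> 0"
    and miss: "(\<lambda>n. missed densA n ta) \<longlonglongrightarrow> 0" "(\<lambda>n. missed densB n tb) \<longlonglongrightarrow> 0"
      "(\<lambda>n. missed densC n tc) \<longlonglongrightarrow> 0" "(\<lambda>n. missed densD n td) \<longlonglongrightarrow> 0"
    and rates: "0 \<le> R2" "0 < ta + R1" "0 < tb" "0 < tc + R1 - R2" "0 < td - R2"
  shows "average_error ta tb tc td R1 c1 R2 c2 \<longlonglongrightarrow> 0"
proof -
  let ?F1 = "\<lambda>n q. \<integral>\<^sub>ps. \<integral>\<^sub>pC. (if fst (snd C (u1block n s)) < message_count R1 n then 0 else 1 :: ennreal)
            \<partial>(user_codebook P1 e1 R1 c1 n q) \<partial>(sblock n)"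
  let ?F2 = "\<lambda>n q. \<integral>\<^sub>ps. \<integral>\<^sub>pC. (if fst (snd C (u2block n s)) < message_count R2 n then 0 else 1 :: ennreal)
            \<partial>(user_codebook P2 e2 R2 c2 n q) \<partial>(sblock n)"
  let ?W = "\<lambda>n q f. \<integral>\<^sub>ps. \<integral>\<^sub>pw1. ennreal (block_ratio P1 e1 n q (u1block n s) w1) * (\<integral>\<^sub>px1. \<integral>\<^sub>pw2.
      ennreal (block_ratio P2 e2 n q (u2block n s) w2) * (\<integral>\<^sub>px2. \<integral>\<^sub>py. (f (u1block n s) w1 x1 w2 (obs n s y) :: ennreal)
      \<partial>(chan n x1 x2) \<partial>(block_kernel e2 n q (u2block n s) w2))
      \<partial>(block_marginal P2 e2 n q) \<partial>(block_kernel e1 n q (u1block n s) w1))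
      \<partial>(block_marginal P1 e1 n q) \<partial>(sblock n)"
  let ?R = "\<lambda>n. ennreal (1 / message_count R1 n) * (ennreal (2 powr (- real n * ta)) + of_nat (message_count R2 n) * ennreal (2 powr (- real n * tc)))
     + (ennreal (2 powr (- real n * tb)) + of_nat (message_count R2 n) * ennreal (2 powr (- real n * td)))"
  have one_shot: "(\<integral>\<^sub>pC1. \<integral>\<^sub>pC2. \<integral>\<^sub>ps. \<integral>\<^sub>py.
        of_bool (decoding_failure (blocks n) (message_count R1 n) (message_count R2 n) (typical n ta tb tc td q)
          C1 (fst C2) (obs n s y) (u1block n s))
        \<partial>(chan n (snd (snd C1 (u1block n s))) (snd (snd C2 (u2block n s)))) \<partial>(sblock n)
        \<partial>(user_codebook P2 e2 R2 c2 n q) \<partial>(user_codebook P1 e1 R1 c1 n q))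
     \<le> ?F1 n q + ?F2 n q + ?W n q (\<lambda>u w x w2 o'. of_bool (\<not> typical n ta tb tc td q u w x w2 o')) + ?R n" for n q
  proof -
    \<comment> \<open>Each kind of confusion uses one threshold: the one whose conditioning matches
      the codewords that the wrong tuple shares with the true one.\<close>
    have le: "of_bool (typical n ta tb tc td q u w x w2 o') \<le> (of_bool (exceeds n ta densA q u w x w2 o') :: ennreal)"
      "of_bool (typical n ta tb tc td q u w x w2 o') \<le> (of_bool (exceeds n tb densB q u w x w2 o') :: ennreal)"
      "of_bool (typical n ta tb tc td q u w x w2 o') \<le> (of_bool (exceeds n tc densC q u w x w2 o') :: ennreal)"
      "of_bool (typical n ta tb tc td q u w x w2 o') \<le> (of_bool (exceeds n td densD q u w x w2 o') :: ennreal)" for u w x w2 o'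
      by (auto simp: typical_def)
    show ?thesis
      unfolding user_codebook_def
    proof (rule random_coding_error_le)
      fix w w2 o'
      show "(\<Sum>u\<in>blocks n. ennreal (block_ratio P1 e1 n q u w) * (\<integral>\<^sub>px. of_bool (typical n ta tb tc td q u w x w2 o')
          \<partial>(block_kernel e1 n q u w))) \<le> ennreal (2 powr (- real n * ta))"
        by (rule block_sum_same_le[OF order.trans[OF le(1) of_bool_exceeds_le[where d = densA, OF dens_nonneg(1)]] densA_le])
    next
      fix w2 o'
      show "(\<Sum>u\<in>blocks n. \<integral>\<^sub>pw. ennreal (block_ratio P1 e1 n q u w) * (\<integral>\<^sub>px. of_bool (typical n ta tb tc td q u w x w2 o')
          \<partial>(block_kernel e1 n q u w)) \<partial>(block_marginal P1 e1 n q)) \<le> ennreal (2 powr (- real n * tb))"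
        by (rule block_sum_other_le[OF order.trans[OF le(2) of_bool_exceeds_le[where d = densB, OF dens_nonneg(2)]] densB_le])
    next
      fix w o'
      show "(\<Sum>u\<in>blocks n. ennreal (block_ratio P1 e1 n q u w) * (\<integral>\<^sub>px. \<integral>\<^sub>pw2. of_bool (typical n ta tb tc td q u w x w2 o')
          \<partial>(block_marginal P2 e2 n q) \<partial>(block_kernel e1 n q u w))) \<le> ennreal (2 powr (- real n * tc))"
        by (rule block_sum_same_le[OF order.trans[OF nn_integral_mono[OF le(3)] nn_integral_exceeds_w2_le[where d = densC, OF dens_nonneg(3)]] densC_le])
    next
      fix o'
      show "(\<Sum>u\<in>blocks n. \<integral>\<^sub>pw. ennreal (block_ratio P1 e1 n q u w) * (\<integral>\<^sub>px. \<integral>\<^sub>pw2. of_bool (typical n ta tb tc td q u w x w2 o')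
          \<partial>(block_marginal P2 e2 n q) \<partial>(block_kernel e1 n q u w)) \<partial>(block_marginal P1 e1 n q))
          \<le> ennreal (2 powr (- real n * td))"
        by (rule block_sum_other_le[OF order.trans[OF nn_integral_mono[OF le(4)] nn_integral_exceeds_w2_le[where d = densD, OF dens_nonneg(4)]] densD_le])
    qed (rule finite_blocks restrict_in_blocks message_count_pos block_ratio_nonneg nn_integral_block_ratio_le_1)+
  qed
  have W_le: "?W n q (\<lambda>u w x w2 o'. of_bool (\<not> typical n ta tb tc td q u w x w2 o'))
     \<le> ?W n q (\<lambda>u w x w2 o'. of_bool (\<not> exceeds n ta densA q u w x w2 o')) + ?W n q (\<lambda>u w x w2 o'. of_bool (\<not> exceeds n tb densB q u w x w2 o'))
      + ?W n q (\<lambda>u w x w2 o'. of_bool (\<not> exceeds n tc densC q u w x w2 o')) + ?W n q (\<lambda>u w x w2 o'. of_bool (\<not> exceeds n td densD q u w x w2 o'))" for n q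
  proof -
    have "?W n q (\<lambda>u w x w2 o'. of_bool (\<not> typical n ta tb tc td q u w x w2 o'))
      \<le> ?W n q (\<lambda>u w x w2 o'. of_bool (\<not> exceeds n ta densA q u w x w2 o') + of_bool (\<not> exceeds n tb densB q u w x w2 o')
     + of_bool (\<not> exceeds n tc densC q u w x w2 o') + of_bool (\<not> exceeds n td densD q u w x w2 o'))"
      by (intro nn_integral_mono mult_left_mono of_bool_not_typical_le zero_le)
    then show ?thesis
      by (simp only: nn_integral_pmf_add distrib_left)
  qed
  have bound: "average_error ta tb tc td R1 c1 R2 c2 n \<le>
      (\<integral>\<^sub>pq. ?F1 n q \<partial>(qblock n)) + (\<integral>\<^sub>pq. ?F2 n q \<partial>(qblock n))
      + (missed densA n ta + missed densB n tb + missed densC n tc + missed densD n td) + ?R n" for n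
  proof -
    have "average_error ta tb tc td R1 c1 R2 c2 n \<le>
      (\<integral>\<^sub>pq. ?F1 n q + ?F2 n q + (?W n q (\<lambda>u w x w2 o'. of_bool (\<not> exceeds n ta densA q u w x w2 o')) + ?W n q (\<lambda>u w x w2 o'. of_bool (\<not> exceeds n tb densB q u w x w2 o'))
      + ?W n q (\<lambda>u w x w2 o'. of_bool (\<not> exceeds n tc densC q u w x w2 o')) + ?W n q (\<lambda>u w x w2 o'. of_bool (\<not> exceeds n td densD q u w x w2 o'))) + ?R n
        \<partial>(qblock n))"
      unfolding average_error_def
      by (intro nn_integral_mono order.trans[OF one_shot] add_mono order.refl W_le)
    then show ?thesis
      by (simp only: nn_integral_pmf_add nn_integral_pmf_const missed_def[OF dens_nonneg(1)] missed_def[OF dens_nonneg(2)]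
          missed_def[OF dens_nonneg(3)] missed_def[OF dens_nonneg(4)])
  qed
  have "(\<lambda>n. (\<integral>\<^sub>pq. ?F1 n q \<partial>(qblock n)) + (\<integral>\<^sub>pq. ?F2 n q \<partial>(qblock n))
      + (missed densA n ta + missed densB n tb + missed densC n tc + missed densD n td) + ?R n) \<longlonglongrightarrow> 0 + 0 + (0 + 0 + 0 + 0) + 0"
    by (intro tendsto_add fail1 fail2 miss confusion_bound_tendsto_0 rates)
  then have lim: "(\<lambda>n. (\<integral>\<^sub>pq. ?F1 n q \<partial>(qblock n)) + (\<integral>\<^sub>pq. ?F2 n q \<partial>(qblock n))
      + (missed densA n ta + missed densB n tb + missed densC n tc + missed densD n td) + ?R n) \<longlonglongrightarrow> 0"
    by simp
  show ?thesis
    by (rule tendsto_sandwich[OF always_eventually always_eventually tendsto_const lim]) (use bound in auto)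
qed

section \<open>Mean log-densities as mutual informations and entropies\<close>

lemma map_joint_u:
  "map_pmf (\<lambda>(q, s, z1, z2, y). (q, a1 s, z1)) joint = do { q \<leftarrow> pq; u \<leftarrow> P1; z \<leftarrow> e1 u q; return_pmf (q, u, z) }"
  unfolding map_S(1)[symmetric] by (simp add: joint_def map_bind_pmf bind_map_pmf)

lemma map_joint_us:
  "map_pmf (\<lambda>(q, s, z1, z2, y). (q, s, z1)) joint = do { q \<leftarrow> pq; s \<leftarrow> S; z \<leftarrow> e1 (a1 s) q; return_pmf (q, s, z) }"
  by (simp add: joint_def map_bind_pmf)

lemma map_cU: "map_pmf cU joint = P1"
proof -
  have "map_pmf cU joint = map_pmf (\<lambda>(q, u, z). u) (map_pmf (\<lambda>(q, s, z1, z2, y). (q, a1 s, z1)) joint)"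
    by (simp add: map_pmf_comp cU_def case_prod_unfold)
  then show ?thesis
    unfolding map_joint_u by (simp add: map_bind_pmf bind_return_pmf')
qed

lemma c_simps:
  "cQ (q, s, z1, z2, y) = q" "cU (q, s, z1, z2, y) = a1 s" "cW1 (q, s, z1, z2, y) = fst z1"
  "cX1 (q, s, z1, z2, y) = snd z1" "cW2 (q, s, z1, z2, y) = fst z2" "cO (q, s, z1, z2, y) = ob s y"
  by (simp_all add: cQ_def cU_def cW1_def cX1_def cW2_def cO_def)

text \<open>The source is independent of Q, so p(u,q) = p(u) p(q) cancels and leaves p(w|u,q) /
  p(w|q). This is why I(U;W|Q) is the threshold for the codebook rate.\<close>

lemma info_density_u:
  assumes "(q, s, (w, x), z2, y) \<in> set_pmf joint"
  shows "info_density joint cU cW1 cQ (a1 s) w q = w_ratio P1 e1 q (a1 s) w"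
proof -
  have UWQ: "pmf (map_pmf (\<lambda>\<omega>. (cU \<omega>, cW1 \<omega>, cQ \<omega>)) joint) (u, w, q)
      = pmf pq q * (pmf P1 u * pmf (map_pmf fst (e1 u q)) w)" for u w
  proof -
    have "map_pmf (\<lambda>\<omega>. (cU \<omega>, cW1 \<omega>, cQ \<omega>)) joint
        = map_pmf (\<lambda>(q, u, z). (u, fst z, q)) (map_pmf (\<lambda>(q, s, z1, z2, y). (q, a1 s, z1)) joint)"
      by (simp add: map_pmf_comp cU_def cW1_def cQ_def case_prod_unfold)
    also have "\<dots> = do { q \<leftarrow> pq; u \<leftarrow> P1; w \<leftarrow> map_pmf fst (e1 u q); return_pmf (u, w, q) }"
      unfolding map_joint_u by (simp add: map_bind_pmf bind_map_pmf)
    finally show ?thesis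
      by (simp add: pmf_bind_inj_point[where a = q] pmf_bind_inj_point[where a = u] pmf_bind_inj_point[where a = w]
          pmf_eq_0_set_pmf)
  qed
  have UQ: "pmf (map_pmf (\<lambda>\<omega>. (cU \<omega>, cQ \<omega>)) joint) (u, q) = pmf pq q * pmf P1 u" for u
  proof -
    have "map_pmf (\<lambda>\<omega>. (cU \<omega>, cQ \<omega>)) joint
        = map_pmf (\<lambda>(q, u, z). (u, q)) (map_pmf (\<lambda>(q, s, z1, z2, y). (q, a1 s, z1)) joint)"
      by (simp add: map_pmf_comp cU_def cQ_def case_prod_unfold)
    also have "\<dots> = do { q \<leftarrow> pq; u \<leftarrow> P1; return_pmf (u, q) }"
      unfolding map_joint_u by (simp add: map_bind_pmf)
    finally show ?thesis
      by (simp add: pmf_bind_inj_point[where a = q] pmf_bind_inj_point[where a = u] pmf_eq_0_set_pmf)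
  qed
  have "q \<in> set_pmf pq" "a1 s \<in> set_pmf P1"
    using assms by (auto simp: joint_def map_S(1)[symmetric])
  then have "pmf pq q \<noteq> 0" "pmf P1 (a1 s) \<noteq> 0"
    by (auto simp: set_pmf_iff)
  then show ?thesis
    by (simp add: info_density_def UWQ UQ pmf_Z w_ratio_def)
qed

lemma expectation_w_ratio:
  "measure_pmf.expectation (do { q \<leftarrow> pq; s \<leftarrow> S; z \<leftarrow> e1 (a1 s) q; return_pmf (q, s, z) })
      (\<lambda>(q, s, z). log 2 (w_ratio P1 e1 q (a1 s) (fst z))) = pmf_cmi joint cU cW1 cQ"
proof -
  have "pmf_cmi joint cU cW1 cQ = measure_pmf.expectation joint (\<lambda>(q, s, z1, z2, y). log 2 (w_ratio P1 e1 q (a1 s) (fst z1)))"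
    unfolding pmf_cmi_eq_expectation
    by (intro integral_cong_AE) (auto simp: AE_measure_pmf_iff c_simps info_density_u)
  also have "\<dots> = measure_pmf.expectation (map_pmf (\<lambda>(q, s, z1, z2, y). (q, s, z1)) joint)
      (\<lambda>(q, s, z). log 2 (w_ratio P1 e1 q (a1 s) (fst z)))"
    by (simp add: case_prod_unfold)
  finally show ?thesis
    unfolding map_joint_us by simp
qed

lemma dens_pos:
  assumes "(q, s, z1, z2, y) \<in> set_pmf joint"
  shows "0 < densA q (a1 s) (fst z1) (snd z1) (fst z2) (ob s y)" "0 < densB q (a1 s) (fst z1) (snd z1) (fst z2) (ob s y)"
    "0 < densC q (a1 s) (fst z1) (snd z1) (fst z2) (ob s y)" "0 < densD q (a1 s) (fst z1) (snd z1) (fst z2) (ob s y)"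
proof -
  have "0 < pmf P1 (a1 s)"
    using pmf_map_pos[OF assms, of cU] unfolding map_cU by (simp add: cU_def)
  then show "0 < densA q (a1 s) (fst z1) (snd z1) (fst z2) (ob s y)" "0 < densB q (a1 s) (fst z1) (snd z1) (fst z2) (ob s y)"
    "0 < densC q (a1 s) (fst z1) (snd z1) (fst z2) (ob s y)" "0 < densD q (a1 s) (fst z1) (snd z1) (fst z2) (ob s y)"
    using info_density_pos[OF assms, of cX1 cO "\<lambda>\<omega>. (cW1 \<omega>, cW2 \<omega>, cQ \<omega>)"]
      info_density_pos[OF assms, of cX1 cO "\<lambda>\<omega>. (cW2 \<omega>, cQ \<omega>)"]
      info_density_pos[OF assms, of "\<lambda>\<omega>. (cW2 \<omega>, cX1 \<omega>)" cO "\<lambda>\<omega>. (cW1 \<omega>, cQ \<omega>)"]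
      info_density_pos[OF assms, of "\<lambda>\<omega>. (cW2 \<omega>, cX1 \<omega>)" cO cQ]
    by (simp_all add: densA_def densB_def densC_def densD_def cX1_def cW1_def cW2_def cQ_def cO_def)
qed

lemma expectation_log_dens:
  fixes X :: "'q \<times> 's \<times> ('w1 \<times> 'x1) \<times> ('w2 \<times> 'x2) \<times> 'y \<Rightarrow> 'z"
  shows "measure_pmf.expectation joint (\<lambda>\<omega>. log 2 (pmf P1 (cU \<omega>) * info_density joint X Y Z (X \<omega>) (Y \<omega>) (Z \<omega>)))
    = pmf_cmi joint X Y Z - pmf_entropy joint cU"
proof -
  have "measure_pmf.expectation joint (\<lambda>\<omega>. log 2 (pmf P1 (cU \<omega>) * info_density joint X Y Z (X \<omega>) (Y \<omega>) (Z \<omega>)))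
      = measure_pmf.expectation joint (\<lambda>\<omega>. log 2 (pmf P1 (cU \<omega>)) + log 2 (info_density joint X Y Z (X \<omega>) (Y \<omega>) (Z \<omega>)))"
  proof (intro integral_cong_AE)
    show "AE \<omega> in measure_pmf joint. log 2 (pmf P1 (cU \<omega>) * info_density joint X Y Z (X \<omega>) (Y \<omega>) (Z \<omega>))
        = log 2 (pmf P1 (cU \<omega>)) + log 2 (info_density joint X Y Z (X \<omega>) (Y \<omega>) (Z \<omega>))"
      unfolding AE_measure_pmf_iff
    proof
      fix \<omega> assume \<omega>: "\<omega> \<in> set_pmf joint"
      have "0 < pmf P1 (cU \<omega>)"
        using pmf_map_pos[OF \<omega>, of cU] by (simp add: map_cU)
      then show "log 2 (pmf P1 (cU \<omega>) * info_density joint X Y Z (X \<omega>) (Y \<omega>) (Z \<omega>))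
        = log 2 (pmf P1 (cU \<omega>)) + log 2 (info_density joint X Y Z (X \<omega>) (Y \<omega>) (Z \<omega>))"
        using info_density_pos[OF \<omega>, of X Y Z] by (simp add: log_def ln_mult add_divide_distrib)
    qed
  qed auto
  also have "\<dots> = pmf_cmi joint X Y Z - pmf_entropy joint cU"
    by (simp add: pmf_cmi_eq_expectation pmf_entropy_eq_expectation map_cU)
  finally show ?thesis .
qed

lemma missed_dens_tendsto_0:
  "ta < pmf_cmi joint cX1 cO (\<lambda>\<omega>. (cW1 \<omega>, cW2 \<omega>, cQ \<omega>)) - pmf_entropy joint cU \<Longrightarrow> (\<lambda>n. missed densA n ta) \<longlonglongrightarrow> 0"
  "tb < pmf_cmi joint cX1 cO (\<lambda>\<omega>. (cW2 \<omega>, cQ \<omega>)) - pmf_entropy joint cU \<Longrightarrow> (\<lambda>n. missed densB n tb) \<longlonglongrightarrow> 0"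
  "tc < pmf_cmi joint (\<lambda>\<omega>. (cW2 \<omega>, cX1 \<omega>)) cO (\<lambda>\<omega>. (cW1 \<omega>, cQ \<omega>)) - pmf_entropy joint cU \<Longrightarrow> (\<lambda>n. missed densC n tc) \<longlonglongrightarrow> 0"
  "td < pmf_cmi joint (\<lambda>\<omega>. (cW2 \<omega>, cX1 \<omega>)) cO cQ - pmf_entropy joint cU \<Longrightarrow> (\<lambda>n. missed densD n td) \<longlonglongrightarrow> 0"
  unfolding expectation_log_dens[symmetric]
  by (rule missed_tendsto_0[where d = densA, OF dens_nonneg(1) dens_pos(1)] missed_tendsto_0[where d = densB, OF dens_nonneg(2) dens_pos(2)]
        missed_tendsto_0[where d = densC, OF dens_nonneg(3) dens_pos(3)] missed_tendsto_0[where d = densD, OF dens_nonneg(4) dens_pos(4)],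
      assumption,
      simp add: densA_def densB_def densC_def densD_def cX1_def cW1_def cW2_def cQ_def cO_def cU_def case_prod_unfold)+

end

section \<open>Coding theorem\<close>

text \<open>Fourier-Motzkin elimination of the two codebook rates.\<close>

lemma rate_pair_exists:
  fixes H1 H2 A1 A2 E1 E2 G1 G2 I1 I2 :: real
  assumes "H1 < G1 - I2" "H2 < G2 - I1" "H1 + H2 < A1 + G2" "H1 + H2 < A2 + G1" "H1 + H2 < E2 + E1"
    "H1 + H2 < G1 + E2 - I1" "H1 + H2 < G2 + E1 - I2" "2 * H1 + H2 < G1 + A1 + E2" "H1 + 2 * H2 < G2 + A2 + E1"
  obtains R1 R2 where "I1 < R1" "I2 < R2" "H1 - A1 < R1" "H1 + R2 - E1 < R1"
    "H2 - A2 < R2" "H2 + R1 - E2 < R2" "R2 < G1 - H1" "R1 < G2 - H2"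
proof -
  \<comment> \<open>For each receiver, A conditions on both codewords, E on the user's own codeword
    and Q, G on Q alone. Comparing each lower with each upper bound on \<open>R1\<close> leaves the
    last two lower bounds and the second upper bound on \<open>R2\<close>; in one comparison
    \<open>R2\<close> cancels, which gives H1 + H2 < E1 + E2.\<close>
  have "max (max I2 (H2 - A2)) (max (H2 + I1 - E2) (H2 + H1 - A1 - E2)) < min (G1 - H1) (G2 - H2 + E1 - H1)"
    unfolding max_less_iff_conj min_less_iff_conj using assms by (intro conjI) linarith+
  then obtain R2 where R2: "max (max I2 (H2 - A2)) (max (H2 + I1 - E2) (H2 + H1 - A1 - E2)) < R2" "R2 < min (G1 - H1) (G2 - H2 + E1 - H1)"
    using dense by blast
  then have "max (max I1 (H1 - A1)) (H1 + R2 - E1) < min (E2 - H2 + R2) (G2 - H2)"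
    unfolding max_less_iff_conj min_less_iff_conj using assms by (intro conjI) linarith+
  then obtain R1 where "max (max I1 (H1 - A1)) (H1 + R2 - E1) < R1" "R1 < min (E2 - H2 + R2) (G2 - H2)"
    using dense by blast
  with R2 show thesis
    by (intro that[of R1 R2]) auto
qed

section \<open>From random codebooks to a deterministic code\<close>

text \<open>Without a candidate some element of \<open>A\<close> is returned, so the decoder always
  outputs a block, as \<open>is_code\<close> demands.\<close>

definition decode :: "'u set \<Rightarrow> ('u \<Rightarrow> bool) \<Rightarrow> 'u" where
  "decode A P = (if \<exists>u\<in>A. P u then SOME u. u \<in> A \<and> P u else SOME u. u \<in> A)"

lemma decode_in: "A \<noteq> {} \<Longrightarrow> decode A P \<in> A"
  using some_in_eq[of A] someI_ex[of "\<lambda>u. u \<in> A \<and> P u"] by (auto simp: decode_def)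

lemma decode_eq:
  assumes "u \<in> A" "\<not> decoding_failure A M1 M2 T C1 w2 ob u"
  shows "decode A (candidate M1 M2 T C1 w2 ob) = u"
proof -
  have u: "candidate M1 M2 T C1 w2 ob u" "\<And>u'. u' \<in> A \<Longrightarrow> candidate M1 M2 T C1 w2 ob u' \<Longrightarrow> u' = u"
    using assms by (auto simp: decoding_failure_def)
  then have "(SOME u. u \<in> A \<and> candidate M1 M2 T C1 w2 ob u) = u"
    using assms(1) by (intro some_equality) blast+
  moreover have "\<exists>u\<in>A. candidate M1 M2 T C1 w2 ob u"
    using u(1) assms(1) by blast
  ultimately show ?thesis
    by (simp only: decode_def if_True)
qed

lemma nn_integral_of_bool: "(\<integral>\<^sub>px. of_bool (Q x) \<partial>p) = emeasure (measure_pmf p) {x. Q x}"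
proof -
  have "(\<integral>\<^sub>px. of_bool (Q x) \<partial>p) = (\<integral>\<^sub>px. indicator {x. Q x} x \<partial>p)"
    by (intro nn_integral_cong) (simp add: indicator_def)
  then show ?thesis
    by simp
qed

lemma blocks_nonempty: "blocks n \<noteq> {}"
  using restrict_in_blocks[of _ n] by blast

lemma code_of_codebooks:
  fixes ch :: "'x1::finite \<Rightarrow> 'x2::finite \<Rightarrow> ('y1::finite \<times> 'y2::finite) pmf"
    and s1 :: "('u1::finite \<times> 'v1::finite) pmf" and s2 :: "('u2::finite \<times> 'v2::finite) pmf"
    and C1 :: "(nat \<Rightarrow> nat \<Rightarrow> 'w1) \<times> ((nat \<Rightarrow> 'u1) \<Rightarrow> nat \<times> (nat \<Rightarrow> 'x1))"
    and C2 :: "(nat \<Rightarrow> nat \<Rightarrow> 'w2) \<times> ((nat \<Rightarrow> 'u2) \<Rightarrow> nat \<times> (nat \<Rightarrow> 'x2))"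
    and n :: nat
  defines "u1 \<equiv> \<lambda>s :: nat \<Rightarrow> ('u1 \<times> 'v1) \<times> ('u2 \<times> 'v2). \<lambda>i\<in>{..<n}. fst (fst (s i))"
    and "u2 \<equiv> \<lambda>s :: nat \<Rightarrow> ('u1 \<times> 'v1) \<times> ('u2 \<times> 'v2). \<lambda>i\<in>{..<n}. fst (snd (s i))"
  shows "\<exists>f1 f2 g1 g2. is_code n f1 f2 g1 g2 \<and> ennreal (error_prob s1 s2 ch n f1 f2 g1 g2) \<le>
    (\<integral>\<^sub>ps. \<integral>\<^sub>py. of_bool (decoding_failure (blocks n) M1 M2 T1 C1 (fst C2) (\<lambda>i\<in>{..<n}. (snd (snd (s i)), fst (y i))) (u1 s))
        \<partial>(channel_blocks ch n (snd (snd C1 (u1 s))) (snd (snd C2 (u2 s)))) \<partial>(source_blocks s1 s2 n))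
    + (\<integral>\<^sub>ps. \<integral>\<^sub>py. of_bool (decoding_failure (blocks n) M2 M1 T2 C2 (fst C1) (\<lambda>i\<in>{..<n}. (snd (fst (s i)), snd (y i))) (u2 s))
        \<partial>(channel_blocks ch n (snd (snd C1 (u1 s))) (snd (snd C2 (u2 s)))) \<partial>(source_blocks s1 s2 n))"
proof -
  \<comment> \<open>Restricting to \<open>{..<n}\<close> puts the input into
    \<open>blocks n\<close>; the channel law reads only these entries.\<close>
  define f1 where "f1 u = (\<lambda>i\<in>{..<n}. snd (snd C1 u) i)" for u
  define f2 where "f2 u = (\<lambda>i\<in>{..<n}. snd (snd C2 u) i)" for u
  define g1 where "g1 = (\<lambda>(y1 :: nat \<Rightarrow> 'y1, v2 :: nat \<Rightarrow> 'v2). decode (blocks n) (candidate M1 M2 T1 C1 (fst C2) (\<lambda>i\<in>{..<n}. (v2 i, y1 i))))"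
  define g2 where "g2 = (\<lambda>(y2 :: nat \<Rightarrow> 'y2, v1 :: nat \<Rightarrow> 'v1). decode (blocks n) (candidate M2 M1 T2 C2 (fst C1) (\<lambda>i\<in>{..<n}. (v1 i, y2 i))))"
  have code: "is_code n f1 f2 g1 g2"
    by (auto simp: is_code_def f1_def f2_def g1_def g2_def restrict_in_blocks intro!: decode_in blocks_nonempty)
  let ?F1 = "\<lambda>s y. decoding_failure (blocks n) M1 M2 T1 C1 (fst C2) (\<lambda>i\<in>{..<n}. (snd (snd (s i)), fst (y i))) (u1 s)"
  let ?F2 = "\<lambda>s y. decoding_failure (blocks n) M2 M1 T2 C2 (fst C1) (\<lambda>i\<in>{..<n}. (snd (fst (s i)), snd (y i))) (u2 s)"
  let ?y1 = "\<lambda>y. \<lambda>i\<in>{..<n}. fst (y i :: 'y1 \<times> 'y2)" and ?y2 = "\<lambda>y. \<lambda>i\<in>{..<n}. snd (y i :: 'y1 \<times> 'y2)"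
  let ?v1 = "\<lambda>s. \<lambda>i\<in>{..<n}. snd (fst (s i :: ('u1 \<times> 'v1) \<times> ('u2 \<times> 'v2)))"
  let ?v2 = "\<lambda>s. \<lambda>i\<in>{..<n}. snd (snd (s i :: ('u1 \<times> 'v1) \<times> ('u2 \<times> 'v2)))"
  let ?E = "\<lambda>s y. (u1 s, u2 s) \<noteq> (g1 (?y1 y, ?v2 s), g2 (?y2 y, ?v1 s))"
  have E: "of_bool (?E s y) \<le> (of_bool (?F1 s y) + of_bool (?F2 s y) :: ennreal)" for s y
  proof -
    have obs: "(\<lambda>i\<in>{..<n}. (?v2 s i, ?y1 y i)) = (\<lambda>i\<in>{..<n}. (snd (snd (s i)), fst (y i)))"
      "(\<lambda>i\<in>{..<n}. (?v1 s i, ?y2 y i)) = (\<lambda>i\<in>{..<n}. (snd (fst (s i)), snd (y i)))"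
      by (auto simp: restrict_def)
    have "g1 (?y1 y, ?v2 s) = u1 s" if "\<not> ?F1 s y"
      unfolding g1_def prod.case obs by (rule decode_eq[OF _ that]) (simp add: u1_def restrict_in_blocks del: restrict_apply)
    moreover have "g2 (?y2 y, ?v1 s) = u2 s" if "\<not> ?F2 s y"
      unfolding g2_def prod.case obs by (rule decode_eq[OF _ that]) (simp add: u2_def restrict_in_blocks del: restrict_apply)
    ultimately show ?thesis
      by (cases "?F1 s y"; cases "?F2 s y") auto
  qed
  have chan: "channel_blocks ch n (f1 a) (f2 b) = channel_blocks ch n (snd (snd C1 a)) (snd (snd C2 b))" for a b
    unfolding channel_blocks_def f1_def f2_def by (intro Pi_pmf_cong) auto
  have "ennreal (error_prob s1 s2 ch n f1 f2 g1 g2)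
      = (\<integral>\<^sub>px. of_bool (fst x \<noteq> snd x) \<partial>(transmission_law s1 s2 ch n f1 f2 g1 g2))"
    unfolding error_prob_def measure_pmf.emeasure_eq_measure[symmetric] nn_integral_of_bool
    by (rule arg_cong[where f = "emeasure _"]) auto
  also have "\<dots> = (\<integral>\<^sub>ps. \<integral>\<^sub>py. of_bool (?E s y)
        \<partial>(channel_blocks ch n (f1 (u1 s)) (f2 (u2 s))) \<partial>(source_blocks s1 s2 n))"
    by (simp only: transmission_law_def Let_def nn_integral_bind_pmf nn_integral_return_pmf zero_le fst_conv snd_conv u1_def u2_def)
  also have "\<dots> \<le> (\<integral>\<^sub>ps. \<integral>\<^sub>py. of_bool (?F1 s y) + of_bool (?F2 s y)
        \<partial>(channel_blocks ch n (f1 (u1 s)) (f2 (u2 s))) \<partial>(source_blocks s1 s2 n))"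
    by (intro nn_integral_mono E)
  finally show ?thesis
    using code unfolding chan nn_integral_pmf_add by blast
qed

lemma receiver_pair:
  "receiver (pair_pmf s1 s2) (\<lambda>s. fst (fst s)) (\<lambda>s. fst (snd s)) (map_pmf fst s1) (map_pmf fst s2)"
  "receiver (pair_pmf s1 s2) (\<lambda>s. fst (snd s)) (\<lambda>s. fst (fst s)) (map_pmf fst s2) (map_pmf fst s1)"
proof -
  show 1: "receiver (pair_pmf s1 s2) (\<lambda>s. fst (fst s)) (\<lambda>s. fst (snd s)) (map_pmf fst s1) (map_pmf fst s2)"
    by standard (simp add: pair_map_pmf1 pair_map_pmf2 map_pmf_comp case_prod_unfold apfst_def apsnd_def map_prod_def)
  show "receiver (pair_pmf s1 s2) (\<lambda>s. fst (snd s)) (\<lambda>s. fst (fst s)) (map_pmf fst s2) (map_pmf fst s1)"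
    by standard (subst pair_commute_pmf, simp add: pair_map_pmf1 pair_map_pmf2 map_pmf_comp case_prod_unfold apfst_def apsnd_def map_prod_def)
qed

lemma (in receiver) user_failure_tendsto_0:
  assumes "pmf_cmi joint cU cW1 cQ < c" "c < R"
  shows "(\<lambda>n. \<integral>\<^sub>pq. \<integral>\<^sub>ps. \<integral>\<^sub>pC. (if fst (snd C (u1block n s)) < message_count R n then 0 else 1)
            \<partial>(user_codebook P1 e1 R c n q) \<partial>(sblock n) \<partial>(qblock n)) \<longlonglongrightarrow> 0"
  using user_codebook_failure_tendsto_0[of pq S e1 a1 c R] assms
  unfolding map_S(1) expectation_w_ratio by simp

text \<open>The two averages are added before anything is fixed, because one choice of time-sharing
  block and codebooks has to serve both receivers.\<close>

lemma reliably_transmissibleI: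
  fixes ch :: "'x1::finite \<Rightarrow> 'x2::finite \<Rightarrow> ('y1::finite \<times> 'y2::finite) pmf"
    and s1 :: "('u1::finite \<times> 'v1::finite) pmf" and s2 :: "('u2::finite \<times> 'v2::finite) pmf"
    and D1 :: "nat \<Rightarrow> 'q \<Rightarrow> ((nat \<Rightarrow> nat \<Rightarrow> 'w1) \<times> ((nat \<Rightarrow> 'u1) \<Rightarrow> nat \<times> (nat \<Rightarrow> 'x1))) pmf"
    and D2 :: "nat \<Rightarrow> 'q \<Rightarrow> ((nat \<Rightarrow> nat \<Rightarrow> 'w2) \<times> ((nat \<Rightarrow> 'u2) \<Rightarrow> nat \<times> (nat \<Rightarrow> 'x2))) pmf"
    and Q :: "nat \<Rightarrow> 'q pmf"
  assumes rx1: "(\<lambda>n. \<integral>\<^sub>pq. \<integral>\<^sub>pC1. \<integral>\<^sub>pC2. \<integral>\<^sub>ps. \<integral>\<^sub>py. of_bool (decoding_failure (blocks n) (M1 n) (M2 n) (T1 n q) C1 (fst C2)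
        (\<lambda>i\<in>{..<n}. (snd (snd (s i)), fst (y i))) (\<lambda>i\<in>{..<n}. fst (fst (s i))))
        \<partial>(channel_blocks ch n (snd (snd C1 (\<lambda>i\<in>{..<n}. fst (fst (s i))))) (snd (snd C2 (\<lambda>i\<in>{..<n}. fst (snd (s i))))))
        \<partial>(source_blocks s1 s2 n) \<partial>(D2 n q) \<partial>(D1 n q) \<partial>(Q n)) \<longlonglongrightarrow> 0"
    and rx2: "(\<lambda>n. \<integral>\<^sub>pq. \<integral>\<^sub>pC2. \<integral>\<^sub>pC1. \<integral>\<^sub>ps. \<integral>\<^sub>py. of_bool (decoding_failure (blocks n) (M2 n) (M1 n) (T2 n q) C2 (fst C1)
        (\<lambda>i\<in>{..<n}. (snd (fst (s i)), snd (y i))) (\<lambda>i\<in>{..<n}. fst (snd (s i))))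
        \<partial>(channel_blocks ch n (snd (snd C1 (\<lambda>i\<in>{..<n}. fst (fst (s i))))) (snd (snd C2 (\<lambda>i\<in>{..<n}. fst (snd (s i))))))
        \<partial>(source_blocks s1 s2 n) \<partial>(D1 n q) \<partial>(D2 n q) \<partial>(Q n)) \<longlonglongrightarrow> 0"
  shows "reliably_transmissible s1 s2 ch"
proof -
  define F1 where "F1 n q C1 C2 = (\<integral>\<^sub>ps. \<integral>\<^sub>py. of_bool (decoding_failure (blocks n) (M1 n) (M2 n) (T1 n q) C1 (fst C2)
        (\<lambda>i\<in>{..<n}. (snd (snd (s i)), fst (y i))) (\<lambda>i\<in>{..<n}. fst (fst (s i))))
        \<partial>(channel_blocks ch n (snd (snd C1 (\<lambda>i\<in>{..<n}. fst (fst (s i))))) (snd (snd C2 (\<lambda>i\<in>{..<n}. fst (snd (s i))))))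
        \<partial>(source_blocks s1 s2 n))" for n q and C1 :: "(nat \<Rightarrow> nat \<Rightarrow> 'w1) \<times> ((nat \<Rightarrow> 'u1) \<Rightarrow> nat \<times> (nat \<Rightarrow> 'x1))"
        and C2 :: "(nat \<Rightarrow> nat \<Rightarrow> 'w2) \<times> ((nat \<Rightarrow> 'u2) \<Rightarrow> nat \<times> (nat \<Rightarrow> 'x2))"
  define F2 where "F2 n q C1 C2 = (\<integral>\<^sub>ps. \<integral>\<^sub>py. of_bool (decoding_failure (blocks n) (M2 n) (M1 n) (T2 n q) C2 (fst C1)
        (\<lambda>i\<in>{..<n}. (snd (fst (s i)), snd (y i))) (\<lambda>i\<in>{..<n}. fst (snd (s i))))
        \<partial>(channel_blocks ch n (snd (snd C1 (\<lambda>i\<in>{..<n}. fst (fst (s i))))) (snd (snd C2 (\<lambda>i\<in>{..<n}. fst (snd (s i))))))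
        \<partial>(source_blocks s1 s2 n))" for n q and C1 :: "(nat \<Rightarrow> nat \<Rightarrow> 'w1) \<times> ((nat \<Rightarrow> 'u1) \<Rightarrow> nat \<times> (nat \<Rightarrow> 'x1))"
        and C2 :: "(nat \<Rightarrow> nat \<Rightarrow> 'w2) \<times> ((nat \<Rightarrow> 'u2) \<Rightarrow> nat \<times> (nat \<Rightarrow> 'x2))"
  define E where "E n = (\<integral>\<^sub>pq. \<integral>\<^sub>pC1. \<integral>\<^sub>pC2. F1 n q C1 C2 + F2 n q C1 C2 \<partial>(D2 n q) \<partial>(D1 n q) \<partial>(Q n))" for n
  have "E = (\<lambda>n. (\<integral>\<^sub>pq. \<integral>\<^sub>pC1. \<integral>\<^sub>pC2. F1 n q C1 C2 \<partial>(D2 n q) \<partial>(D1 n q) \<partial>(Q n))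
      + (\<integral>\<^sub>pq. \<integral>\<^sub>pC2. \<integral>\<^sub>pC1. F2 n q C1 C2 \<partial>(D1 n q) \<partial>(D2 n q) \<partial>(Q n)))"
    unfolding E_def nn_integral_pmf_add by (subst (2) nn_integral_pmf_swap[where p = "D1 _ _"]) (rule refl)
  moreover have "(\<lambda>n. (\<integral>\<^sub>pq. \<integral>\<^sub>pC1. \<integral>\<^sub>pC2. F1 n q C1 C2 \<partial>(D2 n q) \<partial>(D1 n q) \<partial>(Q n))
      + (\<integral>\<^sub>pq. \<integral>\<^sub>pC2. \<integral>\<^sub>pC1. F2 n q C1 C2 \<partial>(D1 n q) \<partial>(D2 n q) \<partial>(Q n))) \<longlonglongrightarrow> 0 + 0"
    using rx1 rx2 unfolding F1_def F2_def by (rule tendsto_add)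
  ultimately have E: "E \<longlonglongrightarrow> 0"
    by simp
  have "\<exists>f1 f2 g1 g2. is_code n f1 f2 g1 g2 \<and> ennreal (error_prob s1 s2 ch n f1 f2 g1 g2) \<le> E n" for n
  proof -
    obtain q where "(\<integral>\<^sub>pC1. \<integral>\<^sub>pC2. F1 n q C1 C2 + F2 n q C1 C2 \<partial>(D2 n q) \<partial>(D1 n q)) \<le> E n"
      by (rule nn_integral_pmf_le_imp_ex[of "Q n"]) (auto simp: E_def)
    then obtain C1 where "(\<integral>\<^sub>pC2. F1 n q C1 C2 + F2 n q C1 C2 \<partial>(D2 n q)) \<le> E n"
      by (rule nn_integral_pmf_le_imp_ex)
    then obtain C2 where C2: "F1 n q C1 C2 + F2 n q C1 C2 \<le> E n"
      by (rule nn_integral_pmf_le_imp_ex)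
    obtain f1 f2 g1 g2 where "is_code n f1 f2 g1 g2" "ennreal (error_prob s1 s2 ch n f1 f2 g1 g2) \<le> F1 n q C1 C2 + F2 n q C1 C2"
      using code_of_codebooks[where n = n and ?s1.0 = s1 and ?s2.0 = s2 and ch = ch and ?M1.0 = "M1 n" and ?M2.0 = "M2 n"
          and ?T1.0 = "T1 n q" and ?T2.0 = "T2 n q" and ?C1.0 = C1 and ?C2.0 = C2] unfolding F1_def F2_def by blast
    with C2 show ?thesis
      by (meson order.trans)
  qed
  then obtain f1 f2 g1 g2 where code: "\<And>n. is_code n (f1 n) (f2 n) (g1 n) (g2 n)"
    and err: "\<And>n. ennreal (error_prob s1 s2 ch n (f1 n) (f2 n) (g1 n) (g2 n)) \<le> E n"
    by metis
  have "(\<lambda>n. ennreal (error_prob s1 s2 ch n (f1 n) (f2 n) (g1 n) (g2 n))) \<longlonglongrightarrow> 0"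
    by (rule tendsto_sandwich[OF always_eventually always_eventually tendsto_const E]) (use err in auto)
  then have "(\<lambda>n. error_prob s1 s2 ch n (f1 n) (f2 n) (g1 n) (g2 n)) \<longlonglongrightarrow> 0"
    using tendsto_ennreal_iff[of "\<lambda>n. error_prob s1 s2 ch n (f1 n) (f2 n) (g1 n) (g2 n)" sequentially 0]
    by (simp add: error_prob_def)
  with code show ?thesis
    unfolding reliably_transmissible_def by blast
qed

theorem theorem2:
  fixes ch :: "'x1::finite \<Rightarrow> 'x2::finite \<Rightarrow> ('y1::finite \<times> 'y2::finite) pmf"
    and s1 :: "('u1::finite \<times> 'v1::finite) pmf"
    and s2 :: "('u2::finite \<times> 'v2::finite) pmf"
    and pq :: "'q::finite pmf"
    and e1 :: "'u1 \<Rightarrow> 'q \<Rightarrow> ('w1::finite \<times> 'x1) pmf"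
    and e2 :: "'u2 \<Rightarrow> 'q \<Rightarrow> ('w2::finite \<times> 'x2) pmf"
  defines "J \<equiv> joint_law pq s1 s2 e1 e2 ch"
  assumes "pmf_entropy J rvU1 < pmf_cmi J rvX1 (rvV2 \<otimes>\<^sub>r rvY1) (rvW2 \<otimes>\<^sub>r rvQ)"
    and "pmf_entropy J rvU2 < pmf_cmi J rvX2 (rvV1 \<otimes>\<^sub>r rvY2) (rvW1 \<otimes>\<^sub>r rvQ)"
    and "pmf_entropy J rvU1 < pmf_cmi J (rvW2 \<otimes>\<^sub>r rvX1) (rvV2 \<otimes>\<^sub>r rvY1) rvQ - pmf_cmi J rvU2 rvW2 rvQ"
    and "pmf_entropy J rvU2 < pmf_cmi J (rvW1 \<otimes>\<^sub>r rvX2) (rvV1 \<otimes>\<^sub>r rvY2) rvQ - pmf_cmi J rvU1 rvW1 rvQ"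
    and "pmf_entropy J rvU1 + pmf_entropy J rvU2
           < pmf_cmi J rvX1 (rvV2 \<otimes>\<^sub>r rvY1) (rvW1 \<otimes>\<^sub>r rvW2 \<otimes>\<^sub>r rvQ)
             + pmf_cmi J (rvW1 \<otimes>\<^sub>r rvX2) (rvV1 \<otimes>\<^sub>r rvY2) rvQ"
    and "pmf_entropy J rvU1 + pmf_entropy J rvU2
           < pmf_cmi J rvX2 (rvV1 \<otimes>\<^sub>r rvY2) (rvW1 \<otimes>\<^sub>r rvW2 \<otimes>\<^sub>r rvQ)
             + pmf_cmi J (rvW2 \<otimes>\<^sub>r rvX1) (rvV2 \<otimes>\<^sub>r rvY1) rvQ"
    and "pmf_entropy J rvU1 + pmf_entropy J rvU2
           < pmf_cmi J (rvW1 \<otimes>\<^sub>r rvX2) (rvV1 \<otimes>\<^sub>r rvY2) (rvW2 \<otimes>\<^sub>r rvQ)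
             + pmf_cmi J (rvW2 \<otimes>\<^sub>r rvX1) (rvV2 \<otimes>\<^sub>r rvY1) (rvW1 \<otimes>\<^sub>r rvQ)"
    and "pmf_entropy J rvU1 + pmf_entropy J rvU2
           < pmf_cmi J (rvW2 \<otimes>\<^sub>r rvX1) (rvV2 \<otimes>\<^sub>r rvY1) rvQ
             + pmf_cmi J (rvW1 \<otimes>\<^sub>r rvX2) (rvV1 \<otimes>\<^sub>r rvY2) (rvW2 \<otimes>\<^sub>r rvQ)
             - pmf_cmi J rvU1 rvW1 rvQ"
    and "pmf_entropy J rvU1 + pmf_entropy J rvU2
           < pmf_cmi J (rvW1 \<otimes>\<^sub>r rvX2) (rvV1 \<otimes>\<^sub>r rvY2) rvQ
             + pmf_cmi J (rvW2 \<otimes>\<^sub>r rvX1) (rvV2 \<otimes>\<^sub>r rvY1) (rvW1 \<otimes>\<^sub>r rvQ)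
             - pmf_cmi J rvU2 rvW2 rvQ"
    and "2 * pmf_entropy J rvU1 + pmf_entropy J rvU2
           < pmf_cmi J (rvW2 \<otimes>\<^sub>r rvX1) (rvV2 \<otimes>\<^sub>r rvY1) rvQ
             + pmf_cmi J rvX1 (rvV2 \<otimes>\<^sub>r rvY1) (rvW1 \<otimes>\<^sub>r rvW2 \<otimes>\<^sub>r rvQ)
             + pmf_cmi J (rvW1 \<otimes>\<^sub>r rvX2) (rvV1 \<otimes>\<^sub>r rvY2) (rvW2 \<otimes>\<^sub>r rvQ)"
    and "pmf_entropy J rvU1 + 2 * pmf_entropy J rvU2
           < pmf_cmi J (rvW1 \<otimes>\<^sub>r rvX2) (rvV1 \<otimes>\<^sub>r rvY2) rvQ
             + pmf_cmi J rvX2 (rvV1 \<otimes>\<^sub>r rvY2) (rvW1 \<otimes>\<^sub>r rvW2 \<otimes>\<^sub>r rvQ)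
             + pmf_cmi J (rvW2 \<otimes>\<^sub>r rvX1) (rvV2 \<otimes>\<^sub>r rvY1) (rvW1 \<otimes>\<^sub>r rvQ)"
  shows "reliably_transmissible s1 s2 ch"
proof -
  let ?S = "pair_pmf s1 s2" and ?U1 = "\<lambda>s :: ('u1 \<times> 'v1) \<times> ('u2 \<times> 'v2). fst (fst s)"
    and ?U2 = "\<lambda>s :: ('u1 \<times> 'v1) \<times> ('u2 \<times> 'v2). fst (snd s)"
  interpret A: receiver pq ?S ?U1 ?U2 "map_pmf fst s1" "map_pmf fst s2" e1 e2 ch
    "\<lambda>s (y :: 'y1 \<times> 'y2). (snd (snd s), fst y)"
    by (rule receiver_pair)
  \<comment> \<open>The users are exchanged, and with them the arguments of the channel, while the
    output pair keeps its order; so this receiver observes \<open>snd y\<close>.\<close>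
  interpret B: receiver pq ?S ?U2 ?U1 "map_pmf fst s2" "map_pmf fst s1" e2 e1 "\<lambda>x2 x1. ch x1 x2"
    "\<lambda>s (y :: 'y1 \<times> 'y2). (snd (fst s), snd y)"
    by (rule receiver_pair)
  have A_joint: "A.joint = map_pmf (\<lambda>(q, u1, v1, u2, v2, w1, w2, x1, x2, y1, y2). (q, ((u1, v1), (u2, v2)), (w1, x1), (w2, x2), (y1, y2))) J"
    unfolding A.joint_def J_def joint_law_def
    by (rule pmf_eqI_nn_integral) (simp add: nn_integral_pair_pmf' case_prod_unfold)
  \<comment> \<open>Here user 2 draws its codeword letter and input before user 1, so one exchange
    of independent draws is needed.\<close>
  have B_joint: "B.joint = map_pmf (\<lambda>(q, u1, v1, u2, v2, w1, w2, x1, x2, y1, y2). (q, ((u1, v1), (u2, v2)), (w2, x2), (w1, x1), (y1, y2))) J"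
    unfolding B.joint_def J_def joint_law_def
    by (rule pmf_eqI_nn_integral)
       (simp add: nn_integral_pair_pmf' case_prod_unfold, subst nn_integral_pmf_swap[where q = "e1 _ _"], rule refl)
  note defs = fun_eq_iff rv_pair_def rvQ_def rvU1_def rvV1_def rvU2_def rvV2_def rvW1_def rvW2_def rvX1_def rvX2_def rvY1_def rvY2_def
  define H1 where "H1 = pmf_entropy J rvU1"
  define H2 where "H2 = pmf_entropy J rvU2"
  define I1 where "I1 = pmf_cmi J rvU1 rvW1 rvQ"
  define I2 where "I2 = pmf_cmi J rvU2 rvW2 rvQ"
  have A_cmi: "pmf_entropy A.joint A.cU = H1" "pmf_cmi A.joint A.cU A.cW1 A.cQ = I1"
    "pmf_cmi A.joint A.cX1 A.cO (\<lambda>\<omega>. (A.cW1 \<omega>, A.cW2 \<omega>, A.cQ \<omega>)) = pmf_cmi J rvX1 (rvV2 \<otimes>\<^sub>r rvY1) (rvW1 \<otimes>\<^sub>r rvW2 \<otimes>\<^sub>r rvQ)"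
    "pmf_cmi A.joint A.cX1 A.cO (\<lambda>\<omega>. (A.cW2 \<omega>, A.cQ \<omega>)) = pmf_cmi J rvX1 (rvV2 \<otimes>\<^sub>r rvY1) (rvW2 \<otimes>\<^sub>r rvQ)"
    "pmf_cmi A.joint (\<lambda>\<omega>. (A.cW2 \<omega>, A.cX1 \<omega>)) A.cO (\<lambda>\<omega>. (A.cW1 \<omega>, A.cQ \<omega>)) = pmf_cmi J (rvW2 \<otimes>\<^sub>r rvX1) (rvV2 \<otimes>\<^sub>r rvY1) (rvW1 \<otimes>\<^sub>r rvQ)"
    "pmf_cmi A.joint (\<lambda>\<omega>. (A.cW2 \<omega>, A.cX1 \<omega>)) A.cO A.cQ = pmf_cmi J (rvW2 \<otimes>\<^sub>r rvX1) (rvV2 \<otimes>\<^sub>r rvY1) rvQ"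
    unfolding A_joint pmf_cmi_map pmf_entropy_map H1_def I1_def
    by (rule arg_cong3[where f = "pmf_cmi J"] arg_cong[where f = "pmf_entropy J"]; auto simp: defs A.c_simps)+
  have swap: "rvW1 \<otimes>\<^sub>r rvW2 \<otimes>\<^sub>r rvQ = (\<lambda>\<omega>. (\<lambda>(w2, w1, q). (w1, w2, q)) ((rvW2 \<otimes>\<^sub>r rvW1 \<otimes>\<^sub>r rvQ) \<omega>))"
    by (simp add: rv_pair_def)
  have B_cmi: "pmf_entropy B.joint B.cU = H2" "pmf_cmi B.joint B.cU B.cW1 B.cQ = I2"
    "pmf_cmi B.joint B.cX1 B.cO (\<lambda>\<omega>. (B.cW1 \<omega>, B.cW2 \<omega>, B.cQ \<omega>)) = pmf_cmi J rvX2 (rvV1 \<otimes>\<^sub>r rvY2) (rvW2 \<otimes>\<^sub>r rvW1 \<otimes>\<^sub>r rvQ)"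
    "pmf_cmi B.joint B.cX1 B.cO (\<lambda>\<omega>. (B.cW2 \<omega>, B.cQ \<omega>)) = pmf_cmi J rvX2 (rvV1 \<otimes>\<^sub>r rvY2) (rvW1 \<otimes>\<^sub>r rvQ)"
    "pmf_cmi B.joint (\<lambda>\<omega>. (B.cW2 \<omega>, B.cX1 \<omega>)) B.cO (\<lambda>\<omega>. (B.cW1 \<omega>, B.cQ \<omega>)) = pmf_cmi J (rvW1 \<otimes>\<^sub>r rvX2) (rvV1 \<otimes>\<^sub>r rvY2) (rvW2 \<otimes>\<^sub>r rvQ)"
    "pmf_cmi B.joint (\<lambda>\<omega>. (B.cW2 \<omega>, B.cX1 \<omega>)) B.cO B.cQ = pmf_cmi J (rvW1 \<otimes>\<^sub>r rvX2) (rvV1 \<otimes>\<^sub>r rvY2) rvQ"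
    unfolding B_joint pmf_cmi_map pmf_entropy_map H2_def I2_def
    by (rule arg_cong3[where f = "pmf_cmi J"] arg_cong[where f = "pmf_entropy J"]; auto simp: defs B.c_simps)+
  have B_A: "pmf_cmi J rvX2 (rvV1 \<otimes>\<^sub>r rvY2) (rvW2 \<otimes>\<^sub>r rvW1 \<otimes>\<^sub>r rvQ) = pmf_cmi J rvX2 (rvV1 \<otimes>\<^sub>r rvY2) (rvW1 \<otimes>\<^sub>r rvW2 \<otimes>\<^sub>r rvQ)"
    unfolding swap by (rule pmf_cmi_inj_cond[symmetric]) (auto simp: inj_def)
  obtain R1 R2 where R: "I1 < R1" "I2 < R2"
    "H1 - pmf_cmi J rvX1 (rvV2 \<otimes>\<^sub>r rvY1) (rvW1 \<otimes>\<^sub>r rvW2 \<otimes>\<^sub>r rvQ) < R1"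
    "H1 + R2 - pmf_cmi J (rvW2 \<otimes>\<^sub>r rvX1) (rvV2 \<otimes>\<^sub>r rvY1) (rvW1 \<otimes>\<^sub>r rvQ) < R1"
    "H2 - pmf_cmi J rvX2 (rvV1 \<otimes>\<^sub>r rvY2) (rvW1 \<otimes>\<^sub>r rvW2 \<otimes>\<^sub>r rvQ) < R2"
    "H2 + R1 - pmf_cmi J (rvW1 \<otimes>\<^sub>r rvX2) (rvV1 \<otimes>\<^sub>r rvY2) (rvW2 \<otimes>\<^sub>r rvQ) < R2"
    "R2 < pmf_cmi J (rvW2 \<otimes>\<^sub>r rvX1) (rvV2 \<otimes>\<^sub>r rvY1) rvQ - H1"
    "R1 < pmf_cmi J (rvW1 \<otimes>\<^sub>r rvX2) (rvV1 \<otimes>\<^sub>r rvY2) rvQ - H2"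
    using assms(4-12) unfolding H1_def[symmetric] H2_def[symmetric] I1_def[symmetric] I2_def[symmetric]
    by (rule rate_pair_exists)
  have R0: "0 \<le> R1" "0 \<le> R2"
    using R(1,2) pmf_cmi_nonneg[of J rvU1 rvW1 rvQ] pmf_cmi_nonneg[of J rvU2 rvW2 rvQ] by (auto simp: I1_def I2_def)
  obtain c1 where c1: "I1 < c1" "c1 < R1"
    using dense[OF R(1)] by blast
  obtain c2 where c2: "I2 < c2" "c2 < R2"
    using dense[OF R(2)] by blast
  \<comment> \<open>Each threshold exponent is placed between what the union bound over confusions
    demands and the mean log-density of the true tuple.\<close>
  have "- R1 < pmf_cmi J rvX1 (rvV2 \<otimes>\<^sub>r rvY1) (rvW1 \<otimes>\<^sub>r rvW2 \<otimes>\<^sub>r rvQ) - H1"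
    "0 < pmf_cmi J rvX1 (rvV2 \<otimes>\<^sub>r rvY1) (rvW2 \<otimes>\<^sub>r rvQ) - H1"
    "R2 - R1 < pmf_cmi J (rvW2 \<otimes>\<^sub>r rvX1) (rvV2 \<otimes>\<^sub>r rvY1) (rvW1 \<otimes>\<^sub>r rvQ) - H1"
    using R assms(2) by (simp_all add: H1_def)
  then obtain ta tb tc td where t: "- R1 < ta" "ta < pmf_cmi J rvX1 (rvV2 \<otimes>\<^sub>r rvY1) (rvW1 \<otimes>\<^sub>r rvW2 \<otimes>\<^sub>r rvQ) - H1"
    "0 < tb" "tb < pmf_cmi J rvX1 (rvV2 \<otimes>\<^sub>r rvY1) (rvW2 \<otimes>\<^sub>r rvQ) - H1"
    "R2 - R1 < tc" "tc < pmf_cmi J (rvW2 \<otimes>\<^sub>r rvX1) (rvV2 \<otimes>\<^sub>r rvY1) (rvW1 \<otimes>\<^sub>r rvQ) - H1"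
    "R2 < td" "td < pmf_cmi J (rvW2 \<otimes>\<^sub>r rvX1) (rvV2 \<otimes>\<^sub>r rvY1) rvQ - H1"
    using dense R(7) by metis
  have "- R2 < pmf_cmi J rvX2 (rvV1 \<otimes>\<^sub>r rvY2) (rvW1 \<otimes>\<^sub>r rvW2 \<otimes>\<^sub>r rvQ) - H2"
    "0 < pmf_cmi J rvX2 (rvV1 \<otimes>\<^sub>r rvY2) (rvW1 \<otimes>\<^sub>r rvQ) - H2"
    "R1 - R2 < pmf_cmi J (rvW1 \<otimes>\<^sub>r rvX2) (rvV1 \<otimes>\<^sub>r rvY2) (rvW2 \<otimes>\<^sub>r rvQ) - H2"
    using R assms(3) by (simp_all add: H2_def)
  then obtain ta' tb' tc' td' where t': "- R2 < ta'" "ta' < pmf_cmi J rvX2 (rvV1 \<otimes>\<^sub>r rvY2) (rvW1 \<otimes>\<^sub>r rvW2 \<otimes>\<^sub>r rvQ) - H2"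
    "0 < tb'" "tb' < pmf_cmi J rvX2 (rvV1 \<otimes>\<^sub>r rvY2) (rvW1 \<otimes>\<^sub>r rvQ) - H2"
    "R1 - R2 < tc'" "tc' < pmf_cmi J (rvW1 \<otimes>\<^sub>r rvX2) (rvV1 \<otimes>\<^sub>r rvY2) (rvW2 \<otimes>\<^sub>r rvQ) - H2"
    "R1 < td'" "td' < pmf_cmi J (rvW1 \<otimes>\<^sub>r rvX2) (rvV1 \<otimes>\<^sub>r rvY2) rvQ - H2"
    using dense R(8) by metis
  \<comment> \<open>An encoding failure involves only the user's own codebook, so these two limits
    serve both receivers.\<close>
  note fail1 = A.user_failure_tendsto_0[unfolded A_cmi, OF c1]
  note fail2 = B.user_failure_tendsto_0[unfolded B_cmi, OF c2]
  have "A.average_error ta tb tc td R1 c1 R2 c2 \<longlonglongrightarrow> 0"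
    by (rule A.average_error_tendsto_0[OF fail1 fail2 A.missed_dens_tendsto_0]) (use R0 t in \<open>simp_all add: A_cmi\<close>)
  moreover have "B.average_error ta' tb' tc' td' R2 c2 R1 c1 \<longlonglongrightarrow> 0"
    by (rule B.average_error_tendsto_0[OF fail2 fail1 B.missed_dens_tendsto_0]) (use R0 t' in \<open>simp_all add: B_cmi B_A\<close>)
  ultimately show ?thesis
    unfolding A.average_error_def B.average_error_def A.chan_def B.chan_def A.obs_def B.obs_def
      channel_blocks_def[symmetric] source_blocks_def[symmetric]
    by (rule reliably_transmissibleI)
qed

end
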